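(* Let $1<p<\infty$, let $n\ge 2$ be an integer, let $a_1,\dots,a_n>0$, and let $\mathbb B_p^n(a)=\{x\in\mathbb R^n:\sum_{r=1}^n|a_rx_r|^p\le 1\}$. For $t>0$ and $\nu\in\mathbb C$ with $\operatorname{Re}\nu>-1$ put $$ \mathcal F_p(t;\nu)=\int_{\mathbb R}|y|^\nu e^{-|y|^p-t|y|^{2p-2}}\,dy . $$ Let $m\in\{1,\dots,n\}$, let $\lambda_1,\dots,\lambda_n\in\mathbb C$, and put $\Lambda:=\sum_{k=1}^n\lambda_k$. Assume that $\operatorname{Re}\Lambda>m-n-p$ and that - if $m=1$: $\operatorname{Re}\lambda_k>-1$ for all $k$; - if $2\le m\le n-1$: $\operatorname{Re}\lambda_k>\max\{-1,1-p\}$ for all $k$; - if $m=n$: $\operatorname{Re}\lambda_k>1-p$ for all $k$. Then $$ \int_{\partial\mathbb B_p^n(a)}\prod_{k=1}^n|x_k|^{\lambda_k}\,d\Phi_{n-m}(\mathbb B_p^n(a),x) =\frac{p(p-1)^{m-1}}{m\,\kappa_m\,\Gamma\!\left(\frac{n+\Lambda+p-m}{p}\right)\Gamma\!\left(\frac m2\right)}\Bigl(\prod_{k=1}^na_k^{-\lambda_k-1}\Bigr)\times $$ $$ \sum_{i=1}^n\ \sum_{\substack{I\subseteq\{1,\dots,n\}\setminus\{i\}\\|I|=m-1}}\int_0^\infty\theta^{\frac m2-1}\,a_i^2\,\mathcal F_p(\theta a_i^2;\lambda_i+2p-2)\prod_{j\in I}\Bigl(a_j^2\,\mathcal F_p(\theta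 a_j^2;\lambda_j+p-2)\Bigr)\prod_{k\notin I\cup\{i\}}\mathcal F_p(\theta a_k^2;\lambda_k)\,d\theta . $$
   Context: $\kappa_m=\pi^{m/2}/\Gamma(1+\frac m2)$ is the volume of the $m$-dimensional Euclidean unit ball. In the last product $k$ ranges over $\{1,\dots,n\}\setminus(I\cup\{i\})$; empty products equal $1$. Curvature measures: let $K\subseteq\mathbb R^n$ be a convex body, $p_K(y)$ the metric projection of $y$ onto $K$, and $\mathbb B_2^n$ the Euclidean unit ball. For Borel $B\subseteq\partial K$ and $\rho\ge 0$ put $A_\rho(K,B)=\{y\in(K+\rho\mathbb B_2^n)\setminus K:\ p_K(y)\in B\}$. The curvature measures $\Phi_0(K,\cdot),\dots,\Phi_{n-1}(K,\cdot)$ are the unique finite Borel measures on $\partial K$ satisfying $\mathrm{Vol}_n(A_\rho(K,B))=\sum_{j=0}^{n-1}\kappa_{n-j}\rho^{n-j}\Phi_j(K,B)$ for all $\rho\ge 0$ and all Borel $B\subseteq\partial K$. *)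

theory Defs
  imports "HOL-Analysis.Analysis"
begin

definition local_parallel_set :: "'a::euclidean_space set \<Rightarrow> real \<Rightarrow> 'a set \<Rightarrow> 'a set" where
  "local_parallel_set K \<rho> B =
     {y \<in> {x + z | x z. x \<in> K \<and> z \<in> cball 0 \<rho>} - K. closest_point K y \<in> B}"

text \<open>The measures \<open>\<Phi> 0, \<dots>, \<Phi> (n - 1)\<close>, where \<open>n\<close> is the dimension of the space, are finite
  Borel measures on the boundary of \<open>K\<close> satisfying the local Steiner formula.
  The constant \<open>unit_ball_vol (real m)\<close> is \<open>\<pi>\<^bsup>m/2\<^esup> / \<Gamma>(1 + m/2)\<close>.\<close>

definition steiner_measures :: "'a::euclidean_space set \<Rightarrow> (nat \<Rightarrow> 'a measure) \<Rightarrow> bool" where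
  "steiner_measures K \<Phi> \<longleftrightarrow>
     (\<forall>j<DIM('a). sets (\<Phi> j) = sets (restrict_space borel (frontier K)) \<and> finite_measure (\<Phi> j)) \<and>
     (\<forall>\<rho>\<ge>0. \<forall>B\<in>sets (restrict_space borel (frontier K)).
        measure lborel (local_parallel_set K \<rho> B) =
          (\<Sum>j<DIM('a). unit_ball_vol (real (DIM('a) - j)) * \<rho> ^ (DIM('a) - j) * measure (\<Phi> j) B))"

text \<open>Meaningful for a convex body \<open>K\<close> and \<open>j < DIM('a)\<close>; uniqueness, which justifies the
  definite description, is proved below.\<close>

definition curvature_measure :: "'a::euclidean_space set \<Rightarrow> nat \<Rightarrow> 'a measure" where
  "curvature_measure K j = (THE \<mu>. \<exists>\<Phi>. steiner_measures K \<Phi> \<and> \<Phi> j = \<mu>)"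

lemma steiner_measures_unique:
  fixes K :: "'a::euclidean_space set"
  assumes "steiner_measures K \<Phi>" "steiner_measures K \<Psi>" and j: "j < DIM('a)"
  shows "\<Phi> j = \<Psi> j"
proof (rule measure_eqI)
  note \<Phi> = assms(1)[unfolded steiner_measures_def]
  note \<Psi> = assms(2)[unfolded steiner_measures_def]
  show "sets (\<Phi> j) = sets (\<Psi> j)" using conjunct1[OF \<Phi>] conjunct1[OF \<Psi>] j by simp
  fix B assume "B \<in> sets (\<Phi> j)"
  then have B: "B \<in> sets (restrict_space borel (frontier K))" using conjunct1[OF \<Phi>] j by simp
  let ?n = "DIM('a)"
  define c where "c i = (if i = 0 then 0 else
     unit_ball_vol (real i) * (measure (\<Phi> (?n - i)) B - measure (\<Psi> (?n - i)) B))" for i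
  have zero: "(\<Sum>i\<le>?n. c i * \<rho> ^ i) = 0" if "\<rho> \<ge> 0" for \<rho>
  proof -
    have "(\<Sum>i\<le>?n. c i * \<rho> ^ i) = (\<Sum>i\<in>{1..?n}. c i * \<rho> ^ i)"
      by (rule sum.mono_neutral_right) (auto simp: c_def)
    also have "\<dots> = (\<Sum>j<?n. c (?n - j) * \<rho> ^ (?n - j))"
      by (rule sum.reindex_bij_witness[of _ "\<lambda>j. ?n - j" "\<lambda>i. ?n - i"]) auto
    also have "\<dots> = (\<Sum>j<?n. unit_ball_vol (real (?n - j)) * \<rho> ^ (?n - j) * measure (\<Phi> j) B) -
        (\<Sum>j<?n. unit_ball_vol (real (?n - j)) * \<rho> ^ (?n - j) * measure (\<Psi> j) B)"
      unfolding sum_subtractf[symmetric]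
      by (rule sum.cong) (auto simp: c_def algebra_simps)
    also have "\<dots> = 0"
    proof -
      have "measure lborel (local_parallel_set K \<rho> B) =
          (\<Sum>j<?n. unit_ball_vol (real (?n - j)) * \<rho> ^ (?n - j) * measure (\<Phi> j) B)"
        using conjunct2[OF \<Phi>] that B by blast
      moreover have "measure lborel (local_parallel_set K \<rho> B) =
          (\<Sum>j<?n. unit_ball_vol (real (?n - j)) * \<rho> ^ (?n - j) * measure (\<Psi> j) B)"
        using conjunct2[OF \<Psi>] that B by blast
      ultimately show ?thesis by linarith
    qed
    finally show ?thesis .
  qed
  have "c (?n - j) = 0"
  proof (rule ccontr)
    assume "c (?n - j) \<noteq> 0"
    then have "finite {\<rho>. (\<Sum>i\<le>?n. c i * \<rho> ^ i) = 0}"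
      by (rule polyfun_roots_finite) simp
    moreover have "{0::real..} \<subseteq> {\<rho>. (\<Sum>i\<le>?n. c i * \<rho> ^ i) = 0}" using zero by auto
    ultimately show False using infinite_Ici finite_subset by blast
  qed
  moreover have "unit_ball_vol (real (?n - j)) > 0" by simp
  ultimately have "measure (\<Phi> j) B = measure (\<Psi> j) B"
    using j by (auto simp: c_def simp del: of_nat_diff split: if_splits)
  then show "emeasure (\<Phi> j) B = emeasure (\<Psi> j) B"
    using conjunct1[OF \<Phi>] conjunct1[OF \<Psi>] j
    by (simp add: finite_measure.emeasure_eq_measure)
qed

lemma curvature_measure_eq:
  fixes K :: "'a::euclidean_space set"
  assumes "steiner_measures K \<Phi>" "j < DIM('a)"
  shows "curvature_measure K j = \<Phi> j"
  unfolding curvature_measure_def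
proof (rule the_equality)
  show "\<exists>\<Psi>. steiner_measures K \<Psi> \<and> \<Psi> j = \<Phi> j" using assms(1) by blast
  show "\<mu> = \<Phi> j" if "\<exists>\<Psi>. steiner_measures K \<Psi> \<and> \<Psi> j = \<mu>" for \<mu>
    using that steiner_measures_unique[OF _ assms(1) assms(2)] by blast
qed

definition weighted_lp_ball :: "real \<Rightarrow> ('n::finite \<Rightarrow> real) \<Rightarrow> (real ^ 'n) set" where
  "weighted_lp_ball p a = {x. (\<Sum>r\<in>UNIV. \<bar>a r * x $ r\<bar> powr p) \<le> 1}"

text \<open>The library has \<open>0 powr \<nu> = 0\<close> for every complex \<open>\<nu>\<close>, also \<open>\<nu> = 0\<close>; in the
  integrals here this affects only null sets.\<close>

definition F_integral :: "real \<Rightarrow> real \<Rightarrow> complex \<Rightarrow> complex" where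
  "F_integral p t \<nu> =
     (LINT y|lborel. complex_of_real \<bar>y\<bar> powr \<nu> *
        complex_of_real (exp (- (\<bar>y\<bar> powr p) - t * \<bar>y\<bar> powr (2 * p - 2))))"

end

theory Submission
  imports Defs
begin

text \<open>
  The unnormalized outer normal of the ball \<open>{\<psi> \<le> 1}\<close>, \<open>\<psi> z = (\<Sum>k. \<bar>a\<^sub>k z\<^sub>k\<bar> powr p)\<close>, at a boundary
  point \<open>x\<close> is \<open>N x = \<nabla>\<psi> x / p\<close>. Points outside the ball are written \<open>x + s N x\<close> with \<open>\<psi> x = 1\<close> and
  \<open>s > 0\<close>; with respect to the cone measure on the boundary the volume element is
  \<open>(\<Sum>i. (N x)\<^sub>i\<^sup>2 (\<Prod>j\<noteq>i. 1 + s d\<^sub>j x))\<close>, where \<open>d\<^sub>j\<close> is the derivative of the \<open>j\<close>-th component of \<open>N\<close>.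
  Expanding in \<open>s\<close> and integrating over \<open>s \<le> \<rho> / \<bar>N x\<bar>\<close> gives the local Steiner formula and shows
  that \<open>\<Phi>\<^bsub>n-m\<^esub>\<close> has density \<open>(\<Sum>i. \<Sum>I. (N x)\<^sub>i\<^sup>2 (\<Prod>j\<in>I. d\<^sub>j x)) / (m \<kappa>\<^sub>m \<bar>N x\<bar>\<^sup>m)\<close> with respect to the
  cone measure. Since the integrand is homogeneous of degree \<open>\<Lambda> + p - m\<close>, its integral against the cone
  measure is a Gamma factor times an integral over the whole space with weight \<open>exp (- \<psi> z)\<close>. Writing
  \<open>\<bar>N z\<bar> powr -m\<close> as a Gamma integral over \<open>\<theta>\<close> then makes all coordinates separate.
\<close>

section \<open>Lebesgue measure in coordinates and substitution\<close>

text \<open>For 1 < p < 2 the map z + \<tau> N z is not differentiable at points with a vanishing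
  coordinate. It is therefore handled one coordinate at a time through monotonicity, and the
  coordinate hyperplanes are discarded as null sets. The hypotheses on \<lambda> are one-dimensional
  integrability conditions: in the term for i and I, coordinate k carries the exponent
  \<open>\<lambda>\<^sub>k + 2p - 2\<close> if k = i, \<open>\<lambda>\<^sub>k + p - 2\<close> if k
  lies in I and \<open>\<lambda>\<^sub>k\<close> otherwise, and each needs real part above -1. The
  hypothesis on \<Lambda> is convergence at 0 of the radial integral of r powr (n + \<Lambda> + p -
  m - 1) times exp (- r powr p). In the constant, the factor p divided by the Gamma value containing
  \<Lambda> undoes that radial integral, Gamma (m/2) undoes the \<theta> integral, the power of p -
  1 comes from the m - 1 factors \<open>d\<^sub>j\<close>, and the powers of
  \<open>a\<^sub>k\<close> come from substituting \<open>a\<^sub>k z\<^sub>k\<close>. Curvature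
  measures are given by a definite description, so the explicit densities also have to supply
  existence.\<close>

lemma nn_integral_lborel_scaleR:
  fixes F :: "'a::euclidean_space \<Rightarrow> ennreal"
  assumes [measurable]: "F \<in> borel_measurable borel" and c: "c > 0"
  shows "(\<integral>\<^sup>+x. F x \<partial>lborel) = ennreal (c ^ DIM('a)) * (\<integral>\<^sup>+x. F (c *\<^sub>R x) \<partial>lborel)"
  using c by (subst lborel_affine[of c 0])
    (simp_all add: nn_integral_density nn_integral_distr nn_integral_cmult)

lemma prod_Basis_vec:
  fixes g :: "real ^ 'n::finite \<Rightarrow> 'b::comm_monoid_mult"
  shows "(\<Prod>b\<in>Basis. g b) = (\<Prod>k\<in>UNIV. g (axis k 1))"
proof -
  have "inj (\<lambda>k. axis k 1 :: real ^ 'n)"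
    by (auto simp: inj_on_def axis_eq_axis)
  then have "prod g ((\<lambda>k. axis k 1) ` UNIV) = (\<Prod>k\<in>UNIV. g (axis k 1))"
    by (simp add: prod.reindex)
  also have "(\<lambda>k. axis k 1) ` UNIV = (Basis :: (real ^ 'n) set)"
    by (auto simp: Basis_vec_def)
  finally show ?thesis .
qed

lemma nn_integral_lborel_prod_vec:
  fixes f :: "'n::finite \<Rightarrow> real \<Rightarrow> ennreal"
  assumes [measurable]: "\<And>k. f k \<in> borel_measurable borel"
  shows "(\<integral>\<^sup>+x. (\<Prod>k\<in>UNIV. f k (x $ k)) \<partial>(lborel :: (real ^ 'n) measure)) =
    (\<Prod>k\<in>UNIV. \<integral>\<^sup>+t. f k t \<partial>lborel)"
proof -
  \<comment> \<open>The factors in \<open>nn_integral_lborel_prod\<close> are indexed by basis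
    vectors; \<open>h\<close> transports the family along k \<mapsto> \<open>axis k 1\<close>, which
    is injective.\<close>
  define h where "h b = f (THE k. b = axis k (1::real))" for b :: "real ^ 'n"
  have h: "h (axis k 1) = f k" for k by (simp add: h_def axis_eq_axis)
  have "(\<integral>\<^sup>+x. (\<Prod>b\<in>Basis. h b (x \<bullet> b)) \<partial>(lborel :: (real ^ 'n) measure)) =
    (\<Prod>b\<in>Basis. \<integral>\<^sup>+t. h b t \<partial>lborel)"
    by (rule nn_integral_lborel_prod) (simp_all add: h_def)
  then show ?thesis
    by (simp add: prod_Basis_vec h inner_axis)
qed

text \<open>\<open>lborel\<close> is the image of a finite product measure under the map assembling
  a vector from its coordinates, so after pulling back this is
  \<open>product_integral_prod\<close>.\<close>

lemma integral_lborel_prod_vec: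
  fixes f :: "'n::finite \<Rightarrow> real \<Rightarrow> complex"
  assumes f: "\<And>k. integrable lborel (f k)"
  shows "(\<integral>x. (\<Prod>k\<in>UNIV. f k (x $ k)) \<partial>(lborel :: (real ^ 'n) measure)) =
    (\<Prod>k\<in>UNIV. \<integral>t. f k t \<partial>lborel)"
proof -
  define h where "h b = f (THE k. b = axis k (1::real))" for b :: "real ^ 'n"
  have h: "h (axis k 1) = f k" for k by (simp add: h_def axis_eq_axis)
  have hi: "integrable lborel (h b)" for b by (simp add: h_def f)
  then have [measurable]: "h b \<in> borel_measurable borel" for b
    using borel_measurable_integrable[OF hi[of b]] by simp
  interpret product_sigma_finite "\<lambda>_::real ^ 'n. lborel :: real measure"
    by unfold_locales
  let ?T = "\<lambda>y::real ^ 'n \<Rightarrow> real. \<Sum>b\<in>Basis. y b *\<^sub>R b"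
  have T: "?T \<in> (\<Pi>\<^sub>M b\<in>Basis. lborel) \<rightarrow>\<^sub>M borel" by measurable
  have eq: "(\<Prod>b\<in>Basis. h b (?T y \<bullet> b)) = (\<Prod>b\<in>Basis. h b (y b))" for y
    by (intro prod.cong) (simp_all add: inner_sum_left_Basis)
  have m: "(\<lambda>x::real ^ 'n. \<Prod>b\<in>Basis. h b (x \<bullet> b)) \<in> borel_measurable borel"
    by measurable
  have "(\<integral>x. (\<Prod>b\<in>Basis. h b (x \<bullet> b)) \<partial>(lborel :: (real ^ 'n) measure)) =
      (\<Prod>b\<in>Basis. \<integral>t. h b t \<partial>lborel)"
    by (subst lborel_eq, subst integral_distr[OF T m])
       (simp add: eq product_integral_prod hi)
  then show ?thesis by (simp add: prod_Basis_vec h inner_axis)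
qed

text \<open>On a compact interval the reflection t \<mapsto> -t turns g into an increasing function,
  for which the substitution rule is available; exhausting the half-line by compact intervals gives
  the improper version. The values A and B are only limits, so g need not be defined sensibly at
  0.\<close>

lemma nn_integral_substitution_decreasing:
  fixes f :: "real \<Rightarrow> ennreal" and g g' :: "real \<Rightarrow> real"
  assumes [measurable]: "f \<in> borel_measurable borel" "g \<in> borel_measurable borel"
      "g' \<in> borel_measurable borel"
    and deriv: "\<And>t. t > 0 \<Longrightarrow> (g has_real_derivative - g' t) (at t)"
    and cont: "continuous_on {0<..} g'"
    and pos: "\<And>t. t > 0 \<Longrightarrow> g' t > 0"
    and lim0: "(g \<longlongrightarrow> A) (at_right 0)" and lim_top: "(g \<longlongrightarrow> B) at_top"
  shows "(\<integral>\<^sup>+t. f (g t) * ennreal (g' t) * indicator {0<..} t \<partial>lborel) =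
    (\<integral>\<^sup>+x. f x * indicator {B<..<A} x \<partial>lborel)"
proof -
  have mono: "g t < g s" if "0 < s" "s < t" for s t
  proof (rule DERIV_neg_imp_decreasing[OF \<open>s < t\<close>])
    fix x assume "s \<le> x"
    then have "x > 0" using that by simp
    then show "\<exists>y. (g has_real_derivative y) (at x) \<and> y < 0"
      using deriv[of x] pos[of x] by (intro exI[of _ "- g' x"]) simp
  qed
  \<comment> \<open>The limit yields only a weak inequality; the intermediate point s/2 makes it
    strict.\<close>
  have less_A: "g s < A" if "s > 0" for s
  proof -
    have "g (s/2) \<le> A"
    proof (rule tendsto_lowerbound[OF lim0])
      show "\<forall>\<^sub>F x in at_right 0. g (s/2) \<le> g x"
        unfolding eventually_at_right_field using that
        by (intro exI[of _ "s/2"]) (auto intro!: less_imp_le mono)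
    qed simp
    moreover have "g s < g (s/2)" using that by (intro mono) auto
    ultimately show ?thesis by simp
  qed
  have B_less: "B < g s" if "s > 0" for s
  proof -
    have "B \<le> g (s+1)"
    proof (rule tendsto_upperbound[OF lim_top])
      show "\<forall>\<^sub>F x in at_top. g x \<le> g (s+1)"
        using eventually_gt_at_top[of "s+1"] by eventually_elim (use that in \<open>auto intro!: less_imp_le mono\<close>)
    qed simp
    moreover have "g (s+1) < g s" using that by (intro mono) auto
    ultimately show ?thesis by simp
  qed
  \<comment> \<open>Adding 2 rather than 1 makes \<open>lo k < hi k\<close> strict already for k =
    0.\<close>
  define lo hi where "lo k = 1 / (real k + 2)" and "hi k = real k + 2" for k
  have lohi: "0 < lo k" "lo k < hi k" for k
    by (auto simp: lo_def hi_def field_simps intro!: add_pos_nonneg)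
  let ?M1 = "density lborel (\<lambda>t. f (g t) * ennreal (g' t))"
  let ?M2 = "density lborel f"
  have step: "emeasure ?M1 {lo k..hi k} = emeasure ?M2 {g (hi k)..g (lo k)}" for k
  proof -
    have "emeasure ?M1 {lo k..hi k} = (\<integral>\<^sup>+t. f (g t) * ennreal (g' t) * indicator {lo k..hi k} t \<partial>lborel)"
      by (simp add: emeasure_density)
    also have "\<dots> = (\<integral>\<^sup>+t. f (g (-t)) * ennreal (g' (-t)) * indicator {- hi k..- lo k} t \<partial>lborel)"
      by (subst nn_integral_real_affine[where c="-1" and t=0])
         (auto intro!: nn_integral_cong simp: indicator_def)
    also have "\<dots> = (\<integral>\<^sup>+x. f x * indicator {g (- (- hi k))..g (- (- lo k))} x \<partial>lborel)"
    proof (rule nn_integral_substitution_aux[symmetric, where g="\<lambda>t. g (-t)" and g'="\<lambda>t. g' (-t)"])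
      show "((\<lambda>t. g (- t)) has_real_derivative g' (- x)) (at x)" if "x \<in> {- hi k..- lo k}" for x
      proof -
        have "-x > 0" using that lohi[of k] by auto
        from deriv[OF this] have "(g has_real_derivative - g' (-x)) (at (-x))" by simp
        then have "((\<lambda>t. g (- t)) has_real_derivative - g' (- x) * - 1) (at x)"
          by (rule DERIV_chain2) (auto intro!: derivative_eq_intros)
        then show ?thesis by simp
      qed
      show "continuous_on {- hi k..- lo k} (\<lambda>t. g' (- t))"
        by (rule continuous_on_compose2[OF cont]) (use lohi[of k] in \<open>auto intro!: continuous_intros\<close>)
      show "g' (-x) \<ge> 0" if "x \<in> {- hi k..- lo k}" for x
        using that lohi[of k] by (intro less_imp_le pos) auto
    qed (use lohi[of k] in auto)
    also have "\<dots> = emeasure ?M2 {g (hi k)..g (lo k)}"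
      by (simp add: emeasure_density)
    finally show ?thesis .
  qed
  have mono_lo: "lo j \<le> lo k" "hi k \<le> hi j" if "k \<le> j" for j k
    using that by (auto simp: lo_def hi_def field_simps)
  have gmono: "g t \<le> g s" if "0 < s" "s \<le> t" for s t
    using mono[of s t] that by (cases "s = t") auto
  have U1: "(\<Union>k. {lo k..hi k}) = {0<..}"
  proof (intro equalityI subsetI)
    fix t :: real assume "t \<in> {0<..}"
    then have t: "t > 0" by simp
    obtain k where k: "real k > max t (1/t)" using reals_Archimedean2 by blast
    have "1 / (real k + 2) \<le> 1 / (1/t)"
      by (rule divide_left_mono) (use k t in auto)
    then have "t \<in> {lo k..hi k}" using k t by (auto simp: lo_def hi_def)
    then show "t \<in> (\<Union>k. {lo k..hi k})" by blast
  next
    fix t assume "t \<in> (\<Union>k. {lo k..hi k})"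
    then obtain k where "lo k \<le> t" by auto
    then show "t \<in> {0<..}" using lohi(1)[of k] by simp
  qed
  have U2: "(\<Union>k. {g (hi k)..g (lo k)}) = {B<..<A}"
  proof (intro equalityI subsetI)
    fix x assume "x \<in> {B<..<A}"
    then have x: "B < x" "x < A" by auto
    have "\<forall>\<^sub>F t in at_right 0. x < g t" using order_tendstoD(1)[OF lim0 x(2)] .
    then obtain b where b: "b > 0" "\<And>y. 0 < y \<Longrightarrow> y < b \<Longrightarrow> x < g y"
      unfolding eventually_at_right_field by auto
    obtain c where c: "\<And>y. y \<ge> c \<Longrightarrow> g y < x"
      using order_tendstoD(2)[OF lim_top x(1)] unfolding eventually_at_top_linorder by auto
    obtain k where k: "real k > max c (1/b)" using reals_Archimedean2 by blast
    have "1 / (real k + 2) < 1 / (1/b)"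
      by (rule divide_strict_left_mono) (use k b(1) in \<open>auto intro!: mult_pos_pos add_pos_nonneg\<close>)
    then have "lo k < b" by (simp add: lo_def)
    then have "x < g (lo k)" using b(2) lohi(1) by blast
    moreover have "g (hi k) < x" using k by (intro c) (simp add: hi_def)
    ultimately have "x \<in> {g (hi k)..g (lo k)}" by auto
    then show "x \<in> (\<Union>k. {g (hi k)..g (lo k)})" by blast
  next
    fix x assume "x \<in> (\<Union>k. {g (hi k)..g (lo k)})"
    then obtain k where "g (hi k) \<le> x" "x \<le> g (lo k)" by auto
    then show "x \<in> {B<..<A}"
      using less_A[OF lohi(1)[of k]] B_less[of "hi k"] lohi[of k] by auto
  qed
  have "(\<integral>\<^sup>+t. f (g t) * ennreal (g' t) * indicator {0<..} t \<partial>lborel) = emeasure ?M1 (\<Union>k. {lo k..hi k})"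
    by (subst U1) (simp add: emeasure_density)
  also have "\<dots> = (SUP k. emeasure ?M1 {lo k..hi k})"
    by (rule SUP_emeasure_incseq[symmetric])
       (auto simp: incseq_def intro: order_trans[OF mono_lo(1)] order_trans[OF _ mono_lo(2)])
  also have "\<dots> = (SUP k. emeasure ?M2 {g (hi k)..g (lo k)})" by (simp add: step)
  also have "\<dots> = emeasure ?M2 (\<Union>k. {g (hi k)..g (lo k)})"
  proof (rule SUP_emeasure_incseq)
    have "g (hi j) \<le> g (hi k)" "g (lo k) \<le> g (lo j)" if "k \<le> j" for j k
      using mono_lo[OF that] lohi[of k] lohi[of j] by (auto intro!: gmono)
    then show "incseq (\<lambda>k. {g (hi k)..g (lo k)})"
      unfolding incseq_def by (meson atLeastatMost_subset_iff)
  qed auto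
  also have "\<dots> = (\<integral>\<^sup>+x. f x * indicator {B<..<A} x \<partial>lborel)"
    by (subst U2) (simp add: emeasure_density)
  finally show ?thesis .
qed

section \<open>Polar coordinates for a gauge\<close>

text \<open>The mass of B is n times the volume of the part of the cone over B inside g \<le> 1.
  With the factor n, polar coordinates have weight r^(n-1) and no further constant. The origin is
  sent to itself, which is harmless because it is a null set.\<close>

definition cone_measure :: "('a::euclidean_space \<Rightarrow> real) \<Rightarrow> 'a measure" where
  "cone_measure g = distr (density lborel (\<lambda>z. of_nat DIM('a) * indicator {z. g z \<le> 1} z))
     borel (\<lambda>z. z /\<^sub>R g z)"

lemma sets_cone_measure [simp, measurable_cong]: "sets (cone_measure g) = sets borel"
  and space_cone_measure [simp]: "space (cone_measure g) = UNIV"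
  by (simp_all add: cone_measure_def)

locale gauge =
  fixes g :: "'a::euclidean_space \<Rightarrow> real"
  assumes g_measurable [measurable]: "g \<in> borel_measurable borel"
    and g_scale: "\<And>c x. c > 0 \<Longrightarrow> g (c *\<^sub>R x) = c * g x"
    and g_pos: "\<And>x. x \<noteq> 0 \<Longrightarrow> g x > 0"
    and g_zero: "g 0 = 0"
    and g_bounded: "bounded {x. g x \<le> 1}"
begin

lemma nn_integral_cone_measure:
  assumes [measurable]: "F \<in> borel_measurable borel"
  shows "(\<integral>\<^sup>+x. F x \<partial>cone_measure g) =
    of_nat DIM('a) * (\<integral>\<^sup>+z. F (z /\<^sub>R g z) * indicator {z. g z \<le> 1} z \<partial>lborel)"
  unfolding cone_measure_def
  by (subst nn_integral_distr, measurable, subst nn_integral_density, measurable,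
      subst nn_integral_cmult[symmetric], measurable)
     (auto intro!: nn_integral_cong simp: mult_ac)

lemma g_normalize: "z \<noteq> 0 \<Longrightarrow> g (z /\<^sub>R g z) = 1"
  using g_scale[of "inverse (g z)" z] g_pos[of z] by simp

lemma finite_cone_measure: "finite_measure (cone_measure g)"
proof
  have "emeasure (cone_measure g) UNIV = (\<integral>\<^sup>+x. 1 \<partial>cone_measure g)" by simp
  also have "\<dots> = of_nat DIM('a) * emeasure lborel {z. g z \<le> 1}"
    by (subst nn_integral_cone_measure) auto
  also have "\<dots> < \<infinity>"
    using emeasure_bounded_finite[OF g_bounded] by (simp add: ennreal_mult_less_top of_nat_less_top)
  finally show "emeasure (cone_measure g) (space (cone_measure g)) \<noteq> \<infinity>" by simp
qed

lemma AE_cone_measure: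
  assumes [measurable]: "Measurable.pred borel P" and "AE z in lborel. P (z /\<^sub>R g z)"
  shows "AE x in cone_measure g. P x"
  unfolding cone_measure_def
  by (subst AE_distr_iff, measurable, subst AE_density, measurable) (use assms(2) in auto)

lemma AE_cone_measure_gauge: "AE x in cone_measure g. g x = 1"
proof (rule AE_cone_measure)
  have "AE z in lborel. z \<noteq> (0::'a)" by (rule AE_lborel_singleton)
  then show "AE z in lborel. g (z /\<^sub>R g z) = 1"
    by eventually_elim (rule g_normalize)
qed measurable

text \<open>The right-hand side is an integral over \<open>g z \<le> 1\<close> and \<open>r > 0\<close>; substituting first \<open>r = t * g z\<close> and
  then \<open>z = u / t\<close> decouples \<open>F u\<close> from \<open>t\<close>.\<close>

lemma nn_integral_polar:
  assumes [measurable]: "F \<in> borel_measurable borel"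
  shows "(\<integral>\<^sup>+z. F z \<partial>lborel) =
    (\<integral>\<^sup>+x. (\<integral>\<^sup>+r. F (r *\<^sub>R x) * ennreal (r ^ (DIM('a) - 1)) * indicator {0<..} r \<partial>lborel) \<partial>cone_measure g)"
proof -
  let ?n = "DIM('a)"
  have n: "?n > 0" by simp
  have [measurable]: "{z. g z \<le> 1} \<in> sets borel" by measurable
  have inner: "(\<integral>\<^sup>+r. F (r *\<^sub>R (z /\<^sub>R g z)) * ennreal (r ^ (?n - 1)) * indicator {0<..} r \<partial>lborel) =
    (\<integral>\<^sup>+t. F (t *\<^sub>R z) * ennreal (t ^ (?n - 1) * g z ^ ?n) * indicator {0<..} t \<partial>lborel)"
    if "z \<noteq> 0" for z
  proof -
    have gz: "g z > 0" by (rule g_pos[OF that])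
    have "(\<integral>\<^sup>+r. F (r *\<^sub>R (z /\<^sub>R g z)) * ennreal (r ^ (?n - 1)) * indicator {0<..} r \<partial>lborel) =
      g z * (\<integral>\<^sup>+t. F ((g z * t) *\<^sub>R (z /\<^sub>R g z)) * ennreal ((g z * t) ^ (?n - 1)) * indicator {0<..} (g z * t) \<partial>lborel)"
      using gz by (subst nn_integral_real_affine[where c="g z" and t=0]) auto
    also have "\<dots> = (\<integral>\<^sup>+t. ennreal (g z) * (F ((g z * t) *\<^sub>R (z /\<^sub>R g z)) * ennreal ((g z * t) ^ (?n - 1)) * indicator {0<..} (g z * t)) \<partial>lborel)"
      by (subst nn_integral_cmult) auto
    also have "\<dots> = (\<integral>\<^sup>+t. F (t *\<^sub>R z) * ennreal (t ^ (?n - 1) * g z ^ ?n) * indicator {0<..} t \<partial>lborel)"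
    proof (rule nn_integral_cong)
      fix t :: real
      have "g z * ((g z * t) ^ (?n - 1)) = t ^ (?n - 1) * g z ^ ?n"
        by (cases ?n) (simp_all add: power_mult_distrib mult_ac)
      then have e: "ennreal (g z) * ennreal ((g z * t) ^ (?n - 1)) = ennreal (t ^ (?n - 1) * g z ^ ?n)"
        using gz by (simp add: ennreal_mult'[symmetric])
      show "ennreal (g z) * (F ((g z * t) *\<^sub>R (z /\<^sub>R g z)) * ennreal ((g z * t) ^ (?n - 1)) * indicator {0<..} (g z * t)) =
        F (t *\<^sub>R z) * ennreal (t ^ (?n - 1) * g z ^ ?n) * indicator {0<..} t"
      proof (cases "t > 0")
        case True
        have "(g z * t) *\<^sub>R (z /\<^sub>R g z) = t *\<^sub>R z" using gz by simp
        then show ?thesis unfolding e[symmetric] using True gz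
          by (simp only:) (simp add: mult_ac)
      qed (use gz in \<open>simp add: zero_less_mult_iff\<close>)
    qed
    finally show ?thesis .
  qed
  have "(\<integral>\<^sup>+x. (\<integral>\<^sup>+r. F (r *\<^sub>R x) * ennreal (r ^ (?n - 1)) * indicator {0<..} r \<partial>lborel) \<partial>cone_measure g) =
    of_nat ?n * (\<integral>\<^sup>+z. (\<integral>\<^sup>+r. F (r *\<^sub>R (z /\<^sub>R g z)) * ennreal (r ^ (?n - 1)) * indicator {0<..} r \<partial>lborel) * indicator {z. g z \<le> 1} z \<partial>lborel)"
    by (subst nn_integral_cone_measure) auto
  also have "\<dots> = of_nat ?n * (\<integral>\<^sup>+z. (\<integral>\<^sup>+t. F (t *\<^sub>R z) * ennreal (t ^ (?n - 1) * g z ^ ?n) * indicator {0<..} t \<partial>lborel) * indicator {z. g z \<le> 1} z \<partial>lborel)"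
  proof -
    have "AE z in lborel. z \<noteq> (0::'a)" by (rule AE_lborel_singleton)
    then show ?thesis
      by (intro arg_cong[where f="\<lambda>x. of_nat ?n * x"] nn_integral_cong_AE, eventually_elim)
         (simp only: inner simp_thms)
  qed
  also have "\<dots> = of_nat ?n * (\<integral>\<^sup>+z. (\<integral>\<^sup>+t. F (t *\<^sub>R z) * ennreal (t ^ (?n - 1) * g z ^ ?n) * indicator {0<..} t * indicator {z. g z \<le> 1} z \<partial>lborel) \<partial>lborel)"
    by (subst nn_integral_multc) auto
  also have "\<dots> = of_nat ?n * (\<integral>\<^sup>+t. (\<integral>\<^sup>+z. F (t *\<^sub>R z) * ennreal (t ^ (?n - 1) * g z ^ ?n) * indicator {0<..} t * indicator {z. g z \<le> 1} z \<partial>lborel) \<partial>lborel)"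
    by (subst lborel_pair.Fubini') auto
  \<comment> \<open>Substituting z = u / t contributes t^(-n), and \<open>g z ^ n\<close> becomes
    \<open>g u ^ n\<close> times another t^(-n), which turns t^(n-1) into t^(-n-1).\<close>
  also have "\<dots> = of_nat ?n * (\<integral>\<^sup>+t. (\<integral>\<^sup>+u. F u * ennreal (g u ^ ?n) * (ennreal (t powr (- real ?n - 1)) * indicator {0<..} t * indicator {z. g z \<le> t} u) \<partial>lborel) \<partial>lborel)"
  proof (rule arg_cong[where f="\<lambda>x. of_nat ?n * x"], rule nn_integral_cong)
    fix t :: real
    show "(\<integral>\<^sup>+z. F (t *\<^sub>R z) * ennreal (t ^ (?n - 1) * g z ^ ?n) * indicator {0<..} t * indicator {z. g z \<le> 1} z \<partial>lborel) =
      (\<integral>\<^sup>+u. F u * ennreal (g u ^ ?n) * (ennreal (t powr (- real ?n - 1)) * indicator {0<..} t * indicator {z. g z \<le> t} u) \<partial>lborel)"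
    proof (cases "t > 0")
      case True
      have g0: "g z \<ge> 0" for z using g_pos[of z] g_zero by (cases "z = 0") auto
      have pw: "t ^ ?n * (t ^ ?n * t powr (- real ?n - 1)) = t ^ (?n - 1)"
      proof -
        have "t ^ ?n * (t ^ ?n * t powr (- real ?n - 1)) = t powr (real ?n + real ?n + (- real ?n - 1))"
          by (simp only: powr_realpow[OF True, symmetric] powr_add[symmetric] add.assoc)
        also have "real ?n + real ?n + (- real ?n - 1) = real (?n - 1)" using n by (simp add: of_nat_diff)
        finally show ?thesis by (simp only: powr_realpow[OF True])
      qed
      have "(\<integral>\<^sup>+u. F u * ennreal (g u ^ ?n) * (ennreal (t powr (- real ?n - 1)) * indicator {0<..} t * indicator {z. g z \<le> t} u) \<partial>lborel) =
        ennreal (t ^ ?n) * (\<integral>\<^sup>+z. F (t *\<^sub>R z) * ennreal (g (t *\<^sub>R z) ^ ?n) * (ennreal (t powr (- real ?n - 1)) * indicator {0<..} t * indicator {z. g z \<le> t} (t *\<^sub>R z)) \<partial>lborel)"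
        by (rule nn_integral_lborel_scaleR) (use True in auto)
      also have "\<dots> = (\<integral>\<^sup>+z. ennreal (t ^ ?n) * (F (t *\<^sub>R z) * ennreal (g (t *\<^sub>R z) ^ ?n) * (ennreal (t powr (- real ?n - 1)) * indicator {0<..} t * indicator {z. g z \<le> t} (t *\<^sub>R z))) \<partial>lborel)"
        by (subst nn_integral_cmult) auto
      also have "\<dots> = (\<integral>\<^sup>+z. F (t *\<^sub>R z) * ennreal (t ^ (?n - 1) * g z ^ ?n) * indicator {0<..} t * indicator {z. g z \<le> 1} z \<partial>lborel)"
      proof (rule nn_integral_cong)
        fix z :: 'a
        have "ennreal (t ^ ?n) * (ennreal (g (t *\<^sub>R z) ^ ?n) * ennreal (t powr (- real ?n - 1))) = ennreal (t ^ (?n - 1) * g z ^ ?n)"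
          using True g0[of z] pw by (simp add: g_scale ennreal_mult[symmetric] power_mult_distrib mult_ac)
        then show "ennreal (t ^ ?n) * (F (t *\<^sub>R z) * ennreal (g (t *\<^sub>R z) ^ ?n) * (ennreal (t powr (- real ?n - 1)) * indicator {0<..} t * indicator {z. g z \<le> t} (t *\<^sub>R z))) =
          F (t *\<^sub>R z) * ennreal (t ^ (?n - 1) * g z ^ ?n) * indicator {0<..} t * indicator {z. g z \<le> 1} z"
          using True by (auto simp: indicator_def g_scale mult_ac)
      qed
      finally show ?thesis by simp
    qed simp
  qed
  also have "\<dots> = of_nat ?n * (\<integral>\<^sup>+u. (\<integral>\<^sup>+t. F u * ennreal (g u ^ ?n) * (ennreal (t powr (- real ?n - 1)) * indicator {0<..} t * indicator {z. g z \<le> t} u) \<partial>lborel) \<partial>lborel)"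
    by (subst lborel_pair.Fubini') auto
  also have "\<dots> = (\<integral>\<^sup>+u. F u * (of_nat ?n * (ennreal (g u ^ ?n) * (\<integral>\<^sup>+t. ennreal (t powr (- real ?n - 1)) * indicator {0<..} t * indicator {z. g z \<le> t} u \<partial>lborel))) \<partial>lborel)"
    by (subst nn_integral_cmult[symmetric], measurable, rule nn_integral_cong,
        subst nn_integral_cmult, measurable) (simp only: mult_ac)
  \<comment> \<open>What remains around F u is n * g u ^ n times the integral of t^(-n-1) over t
    \<ge> g u, which is 1.\<close>
  also have "\<dots> = (\<integral>\<^sup>+u. F u \<partial>lborel)"
  proof (rule nn_integral_cong_AE)
    have "AE z in lborel. z \<noteq> (0::'a)" by (rule AE_lborel_singleton)
    then show "AE u in lborel. F u * (of_nat ?n * (ennreal (g u ^ ?n) * (\<integral>\<^sup>+t. ennreal (t powr (- real ?n - 1)) * indicator {0<..} t * indicator {z. g z \<le> t} u \<partial>lborel))) = F u"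
    proof eventually_elim
      case (elim u)
      then have gu: "g u > 0" by (rule g_pos)
      have "(\<integral>\<^sup>+t. ennreal (t powr (- real ?n - 1)) * indicator {0<..} t * indicator {z. g z \<le> t} u \<partial>lborel) =
         (\<integral>\<^sup>+t. ennreal (t powr (- real ?n - 1)) * indicator {g u..} t \<partial>lborel)"
        using gu by (intro nn_integral_cong) (auto simp: indicator_def)
      also have "\<dots> = ennreal (g u powr (- real ?n) / real ?n)"
      proof -
        have "((\<lambda>t. t powr (- real ?n - 1)) has_integral - (g u powr (- real ?n - 1 + 1)) / (- real ?n - 1 + 1)) {g u..}"
          by (rule has_integral_powr_to_inf) (use gu in auto)
        then show ?thesis by (subst nn_integral_has_integral_lebesgue') auto
      qed
      finally have "of_nat ?n * (ennreal (g u ^ ?n) * (\<integral>\<^sup>+t. ennreal (t powr (- real ?n - 1)) * indicator {0<..} t * indicator {z. g z \<le> t} u \<partial>lborel)) =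
        ennreal (real ?n * (g u ^ ?n * (g u powr (- real ?n) / real ?n)))"
        using gu by (simp only: ennreal_mult' less_imp_le zero_le_power of_nat_0_le_iff ennreal_of_nat_eq_real_of_nat)
      also have "\<dots> = 1" using gu by (simp add: powr_minus powr_realpow)
      finally show ?case by simp
    qed
  qed
  finally show ?thesis by simp
qed

end

section \<open>One coordinate of the normal vector\<close>

definition normal_comp :: "real \<Rightarrow> real \<Rightarrow> real \<Rightarrow> real" where
  "normal_comp p c z = c * sgn z * \<bar>c * z\<bar> powr (p - 1)"

text \<open>At z = 0 the value is 0, since \<open>0 powr\<close> anything is 0. For p \<le> 2 this
  is not the derivative of \<open>normal_comp\<close>, so the derivative rule is stated for z
  \<noteq> 0.\<close>

definition normal_comp_deriv :: "real \<Rightarrow> real \<Rightarrow> real \<Rightarrow> real" where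
  "normal_comp_deriv p c z = (p - 1) * c\<^sup>2 * \<bar>c * z\<bar> powr (p - 2)"

text \<open>Truncating at \<open>max 0 \<tau>\<close> makes the inverse jointly continuous on the whole plane.\<close>

definition shift_inv :: "real \<Rightarrow> real \<Rightarrow> real \<Rightarrow> real \<Rightarrow> real" where
  "shift_inv p c \<tau> u = (THE z. z + max 0 \<tau> * normal_comp p c z = u)"

lemma borel_measurable_normal_comp_deriv [measurable]: "normal_comp_deriv p c \<in> borel_measurable borel"
  unfolding normal_comp_deriv_def[abs_def] by measurable

lemma borel_measurable_normal_comp [measurable]: "normal_comp p c \<in> borel_measurable borel"
  unfolding normal_comp_def[abs_def] by measurable

context
  fixes p c :: real
  assumes p: "p > 1" and c: "c > 0"
begin

text \<open>Splitting the odd power into powers of the positive and the negative part removes the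
  sign function; continuity and monotonicity then follow from those of \<open>powr\<close> on
  nonnegative arguments.\<close>

lemma normal_comp_eq_max: "normal_comp p c z = c * (max 0 (c * z)) powr (p - 1) - c * (max 0 (- (c * z))) powr (p - 1)"
  using c by (auto simp: normal_comp_def sgn_if max_def mult_less_0_iff zero_less_mult_iff not_le mult_le_0_iff zero_le_mult_iff)

lemma normal_comp_0 [simp]: "normal_comp p c 0 = 0"
  by (simp add: normal_comp_def)

lemma normal_comp_eq_0_iff [simp]: "normal_comp p c z = 0 \<longleftrightarrow> z = 0"
  using c by (auto simp: normal_comp_def sgn_if)

lemma continuous_normal_comp: "continuous_on UNIV (normal_comp p c)"
proof -
  have "continuous_on UNIV (\<lambda>z. c * (max 0 (c * z)) powr (p - 1) - c * (max 0 (- (c * z))) powr (p - 1))"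
    using p by (intro continuous_intros continuous_on_powr') auto
  then show ?thesis by (simp add: normal_comp_eq_max[abs_def])
qed

lemma normal_comp_mono: "y \<le> z \<Longrightarrow> normal_comp p c y \<le> normal_comp p c z"
  unfolding normal_comp_eq_max using p c
  by (intro diff_mono mult_left_mono powr_mono2 max.mono) auto

lemma normal_comp_minus: "normal_comp p c (- z) = - normal_comp p c z"
  by (simp add: normal_comp_def sgn_minus)

lemma abs_normal_comp: "\<bar>normal_comp p c z\<bar> = c * \<bar>c * z\<bar> powr (p - 1)"
  using c p by (auto simp: normal_comp_def abs_mult sgn_if)

text \<open>Euler's identity for a function homogeneous of degree p, divided by p.\<close>

lemma normal_comp_mult_self: "normal_comp p c z * z = \<bar>c * z\<bar> powr p"
proof (cases "z = 0")
  case False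
  have "normal_comp p c z * z = \<bar>c * z\<bar> powr 1 * \<bar>c * z\<bar> powr (p - 1)"
    using c False by (auto simp: normal_comp_def abs_mult sgn_if)
  also have "\<dots> = \<bar>c * z\<bar> powr p" by (simp only: powr_add[symmetric]) simp
  finally show ?thesis .
qed simp

lemma normal_comp_power2: "(normal_comp p c z)\<^sup>2 = c\<^sup>2 * \<bar>c * z\<bar> powr (2 * p - 2)"
proof -
  have "(normal_comp p c z)\<^sup>2 = \<bar>normal_comp p c z\<bar> * \<bar>normal_comp p c z\<bar>" by (simp add: power2_eq_square)
  also have "\<dots> = c\<^sup>2 * (\<bar>c * z\<bar> powr (p - 1) * \<bar>c * z\<bar> powr (p - 1))"
    by (simp add: abs_normal_comp power2_eq_square)
  also have "\<dots> = c\<^sup>2 * \<bar>c * z\<bar> powr (2 * p - 2)" by (simp only: powr_add[symmetric]) simp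
  finally show ?thesis .
qed

lemma normal_comp_deriv_nonneg: "normal_comp_deriv p c z \<ge> 0"
  using p by (simp add: normal_comp_deriv_def)

lemma normal_comp_scale: "r > 0 \<Longrightarrow> normal_comp p c (r * z) = r powr (p - 1) * normal_comp p c z"
  by (simp add: normal_comp_def sgn_mult abs_mult powr_mult mult_ac)

lemma normal_comp_deriv_scale: "r > 0 \<Longrightarrow> normal_comp_deriv p c (r * z) = r powr (p - 2) * normal_comp_deriv p c z"
  by (simp add: normal_comp_deriv_def abs_mult powr_mult mult_ac)

lemma DERIV_normal_comp:
  assumes "z \<noteq> 0"
  shows "(normal_comp p c has_real_derivative normal_comp_deriv p c z) (at z)"
proof -
  have pos: "(normal_comp p c has_real_derivative normal_comp_deriv p c z) (at z)" if "z > 0" for z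
  proof -
    have "((\<lambda>z. c * (c * z) powr (p - 1)) has_real_derivative normal_comp_deriv p c z) (at z)"
    proof -
      have "((\<lambda>x. x powr (p - 1)) has_real_derivative (p - 1) * (c * z) powr (p - 1 - 1)) (at (c * z))"
        by (rule has_real_derivative_powr) (use that c in auto)
      from DERIV_cmult[OF DERIV_chain2[OF this DERIV_cmult_Id], of c] show ?thesis
        using that c by (simp add: normal_comp_deriv_def power2_eq_square mult_ac)
    qed
    then show ?thesis
      by (rule has_field_derivative_transform_within_open[where S="{0<..}"])
         (use that c in \<open>auto simp: normal_comp_def\<close>)
  qed
  show ?thesis
  proof (cases "z > 0")
    case False
    then have "- z > 0" using assms by simp
    from pos[OF this] have "((\<lambda>z. normal_comp p c (- z)) has_real_derivative normal_comp_deriv p c (- z) * - 1) (at z)"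
      by (rule DERIV_chain2) (auto intro!: derivative_eq_intros)
    from DERIV_minus[OF this] show ?thesis by (simp add: normal_comp_minus normal_comp_deriv_def)
  qed (rule pos)
qed

lemma DERIV_abs_powr:
  assumes "z \<noteq> 0"
  shows "((\<lambda>z. \<bar>c * z\<bar> powr p) has_real_derivative p * normal_comp p c z) (at z)"
proof -
  have pos: "((\<lambda>z. \<bar>c * z\<bar> powr p) has_real_derivative p * normal_comp p c z) (at z)" if "z > 0" for z
  proof -
    have "((\<lambda>z. (c * z) powr p) has_real_derivative p * normal_comp p c z) (at z)"
      using that c by (auto intro!: derivative_eq_intros simp: normal_comp_def powr_diff field_simps)
    then show ?thesis
      by (rule has_field_derivative_transform_within_open[where S="{0<..}"])
         (use that c in auto)
  qed
  show ?thesis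
  proof (cases "z > 0")
    case False
    then have "- z > 0" using assms by simp
    from pos[OF this] have "((\<lambda>z. \<bar>c * - z\<bar> powr p) has_real_derivative p * normal_comp p c (- z) * - 1) (at z)"
      by (rule DERIV_chain2) (auto intro!: derivative_eq_intros)
    then show ?thesis by (simp add: normal_comp_minus)
  qed (rule pos)
qed

text \<open>Adding a multiple of a monotone function to the identity cannot decrease distances. This
  one inequality gives both the injectivity of the shift and the continuity of its inverse.\<close>

lemma shift_expand:
  assumes "\<tau> \<ge> 0"
  shows "\<bar>y - z\<bar> \<le> \<bar>(y + \<tau> * normal_comp p c y) - (z + \<tau> * normal_comp p c z)\<bar>"
proof -
  have *: "z - y \<le> (z + \<tau> * normal_comp p c z) - (y + \<tau> * normal_comp p c y)" if "y \<le> z" for y z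
    using mult_left_mono[OF normal_comp_mono[OF that] assms] by simp
  show ?thesis using *[of y z] *[of z y] by linarith
qed

text \<open>\<open>normal_comp\<close> has the sign of its argument, so the values of the map at -
  \<bar>u\<bar> and \<bar>u\<bar> enclose u and the intermediate value theorem applies. Uniqueness
  is \<open>shift_expand\<close>.\<close>

lemma shift_ex1: "\<exists>!z. z + max 0 \<tau> * normal_comp p c z = u"
proof -
  let ?P = "\<lambda>z. z + max 0 \<tau> * normal_comp p c z"
  have "continuous_on {- \<bar>u\<bar>..\<bar>u\<bar>} ?P"
    by (intro continuous_intros continuous_on_subset[OF continuous_normal_comp]) auto
  moreover have "?P (- \<bar>u\<bar>) \<le> u"
    using normal_comp_mono[of "- \<bar>u\<bar>" 0] by (simp add: mult_nonneg_nonpos add_nonpos_nonpos)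
      (smt (verit) mult_nonneg_nonpos max.cobounded1)
  moreover have "u \<le> ?P \<bar>u\<bar>"
    using normal_comp_mono[of 0 "\<bar>u\<bar>"] by (smt (verit) mult_nonneg_nonneg max.cobounded1 normal_comp_0 abs_ge_self abs_ge_zero)
  ultimately obtain z where "?P z = u"
    using IVT'[of ?P "- \<bar>u\<bar>" u "\<bar>u\<bar>"] by auto
  moreover have "y = z" if "?P y = u" "?P z = u" for y z
    using shift_expand[of "max 0 \<tau>" y z] that by simp
  ultimately show ?thesis by blast
qed

lemma shift_shift_inv: "shift_inv p c \<tau> u + max 0 \<tau> * normal_comp p c (shift_inv p c \<tau> u) = u"
  unfolding shift_inv_def by (rule theI'[OF shift_ex1])

lemma shift_inv_eqI: "z + max 0 \<tau> * normal_comp p c z = u \<Longrightarrow> shift_inv p c \<tau> u = z"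
  using shift_ex1[of \<tau> u] shift_shift_inv[of \<tau> u] by blast

lemma shift_inv_shift: "\<tau> \<ge> 0 \<Longrightarrow> shift_inv p c \<tau> (z + \<tau> * normal_comp p c z) = z"
  by (rule shift_inv_eqI) simp

lemma shift_inv_eq_0_iff [simp]: "shift_inv p c \<tau> u = 0 \<longleftrightarrow> u = 0"
  using shift_shift_inv[of \<tau> u] shift_inv_eqI[of 0 \<tau> u] by auto

lemma shift_inv_le_iff:
  assumes "\<tau> \<ge> 0"
  shows "z \<le> shift_inv p c \<tau> u \<longleftrightarrow> z + \<tau> * normal_comp p c z \<le> u"
proof -
  let ?P = "\<lambda>z. z + \<tau> * normal_comp p c z" and ?q = "shift_inv p c \<tau> u"
  have eq: "?P ?q = u" using shift_shift_inv[of \<tau> u] assms by simp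
  have mono: "?P y < ?P z" if "y < z" for y z
    using mult_left_mono[OF normal_comp_mono[OF less_imp_le[OF that]] assms] that by simp
  show ?thesis using mono[of z ?q] mono[of ?q z] eq by (cases z ?q rule: linorder_cases) auto
qed

lemma shift_inv_ge_iff:
  assumes "\<tau> \<ge> 0"
  shows "shift_inv p c \<tau> u \<le> z \<longleftrightarrow> u \<le> z + \<tau> * normal_comp p c z"
proof -
  let ?P = "\<lambda>z. z + \<tau> * normal_comp p c z" and ?q = "shift_inv p c \<tau> u"
  have eq: "?P ?q = u" using shift_shift_inv[of \<tau> u] assms by simp
  have mono: "?P y < ?P z" if "y < z" for y z
    using mult_left_mono[OF normal_comp_mono[OF less_imp_le[OF that]] assms] that by simp
  show ?thesis using mono[of z ?q] mono[of ?q z] eq by (cases z ?q rule: linorder_cases) auto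
qed

text \<open>The displacement of the solution is at most the residual of the old solution z at the
  new parameters, by \<open>shift_expand\<close>, and this residual depends continuously on the
  parameters. Differentiability plays no part, so solutions at 0 are covered.\<close>

lemma continuous_shift_inv: "continuous_on UNIV (\<lambda>x. shift_inv p c (fst x) (snd x))"
proof -
  have "((\<lambda>x. shift_inv p c (fst x) (snd x)) \<longlongrightarrow> shift_inv p c (fst x0) (snd x0)) (at x0)" for x0
  proof -
    define z where "z = shift_inv p c (fst x0) (snd x0)"
    have "((\<lambda>x. z + max 0 (fst x) * normal_comp p c z - snd x) \<longlongrightarrow> z + max 0 (fst x0) * normal_comp p c z - snd x0) (at x0)"
      by (intro tendsto_intros)
    then have lim: "((\<lambda>x. z + max 0 (fst x) * normal_comp p c z - snd x) \<longlongrightarrow> 0) (at x0)"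
      using shift_shift_inv[of "fst x0" "snd x0"] by (simp add: z_def)
    have "((\<lambda>x. shift_inv p c (fst x) (snd x) - z) \<longlongrightarrow> 0) (at x0)"
    proof (rule Lim_null_comparison[OF _ tendsto_rabs_zero[OF lim]], intro always_eventually allI)
      fix x :: "real \<times> real"
      show "norm (shift_inv p c (fst x) (snd x) - z) \<le> \<bar>z + max 0 (fst x) * normal_comp p c z - snd x\<bar>"
        using shift_expand[of "max 0 (fst x)" z "shift_inv p c (fst x) (snd x)"]
        by (simp add: shift_shift_inv abs_minus_commute)
    qed
    then show ?thesis unfolding z_def[symmetric] by (simp add: LIM_zero_iff)
  qed
  then show ?thesis by (simp add: continuous_on_eq_continuous_at isCont_def)
qed

lemma borel_measurable_shift_inv [measurable (raw)]:
  assumes "f \<in> borel_measurable M" "h \<in> borel_measurable M"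
  shows "(\<lambda>x. shift_inv p c (f x) (h x)) \<in> borel_measurable M"
proof -
  have "(\<lambda>x. shift_inv p c (fst x) (snd x)) \<in> borel_measurable borel"
    by (rule borel_measurable_continuous_onI[OF continuous_shift_inv])
  from measurable_compose[OF _ this, of "\<lambda>x. (f x, h x)" M] assms show ?thesis
    by (simp add: borel_prod[symmetric])
qed

text \<open>For fixed u the parameter is an explicit function of the solution, \<tau> = (u - z) /
  \<open>normal_comp p c z\<close>. Its derivative is computed directly and then inverted,
  continuity of the inverse being known.\<close>

lemma DERIV_shift_inv:
  assumes "\<tau> > 0" and u: "u \<noteq> 0"
  defines "z \<equiv> shift_inv p c \<tau> u"
  shows "((\<lambda>t. shift_inv p c t u) has_real_derivative - normal_comp p c z / (1 + \<tau> * normal_comp_deriv p c z)) (at \<tau>)"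
proof -
  let ?T = "\<lambda>z. (u - z) / normal_comp p c z"
  have z: "z \<noteq> 0" using u by (simp add: z_def)
  have N: "normal_comp p c z \<noteq> 0" using z by simp
  have T: "?T (shift_inv p c t u) = t" if "t > 0" for t
    using shift_shift_inv[of t u] that u by (simp add: field_simps)
  have uz: "u - z = \<tau> * normal_comp p c z"
    using shift_shift_inv[of \<tau> u] \<open>\<tau> > 0\<close> by (simp add: z_def)
  have pos: "1 + \<tau> * normal_comp_deriv p c z > 0"
    using \<open>\<tau> > 0\<close> normal_comp_deriv_nonneg[of z] by (simp add: add_pos_nonneg)
  have "(?T has_real_derivative ((- 1) * normal_comp p c z - (u - z) * normal_comp_deriv p c z) / (normal_comp p c z * normal_comp p c z)) (at z)"
    using N by (auto intro!: derivative_eq_intros DERIV_normal_comp[OF z])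
  also have "((- 1) * normal_comp p c z - (u - z) * normal_comp_deriv p c z) / (normal_comp p c z * normal_comp p c z) =
      - (1 + \<tau> * normal_comp_deriv p c z) / normal_comp p c z"
    using N by (simp add: uz field_simps)
  finally have dT: "(?T has_real_derivative - (1 + \<tau> * normal_comp_deriv p c z) / normal_comp p c z) (at z)" .
  have "((\<lambda>t. shift_inv p c t u) has_real_derivative inverse (- (1 + \<tau> * normal_comp_deriv p c z) / normal_comp p c z)) (at \<tau>)"
  proof (rule DERIV_inverse_function[where f="?T" and a=0 and b="\<tau>+1"])
    show "(?T has_real_derivative - (1 + \<tau> * normal_comp_deriv p c z) / normal_comp p c z) (at (shift_inv p c \<tau> u))"
      using dT by (simp add: z_def)
    have "continuous_on UNIV (\<lambda>t. shift_inv p c (fst (t, u)) (snd (t, u)))"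
      by (rule continuous_on_compose2[OF continuous_shift_inv]) (auto intro!: continuous_intros)
    then show "isCont (\<lambda>t. shift_inv p c t u) \<tau>"
      by (simp add: continuous_on_eq_continuous_at)
  qed (use pos N T \<open>\<tau> > 0\<close> in auto)
  also have "inverse (- (1 + \<tau> * normal_comp_deriv p c z) / normal_comp p c z) = - normal_comp p c z / (1 + \<tau> * normal_comp_deriv p c z)"
    using N pos by (simp add: field_simps)
  finally show ?thesis .
qed

lemma shift_inv_at_right_0: "((\<lambda>t. shift_inv p c t u) \<longlongrightarrow> u) (at_right 0)"
proof -
  have "continuous_on UNIV (\<lambda>t. shift_inv p c (fst (t, u)) (snd (t, u)))"
    by (rule continuous_on_compose2[OF continuous_shift_inv]) (auto intro!: continuous_intros)
  then have "((\<lambda>t. shift_inv p c t u) \<longlongrightarrow> shift_inv p c 0 u) (at 0)"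
    by (simp add: continuous_on_eq_continuous_at isCont_def)
  moreover have "shift_inv p c 0 u = u" by (rule shift_inv_eqI) simp
  ultimately show ?thesis by (auto intro: tendsto_mono[OF at_le])
qed

text \<open>Both summands of u = z + t * \<open>normal_comp p c z\<close> have the same sign, so
  \<bar>c * z\<bar> powr (p - 1) is at most \<bar>u\<bar> / (t * c). Since p > 1, taking the root
  still gives a bound tending to 0.\<close>

lemma shift_inv_at_top: "((\<lambda>t. shift_inv p c t u) \<longlongrightarrow> 0) at_top"
proof -
  have "((\<lambda>t. \<bar>u\<bar> / t / c) \<longlongrightarrow> 0) at_top"
    by (intro tendsto_divide_zero tendsto_divide_0[OF tendsto_const] filterlim_at_top_imp_at_infinity filterlim_ident)
  then have "((\<lambda>t. (\<bar>u\<bar> / t / c) powr (1 / (p - 1))) \<longlongrightarrow> 0) at_top"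
    by (rule tendsto_zero_powrI[OF _ tendsto_const])
      (use p in \<open>auto intro!: eventually_mono[OF eventually_gt_at_top[of 0]] simp: c less_imp_le\<close>)
  then have lim: "((\<lambda>t. (\<bar>u\<bar> / t / c) powr (1 / (p - 1)) / c) \<longlongrightarrow> 0) at_top"
    by (rule tendsto_divide_zero)
  show ?thesis
  proof (rule Lim_null_comparison[OF _ lim])
    show "\<forall>\<^sub>F t in at_top. norm (shift_inv p c t u) \<le> (\<bar>u\<bar> / t / c) powr (1 / (p - 1)) / c"
      using eventually_gt_at_top[of 0]
    proof eventually_elim
      case (elim t)
      define z where "z = shift_inv p c t u"
      have eq: "z + t * normal_comp p c z = u" using shift_shift_inv[of t u] elim by (simp add: z_def)
      have "t * \<bar>normal_comp p c z\<bar> \<le> \<bar>z + t * normal_comp p c z\<bar>"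
        using elim normal_comp_mono[of 0 z] normal_comp_mono[of z 0] by (cases "z \<ge> 0") (auto simp: mult_nonneg_nonpos abs_if)
      then have "\<bar>c * z\<bar> powr (p - 1) \<le> \<bar>u\<bar> / t / c"
        using elim c eq by (simp add: abs_normal_comp field_simps)
      then have "(\<bar>c * z\<bar> powr (p - 1)) powr (1 / (p - 1)) \<le> (\<bar>u\<bar> / t / c) powr (1 / (p - 1))"
        using p by (intro powr_mono2) auto
      then have "\<bar>c * z\<bar> \<le> (\<bar>u\<bar> / t / c) powr (1 / (p - 1))"
        using p by (simp add: powr_powr)
      then show ?case using c by (simp add: z_def abs_mult field_simps)
    qed
  qed
qed

text \<open>Intervals are enough because Lebesgue measure is determined by boxes. The fundamental
  theorem of calculus is used with the exceptional point 0, where the shift is continuous but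
  possibly not differentiable.\<close>

lemma nn_integral_shift:
  assumes t: "\<tau> \<ge> 0" and lh: "l \<le> h"
  shows "(\<integral>\<^sup>+z. ennreal (1 + \<tau> * normal_comp_deriv p c z) * indicator {l<..<h} (z + \<tau> * normal_comp p c z) \<partial>lborel) = ennreal (h - l)"
proof -
  let ?P = "\<lambda>z. z + \<tau> * normal_comp p c z" and ?q = "shift_inv p c \<tau>"
  have P: "?P (?q u) = u" for u using shift_shift_inv[of \<tau> u] t by simp
  have le: "?q l \<le> ?q h" using lh t by (simp add: shift_inv_le_iff P)
  have "((\<lambda>z. 1 + \<tau> * normal_comp_deriv p c z) has_integral ?P (?q h) - ?P (?q l)) {?q l..?q h}"
  proof (rule fundamental_theorem_of_calculus_strong[where S="{0}"])
    show "(?P has_vector_derivative 1 + \<tau> * normal_comp_deriv p c x) (at x)" if "x \<in> {?q l..?q h} - {0}" for x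
      using that unfolding has_real_derivative_iff_has_vector_derivative[symmetric]
      by (auto intro!: derivative_eq_intros DERIV_normal_comp)
    show "continuous_on {?q l..?q h} ?P"
      by (intro continuous_intros continuous_on_subset[OF continuous_normal_comp]) auto
  qed (use le in auto)
  then have "(\<integral>\<^sup>+z. ennreal (1 + \<tau> * normal_comp_deriv p c z) * indicator {?q l..?q h} z \<partial>lborel) = ennreal (h - l)"
    using t normal_comp_deriv_nonneg by (subst nn_integral_has_integral_lebesgue') (auto simp: P)
  moreover have "(\<integral>\<^sup>+z. ennreal (1 + \<tau> * normal_comp_deriv p c z) * indicator {l<..<h} (?P z) \<partial>lborel) =
      (\<integral>\<^sup>+z. ennreal (1 + \<tau> * normal_comp_deriv p c z) * indicator {?q l..?q h} z \<partial>lborel)"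
  proof (rule nn_integral_cong_AE)
    show "AE z in lborel. ennreal (1 + \<tau> * normal_comp_deriv p c z) * indicator {l<..<h} (?P z) =
        ennreal (1 + \<tau> * normal_comp_deriv p c z) * indicator {?q l..?q h} z"
      using AE_lborel_singleton[of "?q l"] AE_lborel_singleton[of "?q h"]
    proof eventually_elim
      case (elim z)
      have "?P z \<in> {l<..<h} \<longleftrightarrow> z \<in> {?q l..?q h}"
        using shift_inv_le_iff[OF t, of z l] shift_inv_ge_iff[OF t, of h z]
          shift_inv_le_iff[OF t, of z h] shift_inv_ge_iff[OF t, of l z] elim by auto
      then show ?case by (simp add: indicator_def)
    qed
  qed
  ultimately show ?thesis by simp
qed

end

lemma borel_measurable_vec_lambda [measurable (raw)]:
  fixes f :: "'n::finite \<Rightarrow> 'a \<Rightarrow> real"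
  assumes "\<And>k. f k \<in> borel_measurable M"
  shows "(\<lambda>x. \<chi> k. f k x) \<in> borel_measurable M"
  using assms by (subst borel_measurable_euclidean_space) (auto simp: Basis_vec_def inner_axis)

lemma borel_measurable_vec_nth [measurable (raw)]:
  fixes f :: "'a \<Rightarrow> real ^ 'n::finite"
  assumes "f \<in> borel_measurable M"
  shows "(\<lambda>x. f x $ k) \<in> borel_measurable M"
  using measurable_compose[OF assms, of "\<lambda>x. x $ k" borel]
  by (simp add: borel_measurable_continuous_onI continuous_intros)

section \<open>Normal coordinates outside the ball\<close>

locale weighted_lp =
  fixes p :: real and a :: "'n::finite \<Rightarrow> real"
  assumes p: "p > 1" and a: "\<And>k. a k > 0"
begin

definition psi :: "real ^ 'n \<Rightarrow> real" where
  "psi z = (\<Sum>k\<in>UNIV. \<bar>a k * z $ k\<bar> powr p)"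

definition rad :: "real ^ 'n \<Rightarrow> real" where
  "rad z = psi z powr (1 / p)"

definition normal :: "real ^ 'n \<Rightarrow> real ^ 'n" where
  "normal z = (\<chi> k. normal_comp p (a k) (z $ k))"

definition normal_deriv :: "real ^ 'n \<Rightarrow> 'n \<Rightarrow> real" where
  "normal_deriv z k = normal_comp_deriv p (a k) (z $ k)"

text \<open>\<open>jac z s\<close> is the density of the volume in the coordinates \<open>z + s *\<^sub>R normal z\<close>.\<close>

definition jac :: "real ^ 'n \<Rightarrow> real \<Rightarrow> real" where
  "jac z s = (\<Sum>i\<in>UNIV. (normal z $ i)\<^sup>2 * (\<Prod>j\<in>UNIV - {i}. 1 + s * normal_deriv z j))"

definition inv_shift :: "real \<Rightarrow> real ^ 'n \<Rightarrow> real ^ 'n" where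
  "inv_shift \<tau> u = (\<chi> k. shift_inv p (a k) \<tau> (u $ k))"

text \<open>For \<tau> > 0 and u without zero coordinates, - p times this value at z =
  \<open>inv_shift \<tau> u\<close> is the derivative of \<open>psi (inv_shift \<tau> u)\<close>
  with respect to \<tau>.\<close>

definition speed :: "real \<Rightarrow> real ^ 'n \<Rightarrow> real" where
  "speed \<tau> z = (\<Sum>i\<in>UNIV. (normal z $ i)\<^sup>2 / (1 + \<tau> * normal_deriv z i))"

lemma measurable_psi [measurable]: "psi \<in> borel_measurable borel"
  unfolding psi_def[abs_def] by measurable

lemma measurable_rad [measurable]: "rad \<in> borel_measurable borel"
  unfolding rad_def[abs_def] by measurable

lemma measurable_normal [measurable]: "normal \<in> borel_measurable borel"
  unfolding normal_def[abs_def] by measurable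

lemma measurable_normal_deriv [measurable (raw)]: "f \<in> borel_measurable M \<Longrightarrow> (\<lambda>x. normal_deriv (f x) k) \<in> borel_measurable M"
  unfolding normal_deriv_def[abs_def] by measurable

lemma measurable_jac [measurable (raw)]:
  assumes [measurable]: "f \<in> borel_measurable M" "h \<in> borel_measurable M"
  shows "(\<lambda>x. jac (f x) (h x)) \<in> borel_measurable M"
  unfolding jac_def[abs_def] by measurable

lemma measurable_speed [measurable (raw)]:
  assumes [measurable]: "f \<in> borel_measurable M" "h \<in> borel_measurable M"
  shows "(\<lambda>x. speed (f x) (h x)) \<in> borel_measurable M"
  unfolding speed_def[abs_def] by measurable

lemma measurable_inv_shift [measurable (raw)]:
  assumes [measurable]: "f \<in> borel_measurable M" "h \<in> borel_measurable M"
  shows "(\<lambda>x. inv_shift (f x) (h x)) \<in> borel_measurable M"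
  unfolding inv_shift_def[abs_def]
  by (intro borel_measurable_vec_lambda borel_measurable_shift_inv p a) measurable

lemma psi_nonneg: "psi z \<ge> 0"
  by (simp add: psi_def sum_nonneg)

lemma psi_0 [simp]: "psi 0 = 0"
  using p by (simp add: psi_def)

lemma psi_pos: "z \<noteq> 0 \<Longrightarrow> psi z > 0"
proof -
  assume "z \<noteq> 0"
  then obtain k where "z $ k \<noteq> 0" by (auto simp: vec_eq_iff)
  then have "0 < \<bar>a k * z $ k\<bar> powr p" using a[of k] by simp
  also have "\<dots> \<le> psi z" unfolding psi_def by (rule member_le_sum) auto
  finally show ?thesis .
qed

lemma psi_scale: "r > 0 \<Longrightarrow> psi (r *\<^sub>R z) = r powr p * psi z"
  by (simp add: psi_def sum_distrib_left abs_mult powr_mult mult_ac)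

lemma rad_scale: "r > 0 \<Longrightarrow> rad (r *\<^sub>R z) = r * rad z"
  using p by (simp add: rad_def psi_scale powr_mult powr_powr)

lemma rad_powr: "rad z powr p = psi z"
  using p psi_nonneg[of z] by (simp add: rad_def powr_powr)

lemma rad_nonneg: "rad z \<ge> 0"
  by (simp add: rad_def)

lemma rad_le_1_iff: "rad z \<le> 1 \<longleftrightarrow> psi z \<le> 1"
proof
  assume "psi z \<le> 1"
  then show "rad z \<le> 1"
    unfolding rad_def using p psi_nonneg[of z] by (intro powr_le1) auto
next
  assume "rad z \<le> 1"
  then show "psi z \<le> 1"
    unfolding rad_powr[symmetric] using p rad_nonneg by (intro powr_le1) auto
qed

lemma rad_eq_1_iff: "rad z = 1 \<longleftrightarrow> psi z = 1"
  using rad_powr[of z] by (auto simp: rad_def)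

lemma weighted_lp_ball_eq: "weighted_lp_ball p a = {z. psi z \<le> 1}"
  by (simp add: weighted_lp_ball_def psi_def)

lemma bounded_ball: "bounded {z. psi z \<le> 1}"
proof (rule boundedI)
  fix z assume "z \<in> {z. psi z \<le> 1}"
  then have z: "psi z \<le> 1" by simp
  have "\<bar>z $ k\<bar> \<le> 1 / a k" for k
  proof -
    have "\<bar>a k * z $ k\<bar> powr p \<le> psi z" unfolding psi_def by (rule member_le_sum) auto
    then have "(\<bar>a k * z $ k\<bar> powr p) powr (1 / p) \<le> 1"
      using z p by (intro powr_le1) auto
    then have "\<bar>a k * z $ k\<bar> \<le> 1" using p by (simp add: powr_powr)
    then show ?thesis using a[of k] by (simp add: abs_mult field_simps)
  qed
  then show "norm z \<le> (\<Sum>k\<in>UNIV. 1 / a k)"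
    by (intro order_trans[OF norm_le_l1_cart] sum_mono)
qed

sublocale gauge rad
proof
  show "bounded {x. rad x \<le> 1}" using bounded_ball by (simp add: rad_le_1_iff)
  show "rad 0 = 0" using p by (simp add: rad_def)
  show "0 < rad x" if "x \<noteq> 0" for x using psi_pos[OF that] by (simp add: rad_def)
qed (simp_all add: rad_scale)

lemma normal_deriv_nonneg: "normal_deriv z k \<ge> 0"
  by (simp add: normal_deriv_def normal_comp_deriv_nonneg[OF p a])

lemma one_plus_normal_deriv_pos: "\<tau> \<ge> 0 \<Longrightarrow> 1 + \<tau> * normal_deriv z k > 0"
  using normal_deriv_nonneg[of z k] by (simp add: add_pos_nonneg)

lemma jac_nonneg: "s \<ge> 0 \<Longrightarrow> jac z s \<ge> 0"
  unfolding jac_def by (intro sum_nonneg mult_nonneg_nonneg prod_nonneg ballI) (auto intro: less_imp_le one_plus_normal_deriv_pos)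

lemma normal_scale: "r > 0 \<Longrightarrow> normal (r *\<^sub>R z) = r powr (p - 1) *\<^sub>R normal z"
  by (simp add: normal_def vec_eq_iff normal_comp_scale[OF p a])

lemma normal_deriv_scale: "r > 0 \<Longrightarrow> normal_deriv (r *\<^sub>R z) k = r powr (p - 2) * normal_deriv z k"
  by (simp add: normal_deriv_def normal_comp_deriv_scale[OF p a])

text \<open>The product is the Jacobian of z \<mapsto> z + \<tau> N z and \<open>speed\<close>
  governs how \<open>rad\<close> changes with \<tau>. The two factors are consumed by two separate
  substitutions.\<close>

lemma jac_eq_speed:
  assumes "\<tau> \<ge> 0"
  shows "jac z \<tau> = speed \<tau> z * (\<Prod>k\<in>UNIV. 1 + \<tau> * normal_deriv z k)"
  unfolding jac_def speed_def sum_distrib_right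
proof (rule sum.cong)
  fix i :: 'n
  show "(normal z $ i)\<^sup>2 * (\<Prod>j\<in>UNIV - {i}. 1 + \<tau> * normal_deriv z j) =
      (normal z $ i)\<^sup>2 / (1 + \<tau> * normal_deriv z i) * (\<Prod>k\<in>UNIV. 1 + \<tau> * normal_deriv z k)"
    using one_plus_normal_deriv_pos[OF assms, of z i] by (subst prod.remove[of UNIV i]) auto
qed simp

lemma jac_scale:
  assumes "r > 0"
  shows "jac (r *\<^sub>R z) s = r powr (2 * p - 2) * jac z (s * r powr (p - 2))"
proof -
  have "(r powr (p - 1))\<^sup>2 = r powr (2 * p - 2)"
    by (simp only: power2_eq_square powr_add[symmetric]) (simp add: algebra_simps)
  then show ?thesis
    unfolding jac_def sum_distrib_left using assms
    by (intro sum.cong) (auto simp: normal_scale normal_deriv_scale power_mult_distrib mult_ac)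
qed

text \<open>A measure giving every box its volume is \<open>lborel\<close>. The indicator of a box
  splits over the coordinates, and each one-dimensional factor is
  \<open>nn_integral_shift\<close>.\<close>

lemma lborel_shift:
  assumes t: "\<tau> \<ge> 0"
  shows "distr (density lborel (\<lambda>z. \<Prod>k\<in>UNIV. ennreal (1 + \<tau> * normal_deriv z k))) borel (\<lambda>z. z + \<tau> *\<^sub>R normal z) = lborel"
    (is "?M = _")
proof (rule lborel_eqI[symmetric])
  fix l u :: "real ^ 'n"
  assume lu: "\<And>b. b \<in> Basis \<Longrightarrow> l \<bullet> b \<le> u \<bullet> b"
  have lu': "l $ k \<le> u $ k" for k
    using lu[of "axis k 1"] by (simp add: inner_axis)
  have "emeasure ?M (box l u) =
      (\<integral>\<^sup>+z. (\<Prod>k\<in>UNIV. ennreal (1 + \<tau> * normal_deriv z k)) * indicator (box l u) (z + \<tau> *\<^sub>R normal z) \<partial>lborel)"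
    by (subst emeasure_distr, measurable, subst emeasure_density, measurable)
       (auto intro!: nn_integral_cong simp: indicator_def)
  also have "\<dots> = (\<integral>\<^sup>+z. (\<Prod>k\<in>UNIV. ennreal (1 + \<tau> * normal_comp_deriv p (a k) (z $ k)) *
      indicator {l $ k<..<u $ k} (z $ k + \<tau> * normal_comp p (a k) (z $ k))) \<partial>lborel)"
  proof (rule nn_integral_cong)
    fix z :: "real ^ 'n"
    have "indicator (box l u) (z + \<tau> *\<^sub>R normal z) =
        (\<Prod>k\<in>UNIV. indicator {l $ k<..<u $ k} (z $ k + \<tau> * normal_comp p (a k) (z $ k)) :: ennreal)"
    proof (cases "z + \<tau> *\<^sub>R normal z \<in> box l u")
      case True
      then show ?thesis by (simp add: mem_box_cart normal_def)
    next
      case False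
      then obtain k where "z $ k + \<tau> * normal_comp p (a k) (z $ k) \<notin> {l $ k<..<u $ k}"
        by (auto simp: mem_box_cart normal_def)
      then show ?thesis using False by (auto intro!: prod_zero[symmetric] exI[of _ k])
    qed
    then show "(\<Prod>k\<in>UNIV. ennreal (1 + \<tau> * normal_deriv z k)) * indicator (box l u) (z + \<tau> *\<^sub>R normal z) =
      (\<Prod>k\<in>UNIV. ennreal (1 + \<tau> * normal_comp_deriv p (a k) (z $ k)) *
        indicator {l $ k<..<u $ k} (z $ k + \<tau> * normal_comp p (a k) (z $ k)))"
      by (simp add: prod.distrib normal_deriv_def)
  qed
  also have "\<dots> = (\<Prod>k\<in>UNIV. ennreal (u $ k - l $ k))"
    by (subst nn_integral_lborel_prod_vec) (use t lu' in \<open>auto simp: nn_integral_shift[OF p a]\<close>)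
  also have "\<dots> = ennreal (\<Prod>b\<in>Basis. (u - l) \<bullet> b)"
    using lu' by (simp add: prod_Basis_vec inner_axis prod_ennreal)
  finally show "emeasure ?M (box l u) = ennreal (\<Prod>b\<in>Basis. (u - l) \<bullet> b)" .
qed simp

lemma inv_shift_shift: "\<tau> \<ge> 0 \<Longrightarrow> inv_shift \<tau> (z + \<tau> *\<^sub>R normal z) = z"
  by (simp add: inv_shift_def normal_def shift_inv_shift[OF p a] vec_eq_iff)

lemma nn_integral_lborel_shift:
  assumes t: "\<tau> \<ge> 0" and [measurable]: "F \<in> borel_measurable borel"
  shows "(\<integral>\<^sup>+z. (\<Prod>k\<in>UNIV. ennreal (1 + \<tau> * normal_deriv z k)) * F (z + \<tau> *\<^sub>R normal z) \<partial>lborel) = (\<integral>\<^sup>+u. F u \<partial>lborel)"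
  by (subst (2) lborel_shift[OF t, symmetric], subst nn_integral_distr, measurable,
      subst nn_integral_density, measurable)

text \<open>The k-th partial derivative of \<open>psi\<close> is p times the k-th component of
  \<open>normal\<close>, and the k-th coordinate of \<open>inv_shift\<close> moves at the rate -
  \<open>normal\<close> / (1 + t * \<open>normal_deriv\<close>). The chain rule therefore produces
  exactly the sum in \<open>speed\<close>.\<close>

lemma DERIV_rad_inv_shift:
  assumes t: "t > 0" and u: "\<And>k. u $ k \<noteq> 0"
  shows "((\<lambda>\<tau>. rad (inv_shift \<tau> u)) has_real_derivative
     - (rad (inv_shift t u) powr (1 - p) * speed t (inv_shift t u))) (at t)"
proof -
  let ?z = "inv_shift t u"
  have nz: "?z $ k \<noteq> 0" for k using u by (simp add: inv_shift_def p a)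
  have D: "((\<lambda>\<tau>. \<bar>a k * inv_shift \<tau> u $ k\<bar> powr p) has_real_derivative
      p * normal ?z $ k * (- normal ?z $ k / (1 + t * normal_deriv ?z k))) (at t)" for k
  proof -
    have "((\<lambda>\<tau>. shift_inv p (a k) \<tau> (u $ k)) has_real_derivative
        - normal_comp p (a k) (shift_inv p (a k) t (u $ k)) / (1 + t * normal_comp_deriv p (a k) (shift_inv p (a k) t (u $ k)))) (at t)"
      by (rule DERIV_shift_inv[OF p a t u])
    from DERIV_chain2[OF DERIV_abs_powr[OF p a] this] show ?thesis
      using nz[of k] by (simp add: inv_shift_def normal_def normal_deriv_def)
  qed
  have "((\<lambda>\<tau>. psi (inv_shift \<tau> u)) has_real_derivative
      (\<Sum>k\<in>UNIV. p * normal ?z $ k * (- normal ?z $ k / (1 + t * normal_deriv ?z k)))) (at t)"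
    unfolding psi_def by (rule DERIV_sum) (rule D)
  also have "(\<Sum>k\<in>UNIV. p * normal ?z $ k * (- normal ?z $ k / (1 + t * normal_deriv ?z k))) = - (p * speed t ?z)"
    by (simp add: speed_def sum_distrib_left sum_negf power2_eq_square mult_ac)
  finally have D2: "((\<lambda>\<tau>. psi (inv_shift \<tau> u)) has_real_derivative - (p * speed t ?z)) (at t)" .
  have "?z \<noteq> 0" using nz by (auto simp: vec_eq_iff)
  then have pos: "psi ?z > 0" by (rule psi_pos)
  have "((\<lambda>x. x powr (1 / p)) has_real_derivative (1 / p) * psi ?z powr (1 / p - 1)) (at (psi ?z))"
    by (rule has_real_derivative_powr[OF pos])
  from DERIV_chain2[OF this D2] have "((\<lambda>\<tau>. rad (inv_shift \<tau> u)) has_real_derivative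
      (1 / p) * psi ?z powr (1 / p - 1) * - (p * speed t ?z)) (at t)"
    by (simp add: rad_def)
  also have "psi ?z powr (1 / p - 1) = rad ?z powr (1 - p)"
    using p by (simp add: rad_def powr_powr field_simps)
  finally show ?thesis using p by simp
qed

lemma speed_pos:
  assumes "\<tau> \<ge> 0" "z \<noteq> 0"
  shows "speed \<tau> z > 0"
proof -
  obtain k where "z $ k \<noteq> 0" using assms(2) by (auto simp: vec_eq_iff)
  then have "normal z $ k \<noteq> 0" by (simp add: normal_def p a)
  then show ?thesis
    unfolding speed_def using one_plus_normal_deriv_pos[OF assms(1), of z]
    by (intro sum_pos2[of _ k]) (auto intro!: divide_nonneg_pos)
qed

lemma inv_shift_eq_0_iff [simp]: "inv_shift \<tau> u = 0 \<longleftrightarrow> u = 0"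
  by (auto simp: inv_shift_def vec_eq_iff p a)

lemma continuous_psi: "continuous_on UNIV psi"
  unfolding psi_def using p by (intro continuous_intros continuous_on_powr') auto

lemma continuous_rad: "continuous_on UNIV rad"
  unfolding rad_def using p by (intro continuous_intros continuous_on_powr' continuous_psi) (auto simp: psi_nonneg)

lemma nn_integral_radial:
  fixes f :: "real \<Rightarrow> ennreal"
  assumes u: "\<And>k. u $ k \<noteq> 0" and [measurable]: "f \<in> borel_measurable borel"
  shows "(\<integral>\<^sup>+\<tau>. f (rad (inv_shift \<tau> u)) *
      ennreal (rad (inv_shift \<tau> u) powr (1 - p) * speed \<tau> (inv_shift \<tau> u)) * indicator {0<..} \<tau> \<partial>lborel) =
    (\<integral>\<^sup>+\<rho>. f \<rho> * indicator {0<..<rad u} \<rho> \<partial>lborel)"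
proof (rule nn_integral_substitution_decreasing)
  let ?q = "\<lambda>\<tau>. inv_shift \<tau> u"
  have u0: "u \<noteq> 0" using u by (auto simp: vec_eq_iff)
  have q: "continuous_on {0<..} (\<lambda>\<tau>. shift_inv p (a k) \<tau> (u $ k))" for k
    using DERIV_shift_inv[OF p a _ u] by (intro DERIV_continuous_on) (auto intro: has_field_derivative_at_within)
  have cq: "continuous_on {0<..} ?q"
    unfolding inv_shift_def by (intro continuous_on_vec_lambda q)
  have crad: "continuous_on {0<..} (\<lambda>\<tau>. rad (?q \<tau>))"
    by (rule continuous_on_compose2[OF continuous_rad cq]) auto
  have cn: "continuous_on {0<..} (\<lambda>\<tau>. normal (?q \<tau>))"
    unfolding normal_def
    by (intro continuous_on_vec_lambda continuous_on_compose2[OF continuous_normal_comp[OF p a]]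
        continuous_intros cq) auto
  \<comment> \<open>For p < 2 the function \<open>normal_deriv\<close> is unbounded near coordinate
    hyperplanes. The curve avoids them because \<open>shift_inv\<close> sends nonzero values to
    nonzero values.\<close>
  have ccv: "continuous_on {0<..} (\<lambda>\<tau>. normal_deriv (?q \<tau>) k)" for k
    unfolding normal_deriv_def normal_comp_deriv_def
    using a u by (intro continuous_intros cq) (auto simp: inv_shift_def p less_le shift_inv_eq_0_iff[OF p a])
  show "continuous_on {0<..} (\<lambda>\<tau>. rad (?q \<tau>) powr (1 - p) * speed \<tau> (?q \<tau>))"
    unfolding speed_def
  proof (intro continuous_intros crad cn ccv ballI)
    show "rad (?q t) \<noteq> 0" for t using g_pos[of "?q t"] u0 by simp
    show "1 + t * normal_deriv (?q t) k \<noteq> 0" if "t \<in> {0<..}" for t k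
      using one_plus_normal_deriv_pos[of t "?q t" k] that by simp
  qed
  show "((\<lambda>\<tau>. rad (?q \<tau>)) has_real_derivative - (rad (?q t) powr (1 - p) * speed t (?q t))) (at t)"
    if "t > 0" for t by (rule DERIV_rad_inv_shift[OF that u])
  show "0 < rad (?q t) powr (1 - p) * speed t (?q t)" if "t > 0" for t
    using that u0 g_pos[of "?q t"] by (intro mult_pos_pos speed_pos) auto
  have isC: "(rad \<longlongrightarrow> rad x) (nhds x)" for x
    using continuous_rad by (simp add: continuous_on_eq_continuous_at isCont_def tendsto_at_iff_tendsto_nhds)
  have "(?q \<longlongrightarrow> (\<chi> k. u $ k)) (at_right 0)"
    unfolding inv_shift_def by (intro tendsto_vec_lambda shift_inv_at_right_0 p a)
  then show "((\<lambda>\<tau>. rad (?q \<tau>)) \<longlongrightarrow> rad u) (at_right 0)"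
    by (intro filterlim_compose[OF isC]) simp
  have "(?q \<longlongrightarrow> (\<chi> k. 0)) at_top"
    unfolding inv_shift_def by (intro tendsto_vec_lambda shift_inv_at_top p a)
  then have "((\<lambda>\<tau>. rad (?q \<tau>)) \<longlongrightarrow> rad 0) at_top"
    by (intro filterlim_compose[OF isC]) (simp add: zero_vec_def)
  then show "((\<lambda>\<tau>. rad (?q \<tau>)) \<longlongrightarrow> 0) at_top" by (simp add: g_zero)
qed measurable

lemma AE_lborel_nth_nonzero: "AE u in lborel. \<forall>k. (u :: real ^ 'n) $ k \<noteq> 0"
proof -
  have "AE u in lborel. (u :: real ^ 'n) $ k \<noteq> 0" for k
  proof -
    have "negligible {u :: real ^ 'n. u $ k = 0}"
      using negligible_standard_hyperplane[of "axis k 1 :: real ^ 'n" 0] by (simp add: inner_axis)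
    moreover have "{u :: real ^ 'n. u $ k = 0} \<in> sets borel" by measurable
    ultimately have "{u :: real ^ 'n. u $ k = 0} \<in> null_sets lborel"
      by (auto simp: negligible_iff_null_sets null_sets_completion_iff)
    from AE_not_in[OF this] show ?thesis by simp
  qed
  then show ?thesis by (simp add: AE_all_countable)
qed

lemma normal_ray_substitution:
  assumes z: "z \<noteq> 0" and [measurable]: "G \<in> borel_measurable borel"
  defines "r \<equiv> rad z"
  shows "(\<integral>\<^sup>+s. G (z /\<^sub>R r + s *\<^sub>R normal (z /\<^sub>R r)) * ennreal (jac (z /\<^sub>R r) s) * indicator {0<..} s \<partial>lborel) =
    (\<integral>\<^sup>+\<tau>. G ((z + \<tau> *\<^sub>R normal z) /\<^sub>R r) * ennreal (r powr (- p) * jac z \<tau>) * indicator {0<..} \<tau> \<partial>lborel)"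
proof -
  have r: "r > 0" unfolding r_def by (rule g_pos[OF z])
  \<comment> \<open>Since \<open>normal\<close> has degree p - 1, this is the factor for which
    \<open>e *\<^sub>R normal (z /\<^sub>R r)\<close> equals \<open>normal z /\<^sub>R r\<close>.
    The same factor turns the degree 2 - 2 * p of \<open>jac\<close> into r powr (- p).\<close>
  define e where "e = r powr (p - 2)"
  have e: "e > 0" using r by (simp add: e_def)
  have n: "normal (z /\<^sub>R r) = r powr (1 - p) *\<^sub>R normal z"
    using normal_scale[of "inverse r" z] r by (simp add: powr_minus[symmetric] inverse_powr)
  have j: "jac (z /\<^sub>R r) (e * \<tau>) = r powr (2 - 2 * p) * jac z \<tau>" for \<tau>
  proof -
    have eq: "e * \<tau> * inverse r powr (p - 2) = \<tau>"
      using r by (simp add: e_def inverse_powr)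
    show ?thesis
      using jac_scale[of "inverse r" z "e * \<tau>", unfolded eq] r
      by (simp add: powr_minus[symmetric] inverse_powr)
  qed
  have er: "e * r powr (1 - p) = inverse r" "e * r powr (2 - 2 * p) = r powr (- p)"
  proof -
    have "e * r powr (1 - p) = r powr (- 1)" unfolding e_def by (simp only: powr_add[symmetric]) simp
    then show "e * r powr (1 - p) = inverse r" using r by (simp add: powr_minus)
    show "e * r powr (2 - 2 * p) = r powr (- p)" unfolding e_def by (simp only: powr_add[symmetric]) simp
  qed
  have "(\<integral>\<^sup>+s. G (z /\<^sub>R r + s *\<^sub>R normal (z /\<^sub>R r)) * ennreal (jac (z /\<^sub>R r) s) * indicator {0<..} s \<partial>lborel) =
    e * (\<integral>\<^sup>+\<tau>. G (z /\<^sub>R r + (e * \<tau>) *\<^sub>R normal (z /\<^sub>R r)) * ennreal (jac (z /\<^sub>R r) (e * \<tau>)) * indicator {0<..} (e * \<tau>) \<partial>lborel)"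
    using e by (subst nn_integral_real_affine[where c=e and t=0]) auto
  also have "\<dots> = (\<integral>\<^sup>+\<tau>. ennreal e * (G (z /\<^sub>R r + (e * \<tau>) *\<^sub>R normal (z /\<^sub>R r)) * ennreal (jac (z /\<^sub>R r) (e * \<tau>)) * indicator {0<..} (e * \<tau>)) \<partial>lborel)"
    by (subst nn_integral_cmult) auto
  also have "\<dots> = (\<integral>\<^sup>+\<tau>. G ((z + \<tau> *\<^sub>R normal z) /\<^sub>R r) * ennreal (r powr (- p) * jac z \<tau>) * indicator {0<..} \<tau> \<partial>lborel)"
  proof (rule nn_integral_cong)
    fix \<tau> :: real
    show "ennreal e * (G (z /\<^sub>R r + (e * \<tau>) *\<^sub>R normal (z /\<^sub>R r)) * ennreal (jac (z /\<^sub>R r) (e * \<tau>)) * indicator {0<..} (e * \<tau>)) =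
      G ((z + \<tau> *\<^sub>R normal z) /\<^sub>R r) * ennreal (r powr (- p) * jac z \<tau>) * indicator {0<..} \<tau>"
    proof (cases "\<tau> > 0")
      case True
      have "z /\<^sub>R r + (e * \<tau>) *\<^sub>R normal (z /\<^sub>R r) = z /\<^sub>R r + (\<tau> * (e * r powr (1 - p))) *\<^sub>R normal z"
        by (simp add: n mult_ac)
      also have "\<dots> = (z + \<tau> *\<^sub>R normal z) /\<^sub>R r"
        by (simp only: er) (simp add: scaleR_add_right mult_ac)
      finally have 1: "z /\<^sub>R r + (e * \<tau>) *\<^sub>R normal (z /\<^sub>R r) = (z + \<tau> *\<^sub>R normal z) /\<^sub>R r" .
      have 2: "ennreal e * ennreal (jac (z /\<^sub>R r) (e * \<tau>)) = ennreal (r powr (- p) * jac z \<tau>)"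
        using e by (simp only: j ennreal_mult'[symmetric] less_imp_le mult.assoc[symmetric] er)
      show ?thesis unfolding 1 2[symmetric] using True e by (simp add: mult.left_commute)
    qed (use e in \<open>simp add: zero_less_mult_iff\<close>)
  qed
  finally show ?thesis .
qed

text \<open>No determinant is needed: with \<open>s = \<tau> * rad z powr (p - 2)\<close> the point \<open>x + s *\<^sub>R normal x\<close> on the ray
  through \<open>x = z /\<^sub>R rad z\<close> becomes \<open>(z + \<tau> *\<^sub>R normal z) /\<^sub>R rad z\<close>. For fixed \<open>\<tau>\<close> the map
  \<open>z \<mapsto> z + \<tau> *\<^sub>R normal z\<close> acts on each coordinate separately, so \<open>u = z + \<tau> *\<^sub>R normal z\<close> is a product of
  one-dimensional substitutions. For fixed \<open>u\<close> the variable \<open>\<tau>\<close> is then replaced by \<open>\<rho> = rad z\<close>, which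
  decreases from \<open>rad u\<close> to \<open>0\<close>, and finally \<open>u = \<rho> *\<^sub>R y\<close>.\<close>

lemma nn_integral_normal_coordinates:
  assumes [measurable]: "G \<in> borel_measurable borel"
  shows "(\<integral>\<^sup>+x. (\<integral>\<^sup>+s. G (x + s *\<^sub>R normal x) * ennreal (jac x s) * indicator {0<..} s \<partial>lborel) \<partial>cone_measure rad) =
    (\<integral>\<^sup>+y. G y * indicator {y. rad y > 1} y \<partial>lborel)"
proof -
  let ?n = "DIM(real ^ 'n)"
  define q where "q \<tau> u = rad (inv_shift \<tau> u)" for \<tau> u
  have [measurable]: "(\<lambda>x. q (f x) (h x)) \<in> borel_measurable M"
    if [measurable]: "f \<in> borel_measurable M" "h \<in> borel_measurable M" for f h and M :: "'b measure"
    unfolding q_def by measurable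
  \<comment> \<open>Everything is expressed through u = z + \<tau> N z; the product of the 1 +
    \<tau> * \<open>normal_deriv z k\<close> has been split off from \<open>jac\<close>, which
    leaves \<open>speed\<close>.\<close>
  define F where "F \<tau> u = G (u /\<^sub>R q \<tau> u) * ennreal (q \<tau> u powr (- p) * speed \<tau> (inv_shift \<tau> u)) *
    indicator {..1} (q \<tau> u) * indicator {0<..} \<tau>" for \<tau> u
  have [measurable]: "(\<lambda>x. F (f x) (h x)) \<in> borel_measurable M"
    if [measurable]: "f \<in> borel_measurable M" "h \<in> borel_measurable M" for f h and M :: "'b measure"
    unfolding F_def by measurable
  have nz: "AE z in lborel. z \<noteq> (0 :: real ^ 'n)" by (rule AE_lborel_singleton)
  have "(\<integral>\<^sup>+x. (\<integral>\<^sup>+s. G (x + s *\<^sub>R normal x) * ennreal (jac x s) * indicator {0<..} s \<partial>lborel) \<partial>cone_measure rad) =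
    of_nat ?n * (\<integral>\<^sup>+z. (\<integral>\<^sup>+s. G (z /\<^sub>R rad z + s *\<^sub>R normal (z /\<^sub>R rad z)) * ennreal (jac (z /\<^sub>R rad z) s) * indicator {0<..} s \<partial>lborel) *
      indicator {z. rad z \<le> 1} z \<partial>lborel)"
    by (subst nn_integral_cone_measure) auto
  also have "\<dots> = of_nat ?n * (\<integral>\<^sup>+z. (\<integral>\<^sup>+\<tau>. G ((z + \<tau> *\<^sub>R normal z) /\<^sub>R rad z) * ennreal (rad z powr (- p) * jac z \<tau>) * indicator {0<..} \<tau> \<partial>lborel) *
      indicator {z. rad z \<le> 1} z \<partial>lborel)"
    using nz by (intro arg_cong[where f="\<lambda>x. of_nat ?n * x"] nn_integral_cong_AE, eventually_elim)
      (simp only: normal_ray_substitution[OF _ assms] not_False_eq_True)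
  also have "\<dots> = of_nat ?n * (\<integral>\<^sup>+z. (\<integral>\<^sup>+\<tau>. G ((z + \<tau> *\<^sub>R normal z) /\<^sub>R rad z) * ennreal (rad z powr (- p) * jac z \<tau>) * indicator {0<..} \<tau> *
      indicator {z. rad z \<le> 1} z \<partial>lborel) \<partial>lborel)"
    by (subst nn_integral_multc) auto
  also have "\<dots> = of_nat ?n * (\<integral>\<^sup>+z. (\<integral>\<^sup>+\<tau>. (\<Prod>k\<in>UNIV. ennreal (1 + \<tau> * normal_deriv z k)) * F \<tau> (z + \<tau> *\<^sub>R normal z) \<partial>lborel) \<partial>lborel)"
  proof (rule arg_cong[where f="\<lambda>x. of_nat ?n * x"], rule nn_integral_cong, rule nn_integral_cong)
    fix z :: "real ^ 'n" and \<tau> :: real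
    show "G ((z + \<tau> *\<^sub>R normal z) /\<^sub>R rad z) * ennreal (rad z powr (- p) * jac z \<tau>) * indicator {0<..} \<tau> * indicator {z. rad z \<le> 1} z =
      (\<Prod>k\<in>UNIV. ennreal (1 + \<tau> * normal_deriv z k)) * F \<tau> (z + \<tau> *\<^sub>R normal z)"
    proof (cases "\<tau> > 0")
      case True
      have "ennreal (rad z powr (- p) * jac z \<tau>) = ennreal ((\<Prod>k\<in>UNIV. 1 + \<tau> * normal_deriv z k) * (rad z powr (- p) * speed \<tau> z))"
        using True by (simp add: jac_eq_speed mult_ac)
      also have "\<dots> = (\<Prod>k\<in>UNIV. ennreal (1 + \<tau> * normal_deriv z k)) * ennreal (rad z powr (- p) * speed \<tau> z)"
        using True one_plus_normal_deriv_pos[of \<tau> z] by (subst ennreal_mult') (auto simp: prod_ennreal less_imp_le intro!: prod_nonneg)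
      finally show ?thesis
        using True by (simp add: F_def q_def inv_shift_shift indicator_def mult_ac)
    qed (simp add: F_def)
  qed
  also have "\<dots> = of_nat ?n * (\<integral>\<^sup>+\<tau>. (\<integral>\<^sup>+z. (\<Prod>k\<in>UNIV. ennreal (1 + \<tau> * normal_deriv z k)) * F \<tau> (z + \<tau> *\<^sub>R normal z) \<partial>lborel) \<partial>lborel)"
    by (subst lborel_pair.Fubini') auto
  also have "\<dots> = of_nat ?n * (\<integral>\<^sup>+\<tau>. (\<integral>\<^sup>+u. F \<tau> u \<partial>lborel) \<partial>lborel)"
  proof (rule arg_cong[where f="\<lambda>x. of_nat ?n * x"], rule nn_integral_cong)
    fix \<tau> :: real
    show "(\<integral>\<^sup>+z. (\<Prod>k\<in>UNIV. ennreal (1 + \<tau> * normal_deriv z k)) * F \<tau> (z + \<tau> *\<^sub>R normal z) \<partial>lborel) = (\<integral>\<^sup>+u. F \<tau> u \<partial>lborel)"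
    proof (cases "\<tau> > 0")
      case True
      then show ?thesis by (intro nn_integral_lborel_shift) auto
    qed (simp add: F_def)
  qed
  also have "\<dots> = of_nat ?n * (\<integral>\<^sup>+u. (\<integral>\<^sup>+\<tau>. F \<tau> u \<partial>lborel) \<partial>lborel)"
    by (subst lborel_pair.Fubini') auto
  also have "\<dots> = of_nat ?n * (\<integral>\<^sup>+u. (\<integral>\<^sup>+\<rho>. G (u /\<^sub>R \<rho>) * ennreal (1 / \<rho>) * indicator {..1} \<rho> * indicator {0<..<rad u} \<rho> \<partial>lborel) \<partial>lborel)"
  proof (rule arg_cong[where f="\<lambda>x. of_nat ?n * x"], rule nn_integral_cong_AE, use AE_lborel_nth_nonzero in eventually_elim)
    case (elim u)
    then have u: "\<And>k. u $ k \<noteq> 0" by simp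
    then have "u \<noteq> 0" by (auto simp: vec_eq_iff)
    have "(\<integral>\<^sup>+\<tau>. F \<tau> u \<partial>lborel) = (\<integral>\<^sup>+\<tau>. (\<lambda>\<rho>. G (u /\<^sub>R \<rho>) * ennreal (1 / \<rho>) * indicator {..1} \<rho>) (rad (inv_shift \<tau> u)) *
      ennreal (rad (inv_shift \<tau> u) powr (1 - p) * speed \<tau> (inv_shift \<tau> u)) * indicator {0<..} \<tau> \<partial>lborel)"
    proof (rule nn_integral_cong)
      fix \<tau> :: real
      have q: "q \<tau> u > 0" unfolding q_def using \<open>u \<noteq> 0\<close> by (intro g_pos) simp
      \<comment> \<open>The factor \<open>q \<tau> u powr (1 - p) * speed\<close> is the rate of
        decrease of \<rho> = \<open>q \<tau> u\<close>, so the radial substitution absorbs it and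
        only the weight 1/\<rho> remains.\<close>
      have "q \<tau> u powr (- p) * speed \<tau> (inv_shift \<tau> u) = (1 / q \<tau> u) * (q \<tau> u powr (1 - p) * speed \<tau> (inv_shift \<tau> u))"
        using q by (simp add: powr_diff powr_minus field_simps)
      then have "ennreal (q \<tau> u powr (- p) * speed \<tau> (inv_shift \<tau> u)) =
        ennreal (1 / q \<tau> u) * ennreal (q \<tau> u powr (1 - p) * speed \<tau> (inv_shift \<tau> u))"
        using q by (simp only: ennreal_mult' less_imp_le zero_le_divide_1_iff)
      then show "F \<tau> u = (\<lambda>\<rho>. G (u /\<^sub>R \<rho>) * ennreal (1 / \<rho>) * indicator {..1} \<rho>) (rad (inv_shift \<tau> u)) *
        ennreal (rad (inv_shift \<tau> u) powr (1 - p) * speed \<tau> (inv_shift \<tau> u)) * indicator {0<..} \<tau>"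
        by (simp add: F_def q_def[symmetric] mult_ac)
    qed
    also have "\<dots> = (\<integral>\<^sup>+\<rho>. G (u /\<^sub>R \<rho>) * ennreal (1 / \<rho>) * indicator {..1} \<rho> * indicator {0<..<rad u} \<rho> \<partial>lborel)"
      by (rule nn_integral_radial[OF u]) measurable
    finally show ?case .
  qed
  also have "\<dots> = of_nat ?n * (\<integral>\<^sup>+\<rho>. (\<integral>\<^sup>+u. G (u /\<^sub>R \<rho>) * ennreal (1 / \<rho>) * indicator {..1} \<rho> * indicator {0<..<rad u} \<rho> \<partial>lborel) \<partial>lborel)"
  proof -
    have [measurable]: "Measurable.pred (borel \<Otimes>\<^sub>M borel) (\<lambda>x::(real ^ 'n) \<times> real. snd x \<in> {0<..<rad (fst x)})"
      by (simp add: greaterThanLessThan_iff) measurable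
    show ?thesis by (subst lborel_pair.Fubini') auto
  qed
  also have "\<dots> = of_nat ?n * (\<integral>\<^sup>+\<rho>. ennreal (\<rho> ^ (?n - 1)) * indicator {0<..1} \<rho> * (\<integral>\<^sup>+y. G y * indicator {y. rad y > 1} y \<partial>lborel) \<partial>lborel)"
  proof (rule arg_cong[where f="\<lambda>x. of_nat ?n * x"], rule nn_integral_cong)
    fix \<rho> :: real
    show "(\<integral>\<^sup>+u. G (u /\<^sub>R \<rho>) * ennreal (1 / \<rho>) * indicator {..1} \<rho> * indicator {0<..<rad u} \<rho> \<partial>lborel) =
      ennreal (\<rho> ^ (?n - 1)) * indicator {0<..1} \<rho> * (\<integral>\<^sup>+y. G y * indicator {y. rad y > 1} y \<partial>lborel)"
    proof (cases "\<rho> > 0")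
      case True
      have [measurable]: "Measurable.pred borel (\<lambda>u::real ^ 'n. \<rho> \<in> {0<..<rad u})"
        by (simp add: greaterThanLessThan_iff) measurable
      have pw: "ennreal (\<rho> ^ ?n) * ennreal (1 / \<rho>) = ennreal (\<rho> ^ (?n - 1))"
        using True by (cases ?n) (simp_all add: ennreal_mult'[symmetric])
      have "(\<integral>\<^sup>+u. G (u /\<^sub>R \<rho>) * ennreal (1 / \<rho>) * indicator {..1} \<rho> * indicator {0<..<rad u} \<rho> \<partial>lborel) =
        ennreal (\<rho> ^ ?n) * (\<integral>\<^sup>+y. G ((\<rho> *\<^sub>R y) /\<^sub>R \<rho>) * ennreal (1 / \<rho>) * indicator {..1} \<rho> * indicator {0<..<rad (\<rho> *\<^sub>R y)} \<rho> \<partial>lborel)"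
        by (rule nn_integral_lborel_scaleR[OF _ True]) measurable
      also have "\<dots> = ennreal (\<rho> ^ ?n) * (\<integral>\<^sup>+y. (ennreal (1 / \<rho>) * indicator {..1} \<rho>) * (G y * indicator {y. rad y > 1} y) \<partial>lborel)"
        using True by (intro arg_cong[where f="\<lambda>x. ennreal (\<rho> ^ ?n) * x"] nn_integral_cong)
          (simp add: rad_scale indicator_def mult.commute)
      also have "\<dots> = ennreal (\<rho> ^ ?n) * (ennreal (1 / \<rho>) * indicator {..1} \<rho> * (\<integral>\<^sup>+y. (G y * indicator {y. rad y > 1} y) \<partial>lborel))"
        by (subst nn_integral_cmult) auto
      also have "\<dots> = ennreal (\<rho> ^ (?n - 1)) * indicator {0<..1} \<rho> * (\<integral>\<^sup>+y. G y * indicator {y. rad y > 1} y \<partial>lborel)"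
        unfolding pw[symmetric] using True by (simp add: indicator_def mult_ac)
      finally show ?thesis .
    qed simp
  qed
  also have "\<dots> = of_nat ?n * (\<integral>\<^sup>+\<rho>. ennreal (\<rho> ^ (?n - 1)) * indicator {0<..1} \<rho> \<partial>lborel) * (\<integral>\<^sup>+y. G y * indicator {y. rad y > 1} y \<partial>lborel)"
    by (subst nn_integral_multc) (auto simp: mult.assoc)
  \<comment> \<open>This 1/n cancels the factor n built into \<open>cone_measure\<close>.\<close>
  also have "(\<integral>\<^sup>+\<rho>. ennreal (\<rho> ^ (?n - 1)) * indicator {0<..1} \<rho> \<partial>lborel) = ennreal (1 / real ?n)"
  proof -
    have "(\<integral>\<^sup>+\<rho>. ennreal (\<rho> ^ (?n - 1)) * indicator {0<..1} \<rho> \<partial>lborel) = (\<integral>\<^sup>+\<rho>. ennreal (\<rho> ^ (?n - 1)) * indicator {0..1} \<rho> \<partial>lborel)"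
      using AE_lborel_singleton[of "0::real"] by (intro nn_integral_cong_AE, eventually_elim) (auto simp: indicator_def)
    also have "\<dots> = ennreal (1 ^ ?n / ?n - 0 ^ ?n / ?n)"
      by (rule nn_integral_FTC_Icc) (auto intro!: derivative_eq_intros)
    finally show ?thesis by (simp add: zero_power)
  qed
  also have "of_nat ?n * ennreal (1 / real ?n) = 1"
    by (simp add: ennreal_of_nat_eq_real_of_nat ennreal_mult'[symmetric])
  finally show ?thesis by simp
qed

end

section \<open>Integrals of homogeneous functions\<close>

text \<open>The real change of variables is applied to the real and the imaginary part, and the two
  results are recombined.\<close>

lemma absolute_integral_change_of_variables_complex:
  fixes f :: "real \<Rightarrow> complex" and g :: "real \<Rightarrow> real"
  assumes S: "S \<in> sets lebesgue"
    and der: "\<And>x. x \<in> S \<Longrightarrow> (g has_field_derivative g' x) (at x within S)"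
    and inj: "inj_on g S"
    and f: "f absolutely_integrable_on (g ` S)"
  shows "(\<lambda>x. of_real \<bar>g' x\<bar> * f (g x)) absolutely_integrable_on S"
    and "integral S (\<lambda>x. of_real \<bar>g' x\<bar> * f (g x)) = integral (g ` S) f"
proof -
  have real: "(\<lambda>x. \<bar>g' x\<bar> * h (f (g x))) absolutely_integrable_on S \<and>
      integral S (\<lambda>x. \<bar>g' x\<bar> * h (f (g x))) = h (integral (g ` S) f)"
    if h: "bounded_linear h" for h :: "complex \<Rightarrow> real"
  proof (subst has_absolute_integral_change_of_variables_1'[OF S der inj, where f="\<lambda>x. h (f x)"])
    show "(\<lambda>x. h (f x)) absolutely_integrable_on g ` S \<and> integral (g ` S) (\<lambda>x. h (f x)) = h (integral (g ` S) f)"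
      using absolutely_integrable_linear[OF f h] integral_linear[OF _ h, of f "g ` S"] f
      by (simp add: o_def absolutely_integrable_on_def)
  qed
  note re = real[OF bounded_linear_Re] and im = real[OF bounded_linear_Im]
  have eq: "of_real \<bar>g' x\<bar> * f (g x) =
      complex_of_real (\<bar>g' x\<bar> * Re (f (g x))) + \<i> * complex_of_real (\<bar>g' x\<bar> * Im (f (g x)))" for x
    by (simp add: complex_eq_iff)
  have bl: "bounded_linear (\<lambda>x. \<i> * complex_of_real x)"
    by (intro bounded_linear_const_mult bounded_linear_of_real)
  have br: "bounded_linear complex_of_real" by (rule bounded_linear_of_real)
  have A: "(\<lambda>x. complex_of_real (\<bar>g' x\<bar> * Re (f (g x)))) absolutely_integrable_on S"
    using absolutely_integrable_linear[OF conjunct1[OF re] bounded_linear_of_real] by (simp add: o_def)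
  have B: "(\<lambda>x. \<i> * complex_of_real (\<bar>g' x\<bar> * Im (f (g x)))) absolutely_integrable_on S"
    using absolutely_integrable_linear[OF conjunct1[OF im] bl] by (simp add: o_def)
  show "(\<lambda>x. of_real \<bar>g' x\<bar> * f (g x)) absolutely_integrable_on S"
    unfolding eq by (rule set_integral_add(1)[OF A B])
  have "integral S (\<lambda>x. of_real \<bar>g' x\<bar> * f (g x)) =
      integral S (\<lambda>x. complex_of_real (\<bar>g' x\<bar> * Re (f (g x)))) +
      integral S (\<lambda>x. \<i> * complex_of_real (\<bar>g' x\<bar> * Im (f (g x))))"
    unfolding eq using A B by (intro Henstock_Kurzweil_Integration.integral_add) (auto simp: absolutely_integrable_on_def)
  also have "\<dots> = complex_of_real (Re (integral (g ` S) f)) + \<i> * complex_of_real (Im (integral (g ` S) f))"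
    using re im integral_linear[OF _ br, of "\<lambda>x. \<bar>g' x\<bar> * Re (f (g x))" S]
      integral_linear[OF _ bl, of "\<lambda>x. \<bar>g' x\<bar> * Im (f (g x))" S]
    by (simp add: o_def absolutely_integrable_on_def)
  also have "\<dots> = integral (g ` S) f" by (simp add: complex_eq_iff)
  finally show "integral S (\<lambda>x. of_real \<bar>g' x\<bar> * f (g x)) = integral (g ` S) f" .
qed

text \<open>Bridge from gauge integrals, in which the Gamma integral and the change of variables are
  stated, to Bochner integrals over \<open>lborel\<close>; a Borel function has the same integral
  over the completion.\<close>

lemma lborel_of_absolutely_integrable:
  fixes f :: "real \<Rightarrow> complex"
  assumes [measurable]: "f \<in> borel_measurable borel" "S \<in> sets borel" and "f absolutely_integrable_on S"
  shows "integrable lborel (\<lambda>x. indicator S x *\<^sub>R f x)"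
    and "(\<integral>x. indicator S x *\<^sub>R f x \<partial>lborel) = integral S f"
proof -
  have "integrable lebesgue (\<lambda>x. indicator S x *\<^sub>R f x)"
    using assms(3) by (simp add: set_integrable_def)
  then show "integrable lborel (\<lambda>x. indicator S x *\<^sub>R f x)"
    by (subst (asm) integrable_completion) auto
  have "(\<integral>x. indicator S x *\<^sub>R f x \<partial>lborel) = (\<integral>x. indicator S x *\<^sub>R f x \<partial>lebesgue)"
    by (rule integral_completion[symmetric]) auto
  also have "\<dots> = integral S f"
    using set_lebesgue_integral_eq_integral(2)[OF assms(3)] by (simp add: set_lebesgue_integral_def)
  finally show "(\<integral>x. indicator S x *\<^sub>R f x \<partial>lborel) = integral S f" .
qed

text \<open>Complex \<open>powr\<close> jumps across the negative axis. For real arguments the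
  logarithm has an explicit piecewise form, from which measurability is immediate.\<close>

lemma borel_measurable_of_real_powr [measurable (raw)]:
  fixes f :: "'a \<Rightarrow> real"
  assumes [measurable]: "f \<in> borel_measurable M"
  shows "(\<lambda>x. complex_of_real (f x) powr w) \<in> borel_measurable M"
proof -
  have "complex_of_real y powr w = (if y = 0 then 0 else
      exp (w * (complex_of_real (ln \<bar>y\<bar>) + (if y < 0 then complex_of_real pi else 0) * \<i>)))" for y
    by (simp add: powr_def Ln_of_real')
  then show ?thesis by simp
qed

lemma of_real_powr_powr:
  "t > 0 \<Longrightarrow> complex_of_real (t powr q) powr z = complex_of_real t powr (of_real q * z)"
  by (simp add: powr_def Ln_of_real ln_powr mult_ac)

text \<open>Euler's integral for d / p after the substitution t = r powr p, whose derivative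
  supplies the factor p.\<close>

lemma
  assumes p: "p > 0" and d: "Re d > 0"
  shows integrable_exp_powr: "integrable lborel (\<lambda>r. indicator {0<..} r *\<^sub>R
        (complex_of_real r powr (d - 1) * complex_of_real (exp (- (r powr p)))))" (is ?I)
    and integral_exp_powr: "(\<integral>r. indicator {0<..} r *\<^sub>R
        (complex_of_real r powr (d - 1) * complex_of_real (exp (- (r powr p)))) \<partial>lborel) =
      Gamma (d / of_real p) / of_real p" (is ?E)
proof -
  let ?z = "d / of_real p" and ?g = "\<lambda>r::real. r powr p" and ?g' = "\<lambda>r::real. p * r powr (p - 1)"
  let ?f = "\<lambda>t. complex_of_real t powr (?z - 1) / complex_of_real (exp t)"
  let ?h = "\<lambda>r. complex_of_real r powr (d - 1) * complex_of_real (exp (- (r powr p)))"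
  have z: "Re ?z > 0" using d p by simp
  have S: "({0<..} :: real set) \<in> sets lebesgue" by simp
  have inj: "inj_on ?g {0<..}"
  proof (rule inj_onI)
    fix x y :: real assume xy: "x \<in> {0<..}" "y \<in> {0<..}" "x powr p = y powr p"
    have "x = (x powr p) powr (1 / p)" using xy(1) p by (simp add: powr_powr)
    also have "\<dots> = y" unfolding xy(3) using xy(2) p by (simp add: powr_powr)
    finally show "x = y" .
  qed
  have img: "?g ` {0<..} = {0<..}"
  proof (intro equalityI subsetI)
    fix t :: real assume "t \<in> {0<..}"
    then have "t = (t powr (1 / p)) powr p" "t powr (1 / p) > 0" using p by (auto simp: powr_powr)
    then show "t \<in> ?g ` {0<..}" by blast
  qed auto
  have der: "(?g has_field_derivative ?g' r) (at r within {0<..})" if "r \<in> {0<..}" for r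
    by (rule has_field_derivative_at_within[OF has_real_derivative_powr]) (use that in auto)
  have fi: "?f absolutely_integrable_on (?g ` {0<..})"
    unfolding img by (rule absolutely_integrable_Gamma_integral'[OF z])
  have eq: "of_real \<bar>?g' r\<bar> * ?f (?g r) = of_real p * ?h r" if "r \<in> {0<..}" for r
  proof -
    have r: "r > 0" using that by simp
    have "complex_of_real (r powr (p - 1)) * complex_of_real (?g r) powr (?z - 1) =
        complex_of_real r powr (of_real (p - 1)) * complex_of_real r powr (of_real p * (?z - 1))"
      by (simp only: of_real_powr_powr[OF r] powr_of_real[OF less_imp_le[OF r]])
    also have "\<dots> = complex_of_real r powr (d - 1)"
      using p by (simp only: powr_add[symmetric]) (simp add: field_simps)
    finally show ?thesis
      using r p by (simp add: abs_mult exp_minus field_simps)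
  qed
  note cov = absolute_integral_change_of_variables_complex[OF S der inj fi]
  have A: "(\<lambda>r. of_real p * ?h r) absolutely_integrable_on {0<..}"
    by (rule iffD1[OF set_integrable_cong[OF refl refl eq] cov(1)])
  have "integral {0<..} (\<lambda>r. of_real p * ?h r) = integral {0<..} (\<lambda>r. of_real \<bar>?g' r\<bar> * ?f (?g r))"
    by (rule integral_cong) (simp only: eq)
  also have "\<dots> = integral (?g ` {0<..}) ?f" by (rule cov(2))
  also have "\<dots> = Gamma ?z"
    unfolding img by (rule integral_unique[OF Gamma_integral_complex'[OF z]])
  finally have I: "integral {0<..} (\<lambda>r. of_real p * ?h r) = Gamma ?z" .
  have m: "(\<lambda>r. of_real p * ?h r) \<in> borel_measurable borel" by measurable
  note L = lborel_of_absolutely_integrable[OF m _ A]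
  have s: "indicator {0<..} r *\<^sub>R (of_real p * ?h r) = of_real p * (indicator {0<..} r *\<^sub>R ?h r)" for r
    by simp
  have "integrable lborel (\<lambda>r. of_real p * (indicator {0<..} r *\<^sub>R ?h r))"
    using L(1) by (simp only: s) simp
  then have "integrable lborel (\<lambda>r. (1 / of_real p) * (of_real p * (indicator {0<..} r *\<^sub>R ?h r)))"
    by (rule integrable_mult_right)
  also have "(\<lambda>r. (1 / of_real p) * (of_real p * (indicator {0<..} r *\<^sub>R ?h r))) = (\<lambda>r. indicator {0<..} r *\<^sub>R ?h r)"
    using p by (simp add: fun_eq_iff)
  finally show ?I .
  have "of_real p * (\<integral>r. indicator {0<..} r *\<^sub>R ?h r \<partial>lborel) = Gamma ?z"
    using L(2) by (simp only: s I integral_mult_right_zero) simp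
  then show ?E using p by (simp add: field_simps)
qed

text \<open>The even integrand is the sum of the half-line function h evaluated at b * y and at - b
  * y; at most one of the two is nonzero. The factor b powr (- c) undoes the scaling of the
  power.\<close>

lemma integrable_abs_powr_exp:
  fixes p c b :: real
  assumes p: "p > 0" and c: "c > -1" and b: "b > 0"
  shows "integrable lborel (\<lambda>y. \<bar>y\<bar> powr c * exp (- (\<bar>b * y\<bar> powr p)))"
proof -
  define h where "h r = indicator {0<..} r * (r powr c * exp (- (r powr p)))" for r :: real
  have "integrable lborel (\<lambda>r. norm (indicator {0<..} r *\<^sub>R
        (complex_of_real r powr (of_real (c + 1) - 1) * complex_of_real (exp (- (r powr p))))))"
    using c by (intro integrable_norm integrable_exp_powr p) auto
  also have "(\<lambda>r. norm (indicator {0<..} r *\<^sub>R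
        (complex_of_real r powr (of_real (c + 1) - 1) * complex_of_real (exp (- (r powr p)))))) = h"
    by (auto simp: h_def fun_eq_iff norm_mult norm_powr_real_powr indicator_def)
  finally have h: "integrable lborel h" .
  have "integrable lborel (\<lambda>y. b powr (- c) * (h (0 + b * y) + h (0 + (- b) * y)))"
    using b by (intro integrable_mult_right Bochner_Integration.integrable_add lborel_integrable_real_affine h) auto
  also have "(\<lambda>y. b powr (- c) * (h (0 + b * y) + h (0 + (- b) * y))) = (\<lambda>y. \<bar>y\<bar> powr c * exp (- (\<bar>b * y\<bar> powr p)))"
  proof
    fix y :: real
    have pos: "b powr (- c) * h (b * y) = y powr c * exp (- ((b * y) powr p))" if "y > 0" for y
      using that b by (simp add: h_def powr_mult powr_minus)
    have neg: "h y = 0" if "y \<le> 0" for y using that by (simp add: h_def)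
    show "b powr (- c) * (h (0 + b * y) + h (0 + (- b) * y)) = \<bar>y\<bar> powr c * exp (- (\<bar>b * y\<bar> powr p))"
    proof (cases y "0::real" rule: linorder_cases)
      case less
      then have e: "0 + (- b) * y = b * (- y)" "\<bar>y\<bar> = - y" "\<bar>b * y\<bar> = b * (- y)" and "b * y \<le> 0"
        using b by (auto simp: abs_mult mult_le_0_iff)
      then have "h (0 + b * y) = 0" by (simp add: neg)
      then show ?thesis using pos[of "- y"] less unfolding e by (simp only: add_0 neg_0_less_iff_less)
    next
      case greater
      then have e: "0 + b * y = b * y" "\<bar>y\<bar> = y" "\<bar>b * y\<bar> = b * y" and "0 + (- b) * y \<le> 0"
        using b by (auto simp: abs_mult)
      then have "h (0 + (- b) * y) = 0" by (intro neg)
      then show ?thesis using pos[of y] greater unfolding e by (simp only: add_0_right)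
    qed (simp add: neg)
  qed
  finally show ?thesis .
qed

context gauge
begin

text \<open>\<open>nn_integral_polar\<close> as an equality of measures, the form that transfers to
  integrals of complex functions.\<close>

lemma lborel_polar:
  "lborel = distr (density (cone_measure g \<Otimes>\<^sub>M lborel) (\<lambda>(x, r). ennreal (r ^ (DIM('a) - 1) * indicator {0<..} r)))
     borel (\<lambda>(x, r). r *\<^sub>R x)" (is "_ = ?M")
proof (rule measure_eqI)
  interpret C: finite_measure "cone_measure g" by (rule finite_cone_measure)
  interpret P: pair_sigma_finite "cone_measure g" "lborel :: real measure" ..
  fix A :: "'a set" assume "A \<in> sets lborel"
  then have [measurable]: "A \<in> sets borel" by simp
  have "emeasure ?M A = (\<integral>\<^sup>+y. ennreal (snd y ^ (DIM('a) - 1) * indicator {0<..} (snd y)) *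
      indicator A (snd y *\<^sub>R fst y) \<partial>(cone_measure g \<Otimes>\<^sub>M lborel))"
    by (subst emeasure_distr, measurable, subst emeasure_density, measurable)
       (auto intro!: nn_integral_cong simp: indicator_def split: prod.splits)
  also have "\<dots> = (\<integral>\<^sup>+x. (\<integral>\<^sup>+r. ennreal (r ^ (DIM('a) - 1) * indicator {0<..} r) *
      indicator A (r *\<^sub>R x) \<partial>lborel) \<partial>cone_measure g)"
    by (subst lborel.nn_integral_fst[symmetric]) auto
  also have "\<dots> = (\<integral>\<^sup>+x. (\<integral>\<^sup>+r. indicator A (r *\<^sub>R x) * ennreal (r ^ (DIM('a) - 1)) *
      indicator {0<..} r \<partial>lborel) \<partial>cone_measure g)"
    by (intro nn_integral_cong) (auto simp: indicator_def)
  also have "\<dots> = (\<integral>\<^sup>+z. indicator A z \<partial>lborel)"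
    by (rule nn_integral_polar[symmetric]) measurable
  finally show "emeasure lborel A = emeasure ?M A" by simp
qed simp

end

context weighted_lp
begin

text \<open>Where the gauge is 1, homogeneity turns the integrand at \<open>r *\<^sub>R x\<close>
  into \<open>H x\<close> times a function of r alone, so the integral in polar coordinates is a
  product. The condition on Re d makes the radial factor integrable at r = 0.\<close>

lemma
  assumes [measurable]: "H \<in> borel_measurable borel"
    and hom: "\<And>r x. r > 0 \<Longrightarrow> H (r *\<^sub>R x) = complex_of_real r powr d * H x"
    and d: "Re d + real CARD('n) > 0"
    and H: "integrable (cone_measure rad) H"
  shows integrable_homogeneous_exp: "integrable lborel (\<lambda>z. H z * complex_of_real (exp (- psi z)))" (is ?I)
    and integral_homogeneous_exp: "(\<integral>z. H z * complex_of_real (exp (- psi z)) \<partial>lborel) =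
      Gamma ((of_nat CARD('n) + d) / of_real p) / of_real p * (\<integral>x. H x \<partial>cone_measure rad)" (is ?E)
proof -
  interpret C: finite_measure "cone_measure rad" by (rule finite_cone_measure)
  interpret P: pair_sigma_finite "cone_measure rad" "lborel :: real measure" ..
  define k where "k r = indicator {0<..} r *\<^sub>R
    (complex_of_real r powr (of_nat CARD('n) + d - 1) * complex_of_real (exp (- (r powr p))))" for r
  have k: "integrable lborel k"
    unfolding k_def using p d by (intro integrable_exp_powr) auto
  have Ik: "(\<integral>r. k r \<partial>lborel) = Gamma ((of_nat CARD('n) + d) / of_real p) / of_real p"
    unfolding k_def using p d by (intro integral_exp_powr) auto
  let ?F = "\<lambda>z. H z * complex_of_real (exp (- psi z))"
  let ?D = "\<lambda>(x::real ^ 'n, r::real). r ^ (CARD('n) - 1) * indicator {0<..} r"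
  let ?T = "\<lambda>(x::real ^ 'n, r). r *\<^sub>R x"
  let ?G = "\<lambda>y. ?D y *\<^sub>R ?F (?T y)"
  have G: "?G (x, r) = H x * k r" if "rad x = 1" for x r
  proof (cases "r > 0")
    case True
    have "complex_of_real r ^ (CARD('n) - 1) * complex_of_real r powr d = complex_of_real r powr (of_nat CARD('n) + d - 1)"
    proof -
      have "complex_of_real r ^ (CARD('n) - 1) = complex_of_real r powr of_nat (CARD('n) - 1)"
        by (rule powr_nat'[symmetric]) (use True in auto)
      also have "\<dots> * complex_of_real r powr d = complex_of_real r powr (of_nat (CARD('n) - 1) + d)"
        by (simp only: powr_add)
      also have "of_nat (CARD('n) - 1) + d = of_nat CARD('n) + d - 1"
        by (simp add: of_nat_diff Suc_leI)
      finally show ?thesis .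
    qed
    then show ?thesis
      using True that by (simp add: k_def hom psi_scale rad_eq_1_iff scaleR_conv_of_real[where 'a=complex] mult_ac)
  qed (simp add: k_def)
  have mG [measurable]: "?G \<in> borel_measurable (cone_measure rad \<Otimes>\<^sub>M lborel)"
    by measurable
  have int: "integrable (cone_measure rad \<Otimes>\<^sub>M lborel) ?G"
  proof (rule P.Fubini_integrable[OF mG])
    have "integrable (cone_measure rad) (\<lambda>x. norm (H x) * (\<integral>r. norm (k r) \<partial>lborel))"
      by (intro integrable_mult_left integrable_norm H)
    also have "?this \<longleftrightarrow> integrable (cone_measure rad) (\<lambda>x. LINT r|lborel. norm (?G (x, r)))"
    proof (rule integrable_cong_AE)
      show "AE x in cone_measure rad. norm (H x) * (\<integral>r. norm (k r) \<partial>lborel) = (LINT r|lborel. norm (?G (x, r)))"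
        using AE_cone_measure_gauge by eventually_elim (simp only: G norm_mult integral_mult_right_zero)
    qed measurable
    finally show "integrable (cone_measure rad) (\<lambda>x. LINT r|lborel. norm (?G (x, r)))" .
    show "AE x in cone_measure rad. integrable lborel (\<lambda>r. ?G (x, r))"
      using AE_cone_measure_gauge
    proof eventually_elim
      case (elim x)
      show ?case unfolding G[OF elim] by (intro integrable_mult_right k)
    qed
  qed
  have Fm: "?F \<in> borel_measurable borel" by measurable
  have Tm: "?T \<in> density (cone_measure rad \<Otimes>\<^sub>M lborel) (\<lambda>y. ennreal (?D y)) \<rightarrow>\<^sub>M borel" by measurable
  have leb: "lborel = distr (density (cone_measure rad \<Otimes>\<^sub>M lborel) (\<lambda>y. ennreal (?D y))) borel ?T"
    using lborel_polar by (simp add: case_prod_unfold)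
  have Dm: "?D \<in> borel_measurable (cone_measure rad \<Otimes>\<^sub>M lborel)" by measurable
  have D0: "AE y in cone_measure rad \<Otimes>\<^sub>M lborel. 0 \<le> ?D y"
    by (intro AE_I2) (auto simp: indicator_def split: prod.splits)
  have FT: "(\<lambda>y. ?F (?T y)) \<in> borel_measurable (cone_measure rad \<Otimes>\<^sub>M lborel)" by measurable
  show ?I
    by (subst leb, subst integrable_distr_eq[OF Tm Fm], subst integrable_density[OF FT Dm D0]) (rule int)
  have "(\<integral>z. ?F z \<partial>lborel) = (\<integral>y. ?G y \<partial>(cone_measure rad \<Otimes>\<^sub>M lborel))"
    by (subst leb, subst integral_distr[OF Tm Fm], subst integral_density[OF FT Dm D0]) (rule refl)
  also have "\<dots> = (\<integral>x. (\<integral>r. ?G (x, r) \<partial>lborel) \<partial>cone_measure rad)"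
    by (rule P.integral_fst'[OF int, symmetric])
  also have "\<dots> = (\<integral>x. H x * (\<integral>r. k r \<partial>lborel) \<partial>cone_measure rad)"
  proof (rule integral_cong_AE)
    show "AE x in cone_measure rad. (\<integral>r. ?G (x, r) \<partial>lborel) = H x * (\<integral>r. k r \<partial>lborel)"
      using AE_cone_measure_gauge by eventually_elim (simp only: G integral_mult_right_zero)
  qed measurable
  also have "\<dots> = Gamma ((of_nat CARD('n) + d) / of_real p) / of_real p * (\<integral>x. H x \<partial>cone_measure rad)"
    by (simp add: Ik)
  finally show ?E .
qed

lemma AE_cone_measure_nonzero: "AE x in cone_measure rad. \<forall>k. x $ k \<noteq> 0"
proof (rule AE_cone_measure)
  show "AE z in lborel. \<forall>k. (z /\<^sub>R rad z) $ k \<noteq> 0"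
    using AE_lborel_nth_nonzero
  proof eventually_elim
    case (elim z)
    then have "z \<noteq> 0" by (auto simp: vec_eq_iff)
    then show ?case using elim g_pos[of z] by simp
  qed
qed measurable

text \<open>The monomial times exp (- \<open>psi\<close>) is integrated over the whole space in two
  ways. Coordinatewise it is a finite product, because every exponent exceeds -1; in polar
  coordinates it is the wanted integral times a constant C. Finiteness passes to the first factor as
  soon as C \<noteq> 0.\<close>

lemma nn_integral_cone_prod_powr_finite:
  assumes c: "\<And>k. c k > -1"
  shows "(\<integral>\<^sup>+x. ennreal (\<Prod>k\<in>UNIV. \<bar>x $ k\<bar> powr c k) \<partial>cone_measure rad) < \<infinity>"
proof -
  define s where "s = (\<Sum>k\<in>UNIV. c k)"
  define C where "C = (\<integral>\<^sup>+r. ennreal (r powr s * exp (- (r powr p)) * r ^ (CARD('n) - 1)) * indicator {0<..} r \<partial>lborel)"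
  let ?X = "\<lambda>x. ennreal (\<Prod>k\<in>UNIV. \<bar>x $ k\<bar> powr c k)"
  have "(\<integral>\<^sup>+z. (\<Prod>k\<in>UNIV. ennreal (\<bar>z $ k\<bar> powr c k * exp (- (\<bar>a k * z $ k\<bar> powr p)))) \<partial>lborel) =
      (\<Prod>k\<in>UNIV. \<integral>\<^sup>+t. ennreal (\<bar>t\<bar> powr c k * exp (- (\<bar>a k * t\<bar> powr p))) \<partial>lborel)"
    by (rule nn_integral_lborel_prod_vec) measurable
  also have "\<dots> < \<infinity>"
  proof -
    have "(\<integral>\<^sup>+t. ennreal (\<bar>t\<bar> powr c k * exp (- (\<bar>a k * t\<bar> powr p))) \<partial>lborel) < \<infinity>" for k
      using integrable_abs_powr_exp[of p "c k" "a k"] p c[of k] a[of k]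
      by (simp add: integrable_iff_bounded abs_mult)
    then show ?thesis by (simp add: ennreal_prod_eq_top less_top[symmetric])
  qed
  finally have fin: "(\<integral>\<^sup>+z. (\<Prod>k\<in>UNIV. ennreal (\<bar>z $ k\<bar> powr c k * exp (- (\<bar>a k * z $ k\<bar> powr p)))) \<partial>lborel) < \<infinity>" .
  have eq: "(\<Prod>k\<in>UNIV. ennreal (\<bar>z $ k\<bar> powr c k * exp (- (\<bar>a k * z $ k\<bar> powr p)))) = ?X z * ennreal (exp (- psi z))" for z
    by (simp add: prod_ennreal prod.distrib exp_sum[symmetric] sum_negf psi_def ennreal_mult'')
  have "(\<integral>\<^sup>+z. ?X z * ennreal (exp (- psi z)) \<partial>lborel) =
    (\<integral>\<^sup>+x. (\<integral>\<^sup>+r. ?X (r *\<^sub>R x) * ennreal (exp (- psi (r *\<^sub>R x))) * ennreal (r ^ (CARD('n) - 1)) * indicator {0<..} r \<partial>lborel) \<partial>cone_measure rad)"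
    by (subst nn_integral_polar) auto
  also have "\<dots> = (\<integral>\<^sup>+x. ?X x * C \<partial>cone_measure rad)"
  proof (rule nn_integral_cong_AE, use AE_cone_measure_gauge AE_cone_measure_nonzero in eventually_elim)
    case (elim x)
    have "(\<integral>\<^sup>+r. ?X (r *\<^sub>R x) * ennreal (exp (- psi (r *\<^sub>R x))) * ennreal (r ^ (CARD('n) - 1)) * indicator {0<..} r \<partial>lborel) =
      (\<integral>\<^sup>+r. ?X x * (ennreal (r powr s * exp (- (r powr p)) * r ^ (CARD('n) - 1)) * indicator {0<..} r) \<partial>lborel)"
    proof (rule nn_integral_cong)
      fix r :: real
      show "?X (r *\<^sub>R x) * ennreal (exp (- psi (r *\<^sub>R x))) * ennreal (r ^ (CARD('n) - 1)) * indicator {0<..} r =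
        ?X x * (ennreal (r powr s * exp (- (r powr p)) * r ^ (CARD('n) - 1)) * indicator {0<..} r)"
      proof (cases "r > 0")
        case True
        have "(\<Prod>k\<in>UNIV. \<bar>(r *\<^sub>R x) $ k\<bar> powr c k) = (\<Prod>k\<in>UNIV. \<bar>x $ k\<bar> powr c k) * r powr s"
          using True by (simp add: abs_mult powr_mult prod.distrib powr_sum s_def)
        then show ?thesis
          using True elim by (simp add: psi_scale rad_eq_1_iff ennreal_mult'[symmetric] prod_nonneg mult_ac)
      qed simp
    qed
    then show ?case by (simp add: C_def nn_integral_cmult)
  qed
  also have "\<dots> = (\<integral>\<^sup>+x. ?X x \<partial>cone_measure rad) * C"
    by (rule nn_integral_multc) measurable
  finally have prod: "(\<integral>\<^sup>+x. ?X x \<partial>cone_measure rad) * C < \<infinity>" using fin by (simp add: eq)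
  have "C \<noteq> 0"
  proof
    assume "C = 0"
    then have "AE r in lborel. ennreal (r powr s * exp (- (r powr p)) * r ^ (CARD('n) - 1)) * indicator {0<..} r = 0"
      unfolding C_def by (subst (asm) nn_integral_0_iff_AE) auto
    then have "AE r in lborel. r \<notin> {0<..(1::real)}"
    proof eventually_elim
      case (elim r)
      have "r powr s * exp (- (r powr p)) * r ^ (CARD('n) - 1) > 0" if "r > 0"
        using that by simp
      then show ?case
      proof (intro notI)
        assume pos: "r > 0 \<Longrightarrow> r powr s * exp (- (r powr p)) * r ^ (CARD('n) - 1) > 0" and "r \<in> {0<..1}"
        then have r: "r > 0" by simp
        then have "indicator {0<..} r = (1 :: ennreal)" by simp
        with elim have "ennreal (r powr s * exp (- (r powr p)) * r ^ (CARD('n) - 1)) = 0"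
          by (simp only: mult_1_right)
        with pos[OF r] show False by (simp only: ennreal_eq_0_iff not_le[symmetric])
      qed
    qed
    then have "emeasure lborel {0<..(1::real)} = 0"
      by (subst (asm) AE_iff_measurable[where N="{0<..1}"]) auto
    then show False by simp
  qed
  with prod show ?thesis
    by (auto simp: ennreal_mult_less_top)
qed

end

context weighted_lp
begin

section \<open>The local Steiner formula\<close>

abbreviation "lp_ball \<equiv> weighted_lp_ball p a"

section \<open>Convex geometry of the ball: supporting half-spaces, boundary, nearest points\<close>

lemma normal_inner_self: "normal x \<bullet> x = psi x"
  by (simp add: inner_vec_def normal_def psi_def normal_comp_mult_self[OF p a])

text \<open>Young's inequality with exponents p and q = p / (p - 1) in each coordinate, then
  summation. Together with \<open>normal_inner_self\<close> it says that \<open>normal x\<close>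
  defines a supporting hyperplane at x.\<close>

lemma normal_inner_le_1:
  assumes x: "psi x = 1" and w: "psi w \<le> 1"
  shows "normal x \<bullet> w \<le> 1"
proof -
  define q where "q = p / (p - 1)"
  have q: "q > 1" "1 / p + 1 / q = 1" "(p - 1) * q = p" using p by (auto simp: q_def field_simps)
  have "normal x $ k * w $ k \<le> \<bar>a k * w $ k\<bar> powr p / p + \<bar>a k * x $ k\<bar> powr p / q" for k
  proof -
    have "normal x $ k * w $ k \<le> \<bar>normal x $ k\<bar> * \<bar>w $ k\<bar>" by (simp add: abs_mult[symmetric])
    also have "\<dots> = \<bar>a k * w $ k\<bar> * \<bar>a k * x $ k\<bar> powr (p - 1)"
      using a[of k] by (simp add: normal_def abs_normal_comp[OF p a] abs_mult)
    also have "\<dots> \<le> \<bar>a k * w $ k\<bar> powr p / p + (\<bar>a k * x $ k\<bar> powr (p - 1)) powr q / q"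
      by (rule Youngs_inequality) (use p q in auto)
    also have "(\<bar>a k * x $ k\<bar> powr (p - 1)) powr q = \<bar>a k * x $ k\<bar> powr p"
      by (simp add: powr_powr q)
    finally show ?thesis .
  qed
  then have "normal x \<bullet> w \<le> (\<Sum>k\<in>UNIV. \<bar>a k * w $ k\<bar> powr p / p + \<bar>a k * x $ k\<bar> powr p / q)"
    unfolding inner_vec_def by (intro sum_mono) simp
  also have "\<dots> = psi w / p + psi x / q"
    by (simp add: psi_def sum.distrib sum_divide_distrib)
  also have "\<dots> \<le> 1 / p + 1 / q"
    using w x p by (simp add: divide_right_mono)
  finally show ?thesis using q by simp
qed

text \<open>A point w outside violates the half-space belonging to its radial projection w /
  \<open>rad w\<close>. Convexity and closedness of the ball are read off from this
  representation.\<close>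

lemma ball_eq_Inter: "lp_ball = (\<Inter>x\<in>{x. psi x = 1}. {w. normal x \<bullet> w \<le> 1})"
proof (intro equalityI subsetI)
  fix w assume w: "w \<in> (\<Inter>x\<in>{x. psi x = 1}. {w. normal x \<bullet> w \<le> 1})"
  show "w \<in> lp_ball"
  proof (rule ccontr)
    assume "w \<notin> lp_ball"
    then have "rad w > 1" by (simp add: weighted_lp_ball_eq rad_le_1_iff[symmetric])
    define x where "x = w /\<^sub>R rad w"
    have "w \<noteq> 0" using \<open>rad w > 1\<close> g_zero by auto
    then have x: "psi x = 1" using g_normalize[of w] by (simp add: x_def rad_eq_1_iff)
    have "w = rad w *\<^sub>R x" using \<open>rad w > 1\<close> by (simp add: x_def)
    then have "normal x \<bullet> w = rad w * (normal x \<bullet> x)" by (metis inner_scaleR_right)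
    also have "\<dots> > 1" using \<open>rad w > 1\<close> x by (simp add: normal_inner_self)
    finally show False using w x by force
  qed
qed (auto simp: weighted_lp_ball_eq normal_inner_le_1)

lemma convex_ball: "convex lp_ball"
  unfolding ball_eq_Inter by (intro convex_INT convex_halfspace_le)

lemma closed_ball: "closed lp_ball"
  unfolding ball_eq_Inter by (intro closed_INT ballI closed_halfspace_le)

lemma ball_nonempty: "lp_ball \<noteq> {}"
  using psi_0 by (auto simp: weighted_lp_ball_eq intro!: exI[of _ 0])

lemma normal_neq_0: "psi x = 1 \<Longrightarrow> normal x \<noteq> 0"
  using normal_inner_self[of x] by auto

lemma normal_ray_inner:
  "psi x = 1 \<Longrightarrow> normal x \<bullet> (x + s *\<^sub>R normal x) = 1 + s * (norm (normal x))\<^sup>2"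
  by (simp add: inner_add_right normal_inner_self power2_norm_eq_inner)

lemma normal_ray_notin_ball:
  assumes "psi x = 1" "s > 0"
  shows "x + s *\<^sub>R normal x \<notin> lp_ball"
proof
  assume "x + s *\<^sub>R normal x \<in> lp_ball"
  then have "normal x \<bullet> (x + s *\<^sub>R normal x) \<le> 1"
    using assms by (intro normal_inner_le_1) (auto simp: weighted_lp_ball_eq)
  moreover have "s * (norm (normal x))\<^sup>2 > 0" using assms normal_neq_0[of x] by simp
  ultimately show False using normal_ray_inner[OF assms(1), of s] by simp
qed

text \<open>Points with \<open>psi\<close> < 1 are interior by continuity, while a point with
  \<open>psi\<close> = 1 leaves the ball under an arbitrarily small step along its normal.\<close>

lemma frontier_ball: "frontier lp_ball = {x. psi x = 1}"
proof (intro equalityI subsetI)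
  fix x assume "x \<in> frontier lp_ball"
  then have x: "x \<in> lp_ball" "x \<notin> interior lp_ball"
    by (auto simp: frontier_def closure_closed[OF closed_ball])
  have "{x. psi x < 1} \<subseteq> interior lp_ball"
    by (rule interior_maximal) (auto simp: weighted_lp_ball_eq intro!: open_Collect_less continuous_psi)
  then show "x \<in> {x. psi x = 1}" using x by (force simp: weighted_lp_ball_eq)
next
  fix x assume "x \<in> {x. psi x = 1}"
  then have x: "psi x = 1" by simp
  have "x \<notin> interior lp_ball"
  proof
    assume "x \<in> interior lp_ball"
    then obtain e where e: "e > 0" "ball x e \<subseteq> lp_ball" unfolding mem_interior by auto
    define s where "s = e / (2 * norm (normal x))"
    have s: "s > 0" using e normal_neq_0[OF x] by (simp add: s_def)
    have "dist x (x + s *\<^sub>R normal x) = e / 2"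
      using e normal_neq_0[OF x] by (simp add: dist_norm s_def)
    then have "x + s *\<^sub>R normal x \<in> ball x e" using e by simp
    then show False using e normal_ray_notin_ball[OF x s] by blast
  qed
  then show "x \<in> frontier lp_ball"
    using x closure_subset[of lp_ball] by (auto simp: frontier_def weighted_lp_ball_eq)
qed

lemma frontier_ball_borel [measurable]: "frontier lp_ball \<in> sets borel"
  by (intro borel_closed frontier_closed)

text \<open>On expanding the squared distance from x + s N x to a point w of the ball, the cross
  term is nonnegative because w lies in the supporting half-space at x.\<close>

lemma closest_point_normal_ray:
  assumes x: "psi x = 1" and s: "s \<ge> 0"
  shows "closest_point lp_ball (x + s *\<^sub>R normal x) = x"
proof (rule closest_point_unique[OF convex_ball closed_ball, symmetric])
  show "x \<in> lp_ball" using x by (simp add: weighted_lp_ball_eq)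
  show "\<forall>w\<in>lp_ball. dist (x + s *\<^sub>R normal x) x \<le> dist (x + s *\<^sub>R normal x) w"
  proof
    fix w assume "w \<in> lp_ball"
    then have "normal x \<bullet> w \<le> 1" using x by (intro normal_inner_le_1) (auto simp: weighted_lp_ball_eq)
    then have "s * (normal x \<bullet> (x - w)) \<ge> 0"
      using s x by (simp add: inner_diff_right normal_inner_self)
    moreover have "(norm (x + s *\<^sub>R normal x - w))\<^sup>2 = (norm (s *\<^sub>R normal x))\<^sup>2 + 2 * (s * (normal x \<bullet> (x - w))) + (norm (x - w))\<^sup>2"
      unfolding power2_norm_eq_inner by (simp add: algebra_simps inner_commute)
    ultimately have "(norm (s *\<^sub>R normal x))\<^sup>2 \<le> (norm (x + s *\<^sub>R normal x - w))\<^sup>2" by simp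
    then show "dist (x + s *\<^sub>R normal x) x \<le> dist (x + s *\<^sub>R normal x) w"
      by (simp add: dist_norm power2_le_iff_abs_le)
  qed
qed

text \<open>Trading the Minkowski sum for the distance to the nearest point describes the set
  through the continuous map \<open>closest_point\<close>, which makes Borel measurability
  visible.\<close>

lemma local_parallel_set_eq:
  "local_parallel_set lp_ball \<rho> B = {y. y \<notin> lp_ball \<and> dist y (closest_point lp_ball y) \<le> \<rho> \<and> closest_point lp_ball y \<in> B}"
proof -
  have "(\<exists>x z. y = x + z \<and> x \<in> lp_ball \<and> z \<in> cball 0 \<rho>) \<longleftrightarrow> dist y (closest_point lp_ball y) \<le> \<rho>" for y
  proof
    assume "\<exists>x z. y = x + z \<and> x \<in> lp_ball \<and> z \<in> cball 0 \<rho>"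
    then obtain x z where "y = x + z" "x \<in> lp_ball" "norm z \<le> \<rho>" by auto
    then show "dist y (closest_point lp_ball y) \<le> \<rho>"
      using closest_point_le[OF closed_ball, of x y] by (simp add: dist_norm)
  next
    assume "dist y (closest_point lp_ball y) \<le> \<rho>"
    then show "\<exists>x z. y = x + z \<and> x \<in> lp_ball \<and> z \<in> cball 0 \<rho>"
      using closest_point_in_set[OF closed_ball ball_nonempty, of y]
      by (rule_tac exI[of _ "closest_point lp_ball y"], rule_tac exI[of _ "y - closest_point lp_ball y"])
        (simp add: dist_norm norm_minus_commute)
  qed
  then show ?thesis unfolding local_parallel_set_def by auto
qed

lemma local_parallel_set_borel [measurable]:
  assumes [measurable]: "B \<in> sets borel"
  shows "local_parallel_set lp_ball \<rho> B \<in> sets borel"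
proof -
  have [measurable]: "closest_point lp_ball \<in> borel_measurable borel"
    by (intro borel_measurable_continuous_onI continuous_on_closest_point convex_ball closed_ball ball_nonempty)
  have [measurable]: "lp_ball \<in> sets borel" by (intro borel_closed closed_ball)
  show ?thesis unfolding local_parallel_set_eq by measurable
qed

lemma normal_ray_in_local_parallel_set:
  assumes "psi x = 1" "s > 0"
  shows "x + s *\<^sub>R normal x \<in> local_parallel_set lp_ball \<rho> B \<longleftrightarrow> x \<in> B \<and> s \<le> \<rho> / norm (normal x)"
  using assms normal_neq_0[OF assms(1)] normal_ray_notin_ball[OF assms] closest_point_normal_ray[OF assms(1), of s]
  by (auto simp: local_parallel_set_eq dist_norm field_simps)

section \<open>Densities of the curvature measures and their finiteness\<close>

definition curv_term :: "'n \<Rightarrow> 'n set \<Rightarrow> real ^ 'n \<Rightarrow> real" where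
  "curv_term i I x = (normal x $ i)\<^sup>2 * (\<Prod>j\<in>I. normal_deriv x j)"

text \<open>For 1 \<le> m \<le> n this is the coefficient of s^(m-1) in the polynomial
  \<open>jac x s\<close>; see \<open>jac_eq_curv_sum\<close>.\<close>

definition curv_sum :: "nat \<Rightarrow> real ^ 'n \<Rightarrow> real" where
  "curv_sum m x = (\<Sum>i\<in>UNIV. \<Sum>I\<in>{I. I \<subseteq> UNIV - {i} \<and> card I = m - 1}. curv_term i I x)"

text \<open>Integrating s^(m-1) over 0 \<le> s \<le> \<rho> / \<open>norm (normal x)\<close> gives
  \<rho>^m / (m * \<open>norm (normal x) ^ m\<close>); the ball volume is the one occurring in the
  Steiner formula.\<close>

definition curv_density :: "nat \<Rightarrow> real ^ 'n \<Rightarrow> real" where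
  "curv_density m x = curv_sum m x / (real m * unit_ball_vol (real m) * norm (normal x) ^ m)"

text \<open>Restricting to the boundary loses no mass, since almost every point for the cone measure
  has \<open>rad\<close> = 1.\<close>

definition curv_meas :: "nat \<Rightarrow> (real ^ 'n) measure" where
  "curv_meas j = restrict_space (density (cone_measure rad) (\<lambda>x. ennreal (curv_density (CARD('n) - j) x))) (frontier lp_ball)"

lemma measurable_curv_term [measurable]: "curv_term i I \<in> borel_measurable borel"
  unfolding curv_term_def[abs_def] by measurable

lemma measurable_curv_sum [measurable]: "curv_sum m \<in> borel_measurable borel"
  unfolding curv_sum_def[abs_def] by measurable

lemma measurable_curv_density [measurable]: "curv_density m \<in> borel_measurable borel"
  unfolding curv_density_def[abs_def] by measurable

lemma curv_term_nonneg: "curv_term i I x \<ge> 0"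
  by (simp add: curv_term_def prod_nonneg normal_deriv_nonneg)

lemma curv_sum_nonneg: "curv_sum m x \<ge> 0"
  by (simp add: curv_sum_def sum_nonneg curv_term_nonneg)

lemma curv_density_nonneg: "curv_density m x \<ge> 0"
  by (simp add: curv_density_def curv_sum_nonneg)

text \<open>Each product is expanded over the subsets I of the complement of i and the subsets are
  grouped by cardinality, which is below n because i is missing.\<close>

lemma jac_eq_curv_sum: "jac x s = (\<Sum>k<CARD('n). s ^ k * curv_sum (Suc k) x)"
proof -
  have "(\<Prod>j\<in>UNIV - {i}. 1 + s * normal_deriv x j) = (\<Sum>k<CARD('n). \<Sum>I\<in>{I. I \<subseteq> UNIV - {i} \<and> card I = k}. s ^ k * (\<Prod>j\<in>I. normal_deriv x j))"
    for i :: 'n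
  proof -
    have "(\<Prod>j\<in>UNIV - {i}. 1 + s * normal_deriv x j) = (\<Prod>j\<in>UNIV - {i}. s * normal_deriv x j + 1)"
      by (simp add: add.commute)
    also have "\<dots> = (\<Sum>I\<in>Pow (UNIV - {i}). s ^ card I * (\<Prod>j\<in>I. normal_deriv x j))"
      by (subst prod_add) (auto simp: prod.distrib)
    also have "\<dots> = (\<Sum>k\<in>{..<CARD('n)}. \<Sum>I\<in>{I \<in> Pow (UNIV - {i}). card I = k}. s ^ card I * (\<Prod>j\<in>I. normal_deriv x j))"
    proof (rule sum.group[symmetric])
      have "card I < CARD('n)" if "I \<subseteq> UNIV - {i}" for I
        using psubset_card_mono[of UNIV I] that by auto
      then show "card ` Pow (UNIV - {i}) \<subseteq> {..<CARD('n)}" by auto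
    qed auto
    finally show ?thesis by (auto intro!: sum.cong)
  qed
  then have "jac x s = (\<Sum>i\<in>UNIV. \<Sum>k<CARD('n). \<Sum>I\<in>{I. I \<subseteq> UNIV - {i} \<and> card I = k}. s ^ k * curv_term i I x)"
    by (simp add: jac_def curv_term_def sum_distrib_left mult_ac)
  also have "\<dots> = (\<Sum>k<CARD('n). s ^ k * curv_sum (Suc k) x)"
    by (subst sum.swap) (simp add: curv_sum_def sum_distrib_left)
  finally show ?thesis .
qed

text \<open>By Cauchy-Schwarz, 1 = \<open>normal x \<bullet> x\<close> \<le>
  \<open>norm (normal x) * norm x\<close>, and the ball is bounded. Negative powers of the length of
  the normal are thus harmless on the boundary.\<close>

lemma normal_bound: "\<exists>R>0. \<forall>x. psi x = 1 \<longrightarrow> 1 / norm (normal x) \<le> R"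
proof -
  obtain R where R: "R > 0" "\<And>x. psi x \<le> 1 \<Longrightarrow> norm x \<le> R"
    using bounded_ball unfolding bounded_pos by auto
  have b: "1 / norm (normal x) \<le> R" if x: "psi x = 1" for x
  proof -
    have "1 = normal x \<bullet> x" by (simp add: normal_inner_self x)
    also have "\<dots> \<le> norm (normal x) * norm x" by (rule norm_cauchy_schwarz)
    also have "\<dots> \<le> norm (normal x) * R" using R(2)[of x] x by (intro mult_left_mono) auto
    finally show ?thesis using normal_neq_0[OF x] by (simp add: field_simps)
  qed
  with R(1) show ?thesis by blast
qed

definition term_exp :: "'n \<Rightarrow> 'n set \<Rightarrow> 'n \<Rightarrow> real" where
  "term_exp i I k = (if k = i then 2 * p - 2 else if k \<in> I then p - 2 else 0)"

definition term_coef :: "'n \<Rightarrow> 'n set \<Rightarrow> 'n \<Rightarrow> real" where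
  "term_coef i I k = (if k = i then (a k)\<^sup>2 else if k \<in> I then (p - 1) * (a k)\<^sup>2 else 1)"

text \<open>The case distinction is needed because \<open>0 powr 0 = 0\<close>.\<close>

definition term_pow :: "'n \<Rightarrow> 'n set \<Rightarrow> 'n \<Rightarrow> real \<Rightarrow> real" where
  "term_pow i I k y = (if k \<in> insert i I then \<bar>y\<bar> powr term_exp i I k else 1)"

lemma curv_term_eq_prod:
  assumes "i \<notin> I"
  shows "curv_term i I x = (\<Prod>k\<in>UNIV. term_coef i I k * term_pow i I k (a k * x $ k))"
proof -
  have "(\<Prod>k\<in>UNIV. term_coef i I k * term_pow i I k (a k * x $ k)) =
      (\<Prod>k\<in>insert i I. term_coef i I k * term_pow i I k (a k * x $ k))"
    by (rule prod.mono_neutral_right) (auto simp: term_coef_def term_pow_def)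
  also have "\<dots> = (a i)\<^sup>2 * \<bar>a i * x $ i\<bar> powr (2 * p - 2) * (\<Prod>k\<in>I. term_coef i I k * term_pow i I k (a k * x $ k))"
    using assms by (subst prod.insert) (auto simp: term_coef_def term_pow_def term_exp_def)
  also have "(\<Prod>k\<in>I. term_coef i I k * term_pow i I k (a k * x $ k)) = (\<Prod>k\<in>I. normal_deriv x k)"
    using assms by (intro prod.cong) (auto simp: term_coef_def term_pow_def term_exp_def normal_deriv_def normal_comp_deriv_def)
  finally show ?thesis by (simp add: curv_term_def normal_def normal_comp_power2[OF p a])
qed

text \<open>With 1 / \<open>norm (normal x)\<close> bounded, the integrand is at most a constant
  times a monomial with exponents \<open>c k + term_exp i I k\<close> at almost every boundary
  point.\<close>

lemma nn_integral_curv_term_finite: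
  assumes i: "i \<notin> I" and c: "\<And>k. c k + term_exp i I k > -1"
  shows "(\<integral>\<^sup>+x. ennreal ((\<Prod>k\<in>UNIV. \<bar>x $ k\<bar> powr c k) * curv_term i I x / norm (normal x) ^ m) \<partial>cone_measure rad) < \<infinity>"
proof -
  obtain R where R: "R > 0" "\<And>x. psi x = 1 \<Longrightarrow> 1 / norm (normal x) \<le> R"
    using normal_bound by blast
  define A where "A = (\<Prod>k\<in>UNIV. term_coef i I k * a k powr term_exp i I k)"
  have A: "A \<ge> 0" unfolding A_def using p by (intro prod_nonneg) (auto simp: term_coef_def)
  let ?P = "\<lambda>x::real ^ 'n. \<Prod>k\<in>UNIV. \<bar>x $ k\<bar> powr (c k + term_exp i I k)"
  have "(\<integral>\<^sup>+x. ennreal ((\<Prod>k\<in>UNIV. \<bar>x $ k\<bar> powr c k) * curv_term i I x / norm (normal x) ^ m) \<partial>cone_measure rad) \<le>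
    (\<integral>\<^sup>+x. ennreal (A * R ^ m) * ennreal (?P x) \<partial>cone_measure rad)"
  proof (rule nn_integral_mono_AE, use AE_cone_measure_gauge AE_cone_measure_nonzero in eventually_elim)
    case (elim x)
    then have x: "psi x = 1" by (simp add: rad_eq_1_iff)
    have "(\<Prod>k\<in>UNIV. \<bar>x $ k\<bar> powr c k) * curv_term i I x = A * ?P x"
      unfolding curv_term_eq_prod[OF i] A_def prod.distrib[symmetric]
    proof (rule prod.cong)
      fix k :: 'n
      have "term_pow i I k (a k * x $ k) = a k powr term_exp i I k * \<bar>x $ k\<bar> powr term_exp i I k"
        using elim a[of k] by (auto simp: term_pow_def abs_mult powr_mult term_exp_def)
      then show "\<bar>x $ k\<bar> powr c k * (term_coef i I k * term_pow i I k (a k * x $ k)) =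
        term_coef i I k * a k powr term_exp i I k * \<bar>x $ k\<bar> powr (c k + term_exp i I k)"
        by (simp add: powr_add)
    qed simp
    then have "(\<Prod>k\<in>UNIV. \<bar>x $ k\<bar> powr c k) * curv_term i I x / norm (normal x) ^ m = A * ?P x * (1 / norm (normal x)) ^ m"
      by (simp add: power_one_over)
    also have "\<dots> \<le> A * ?P x * R ^ m"
      using A R(2)[OF x] by (intro mult_left_mono power_mono mult_nonneg_nonneg prod_nonneg) auto
    finally show ?case
      using A R(1) by (subst ennreal_mult[symmetric]) (auto simp: mult_ac prod_nonneg intro!: ennreal_leI)
  qed
  also have "\<dots> = ennreal (A * R ^ m) * (\<integral>\<^sup>+x. ennreal (?P x) \<partial>cone_measure rad)"
    by (rule nn_integral_cmult) measurable
  also have "\<dots> < \<infinity>"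
    using nn_integral_cone_prod_powr_finite[of "\<lambda>k. c k + term_exp i I k"] c by (simp add: ennreal_mult_less_top)
  finally show ?thesis .
qed

lemma sets_curv_meas [simp]: "sets (curv_meas j) = sets (restrict_space borel (frontier lp_ball))"
  unfolding curv_meas_def by (rule sets_restrict_space_cong) simp

text \<open>The case of weights with exponent 0: the remaining exponents 2 * p - 2, p - 2 and 0 all
  exceed -1 because p > 1.\<close>

lemma nn_integral_curv_density_finite: "(\<integral>\<^sup>+x. ennreal (curv_density m x) \<partial>cone_measure rad) < \<infinity>"
proof -
  let ?J = "\<lambda>i::'n. {I. I \<subseteq> UNIV - {i} \<and> card I = m - 1}"
  let ?c = "1 / (real m * unit_ball_vol (real m))"
  \<comment> \<open>Only almost everywhere, since \<open>0 powr 0 = 0\<close>.\<close>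
  have ps: "AE x in cone_measure rad. (\<Prod>k\<in>UNIV. \<bar>x $ k\<bar> powr (0::real)) = 1"
    using AE_cone_measure_nonzero by eventually_elim simp
  have "(\<integral>\<^sup>+x. ennreal (curv_density m x) \<partial>cone_measure rad) =
    (\<integral>\<^sup>+x. (\<Sum>i\<in>UNIV. \<Sum>I\<in>?J i. ennreal ?c * ennreal ((\<Prod>k\<in>UNIV. \<bar>x $ k\<bar> powr 0) * curv_term i I x / norm (normal x) ^ m)) \<partial>cone_measure rad)"
  proof (rule nn_integral_cong_AE, use ps in eventually_elim)
    case (elim x)
    have "curv_density m x = (\<Sum>i\<in>UNIV. \<Sum>I\<in>?J i. ?c * (curv_term i I x / norm (normal x) ^ m))"
      by (simp add: curv_density_def curv_sum_def sum_distrib_left[symmetric] sum_divide_distrib[symmetric])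
    then show ?case
      unfolding elim by (simp add: ennreal_mult'[symmetric] sum_ennreal curv_term_nonneg sum_nonneg)
  qed
  also have "\<dots> = (\<Sum>i\<in>UNIV. \<Sum>I\<in>?J i. ennreal ?c * (\<integral>\<^sup>+x. ennreal ((\<Prod>k\<in>UNIV. \<bar>x $ k\<bar> powr 0) * curv_term i I x / norm (normal x) ^ m) \<partial>cone_measure rad))"
    by (simp add: nn_integral_sum nn_integral_cmult)
  also have "\<dots> < \<infinity>"
  proof -
    have "(\<integral>\<^sup>+x. ennreal ((\<Prod>k\<in>UNIV. \<bar>x $ k\<bar> powr 0) * curv_term i I x / norm (normal x) ^ m) \<partial>cone_measure rad) < \<infinity>"
      if "I \<in> ?J i" for i I
      using that p by (intro nn_integral_curv_term_finite) (auto simp: term_exp_def)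
    then show ?thesis by (auto simp: ennreal_mult_less_top)
  qed
  finally show ?thesis .
qed

lemma emeasure_curv_meas:
  assumes "B \<in> sets (restrict_space borel (frontier lp_ball))"
  shows "emeasure (curv_meas j) B = (\<integral>\<^sup>+x. ennreal (curv_density (CARD('n) - j) x) * indicator B x \<partial>cone_measure rad)"
proof -
  have B: "B \<subseteq> frontier lp_ball" and [measurable]: "B \<in> sets borel"
    using assms by (auto simp: sets_restrict_space_iff)
  have "emeasure (curv_meas j) B = emeasure (density (cone_measure rad) (\<lambda>x. ennreal (curv_density (CARD('n) - j) x))) B"
    unfolding curv_meas_def by (rule emeasure_restrict_space) (use B in simp_all)
  also have "\<dots> = (\<integral>\<^sup>+x. ennreal (curv_density (CARD('n) - j) x) * indicator B x \<partial>cone_measure rad)"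
    by (rule emeasure_density) simp_all
  finally show ?thesis .
qed

lemma finite_curv_meas: "finite_measure (curv_meas j)"
proof
  have sp: "space (curv_meas j) \<in> sets (restrict_space borel (frontier lp_ball))"
    using sets.top[of "curv_meas j"] by simp
  have "emeasure (curv_meas j) (space (curv_meas j)) \<le> (\<integral>\<^sup>+x. ennreal (curv_density (CARD('n) - j) x) \<partial>cone_measure rad)"
    unfolding emeasure_curv_meas[OF sp] by (intro nn_integral_mono) (auto simp: indicator_def)
  also have "\<dots> < \<infinity>" by (rule nn_integral_curv_density_finite)
  finally show "emeasure (curv_meas j) (space (curv_meas j)) \<noteq> \<infinity>" by simp
qed

text \<open>The ray from x meets the local parallel set exactly for 0 < s \<le> \<rho> /
  \<open>norm (normal x)\<close> if x \<in> B, and not at all otherwise. Integrating the polynomial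
  \<open>jac x s\<close> over this range gives a polynomial in \<rho> without constant term.\<close>

lemma nn_integral_normal_ray:
  assumes x: "psi x = 1" and \<rho>: "\<rho> \<ge> 0"
  shows "(\<integral>\<^sup>+s. indicator (local_parallel_set lp_ball \<rho> B) (x + s *\<^sub>R normal x) * ennreal (jac x s) * indicator {0<..} s \<partial>lborel) =
    (\<Sum>k<CARD('n). ennreal (unit_ball_vol (real (Suc k)) * \<rho> ^ Suc k) * (ennreal (curv_density (Suc k) x) * indicator B x))"
proof -
  let ?R = "\<rho> / norm (normal x)"
  have "(\<integral>\<^sup>+s. indicator (local_parallel_set lp_ball \<rho> B) (x + s *\<^sub>R normal x) * ennreal (jac x s) * indicator {0<..} s \<partial>lborel) =
    (\<integral>\<^sup>+s. (ennreal (jac x s) * indicator {0..?R} s) * indicator B x \<partial>lborel)"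
  proof (rule nn_integral_cong_AE, use AE_lborel_singleton[of "0::real"] in eventually_elim)
    case (elim s)
    then show ?case
      using normal_ray_in_local_parallel_set[OF x, of s \<rho> B] by (cases "s > 0") (auto simp: indicator_def)
  qed
  also have "\<dots> = (\<integral>\<^sup>+s. ennreal (jac x s) * indicator {0..?R} s \<partial>lborel) * indicator B x"
    by (rule nn_integral_multc) measurable
  also have "(\<integral>\<^sup>+s. ennreal (jac x s) * indicator {0..?R} s \<partial>lborel) =
    ennreal ((\<Sum>k<CARD('n). ?R ^ Suc k / Suc k * curv_sum (Suc k) x) - (\<Sum>k<CARD('n). 0 ^ Suc k / Suc k * curv_sum (Suc k) x))"
  proof (rule nn_integral_FTC_Icc[where F="\<lambda>s. \<Sum>k<CARD('n). s ^ Suc k / Suc k * curv_sum (Suc k) x"])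
    show "((\<lambda>s. \<Sum>k<CARD('n). s ^ Suc k / Suc k * curv_sum (Suc k) x) has_real_derivative jac x s) (at s)" for s
      unfolding jac_eq_curv_sum
      by (auto intro!: derivative_eq_intros sum.cong simp del: power_Suc)
  qed (use \<rho> in \<open>auto simp: jac_nonneg\<close>)
  also have "(\<Sum>k<CARD('n). ?R ^ Suc k / Suc k * curv_sum (Suc k) x) - (\<Sum>k<CARD('n). 0 ^ Suc k / Suc k * curv_sum (Suc k) x) =
    (\<Sum>k<CARD('n). unit_ball_vol (real (Suc k)) * \<rho> ^ Suc k * curv_density (Suc k) x)"
  proof -
    have u: "unit_ball_vol (real (Suc k)) \<noteq> 0" for k
      by (rule less_imp_neq[symmetric]) (rule unit_ball_vol_pos, simp)
    show ?thesis
      using u by (simp add: curv_density_def power_divide del: of_nat_Suc) (intro sum.cong, auto simp: field_simps)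
  qed
  also have "ennreal \<dots> = (\<Sum>k<CARD('n). ennreal (unit_ball_vol (real (Suc k)) * \<rho> ^ Suc k) * ennreal (curv_density (Suc k) x))"
    using \<rho> by (subst sum_ennreal[symmetric])
      (auto simp: ennreal_mult'[symmetric] curv_density_nonneg intro!: sum.cong mult_nonneg_nonneg simp del: power_Suc of_nat_Suc)
  finally show ?thesis by (simp add: sum_distrib_right mult.assoc del: power_Suc of_nat_Suc)
qed

text \<open>Normal coordinates applied to the indicator of the local parallel set. This is the
  existence statement which, with uniqueness, evaluates the definite description in
  \<open>curvature_measure\<close>.\<close>

lemma steiner_curv_meas: "steiner_measures lp_ball curv_meas"
  unfolding steiner_measures_def
proof (intro conjI allI impI ballI)
  fix \<rho> :: real and B assume \<rho>: "\<rho> \<ge> 0" and B: "B \<in> sets (restrict_space borel (frontier lp_ball))"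
  have [measurable]: "B \<in> sets borel"
    using B by (auto simp: sets_restrict_space_iff)
  let ?A = "local_parallel_set lp_ball \<rho> B" and ?n = "CARD('n)"
  interpret F: finite_measure "curv_meas j" for j by (rule finite_curv_meas)
  have "emeasure lborel ?A = (\<integral>\<^sup>+y. indicator ?A y * indicator {y. rad y > 1} y \<partial>lborel)"
  proof -
    have "y \<in> lp_ball \<longleftrightarrow> \<not> rad y > 1" for y by (simp add: weighted_lp_ball_eq rad_le_1_iff[symmetric] not_less)
    then have "indicator ?A y = (indicator ?A y * indicator {y. rad y > 1} y :: ennreal)" for y
      by (auto simp: indicator_def local_parallel_set_eq)
    then have "(\<integral>\<^sup>+y. indicator ?A y \<partial>lborel) = (\<integral>\<^sup>+y. indicator ?A y * indicator {y. rad y > 1} y \<partial>lborel)"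
      by (intro nn_integral_cong)
    then show ?thesis by simp
  qed
  also have "\<dots> = (\<integral>\<^sup>+x. (\<integral>\<^sup>+s. indicator ?A (x + s *\<^sub>R normal x) * ennreal (jac x s) * indicator {0<..} s \<partial>lborel) \<partial>cone_measure rad)"
    by (rule nn_integral_normal_coordinates[symmetric]) measurable
  also have "\<dots> = (\<integral>\<^sup>+x. (\<Sum>k<?n. ennreal (unit_ball_vol (real (Suc k)) * \<rho> ^ Suc k) * (ennreal (curv_density (Suc k) x) * indicator B x)) \<partial>cone_measure rad)"
    by (rule nn_integral_cong_AE, use AE_cone_measure_gauge in eventually_elim)
       (simp only: nn_integral_normal_ray \<rho> rad_eq_1_iff)
  also have "\<dots> = (\<Sum>k<?n. ennreal (unit_ball_vol (real (Suc k)) * \<rho> ^ Suc k) * (\<integral>\<^sup>+x. ennreal (curv_density (Suc k) x) * indicator B x \<partial>cone_measure rad))"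
    by (subst nn_integral_sum, measurable, rule sum.cong, simp, rule nn_integral_cmult, measurable)
  \<comment> \<open>Order reversal k = n - 1 - j, so that Suc k = n - j.\<close>
  also have "\<dots> = (\<Sum>j<?n. ennreal (unit_ball_vol (real (?n - j)) * \<rho> ^ (?n - j)) * emeasure (curv_meas j) B)"
    by (subst sum.nat_diff_reindex[symmetric])
       (intro sum.cong, auto simp: emeasure_curv_meas[OF B] Suc_diff_Suc simp del: power_Suc of_nat_Suc)
  also have "\<dots> = ennreal (\<Sum>j<?n. unit_ball_vol (real (?n - j)) * \<rho> ^ (?n - j) * measure (curv_meas j) B)"
    using \<rho> by (subst sum_ennreal[symmetric])
      (auto simp: F.emeasure_eq_measure ennreal_mult'[symmetric] intro!: sum.cong)
  finally have "measure lborel ?A = (\<Sum>j<?n. unit_ball_vol (real (?n - j)) * \<rho> ^ (?n - j) * measure (curv_meas j) B)"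
    using \<rho> by (intro measure_eq_emeasure_eq_ennreal sum_nonneg mult_nonneg_nonneg) auto
  then show "measure lborel ?A = (\<Sum>j<DIM(real ^ 'n). unit_ball_vol (real (DIM(real ^ 'n) - j)) * \<rho> ^ (DIM(real ^ 'n) - j) * measure (curv_meas j) B)"
    by simp
qed (simp_all add: finite_curv_meas)

lemma curvature_measure_ball:
  "j < CARD('n) \<Longrightarrow> curvature_measure lp_ball j = curv_meas j"
  using curvature_measure_eq[OF steiner_curv_meas, of j] by simp

lemma
  fixes f :: "real ^ 'n \<Rightarrow> complex"
  assumes [measurable]: "f \<in> borel_measurable borel"
  shows integrable_curv_meas_iff:
      "integrable (curv_meas j) f \<longleftrightarrow> integrable (cone_measure rad) (\<lambda>x. curv_density (CARD('n) - j) x *\<^sub>R f x)" (is ?I)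
    and integral_curv_meas:
      "integral\<^sup>L (curv_meas j) f = (\<integral>x. curv_density (CARD('n) - j) x *\<^sub>R f x \<partial>cone_measure rad)" (is ?E)
proof -
  let ?d = "curv_density (CARD('n) - j)" and ?f = "\<lambda>x. indicator (frontier lp_ball) x *\<^sub>R f x"
  have S: "frontier lp_ball \<inter> space (density (cone_measure rad) (\<lambda>x. ennreal (?d x))) \<in> sets (density (cone_measure rad) (\<lambda>x. ennreal (?d x)))"
    by simp
  have nn: "AE x in cone_measure rad. 0 \<le> ?d x" by (simp add: curv_density_nonneg)
  have m: "?f \<in> borel_measurable (cone_measure rad)" "?d \<in> borel_measurable (cone_measure rad)" by measurable
  have ae: "AE x in cone_measure rad. ?d x *\<^sub>R ?f x = ?d x *\<^sub>R f x"
    using AE_cone_measure_gauge by eventually_elim (simp add: frontier_ball rad_eq_1_iff)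
  show ?I
    unfolding curv_meas_def integrable_restrict_space[OF S] integrable_density[OF m nn]
    by (rule integrable_cong_AE[OF _ _ ae]) measurable
  show ?E
    unfolding curv_meas_def integral_restrict_space[OF S] integral_density[OF m nn]
    by (rule integral_cong_AE[OF _ _ ae]) measurable
qed

end

section \<open>The moment formula\<close>

text \<open>Euler's integral rescaled by c. It is used with s = m / 2 and c the squared length of
  the normal, so that c powr s becomes its m-th power.\<close>

lemma
  assumes s: "s > 0" and c: "c > (0::real)"
  shows integrable_Gamma_scaled: "integrable lborel (\<lambda>\<theta>. indicator {0<..} \<theta> * (\<theta> powr (s - 1) * exp (- \<theta> * c)))" (is ?I)
    and integral_Gamma_scaled: "(\<integral>\<theta>. indicator {0<..} \<theta> * (\<theta> powr (s - 1) * exp (- \<theta> * c)) \<partial>lborel) =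
      Gamma s / c powr s" (is ?E)
proof -
  let ?h = "\<lambda>r::real. indicator {0<..} r * (r powr (s - 1) * exp (- r)) :: real"
  let ?h' = "\<lambda>\<theta>::real. indicator {0<..} \<theta> * (\<theta> powr (s - 1) * exp (- \<theta> * c)) :: real"
  have eq: "indicator {0<..} r *\<^sub>R (complex_of_real r powr (complex_of_real s - 1) * complex_of_real (exp (- (r powr 1)))) =
      complex_of_real (?h r)" for r
    by (cases "r > 0") (simp_all add: powr_of_real[of r "s - 1", simplified])
  have s': "0 < (1::real)" "0 < Re (complex_of_real s)" using s by simp_all
  have h: "integrable lborel ?h"
    using integrable_exp_powr[OF s', unfolded eq] by (simp only: complex_of_real_integrable_eq)
  have "complex_of_real (\<integral>r. ?h r \<partial>lborel) = complex_of_real (Gamma s)"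
    using integral_exp_powr[OF s', unfolded eq integral_complex_of_real]
    by (simp only: Gamma_complex_of_real of_real_1 div_by_1)
  then have Ih: "(\<integral>r. ?h r \<partial>lborel) = Gamma s" by (simp only: of_real_eq_iff)
  have sc: "?h (0 + c * \<theta>) = c powr (s - 1) * ?h' \<theta>" for \<theta>
    using c by (cases "\<theta> > 0") (auto simp: powr_mult zero_less_mult_iff mult_ac)
  have "integrable lborel (\<lambda>\<theta>. c powr (s - 1) * ?h' \<theta>)"
    using lborel_integrable_real_affine[OF h, of c 0] c unfolding sc by simp
  then have "integrable lborel (\<lambda>\<theta>. (1 / c powr (s - 1)) * (c powr (s - 1) * ?h' \<theta>))"
    by (rule integrable_mult_right)
  also have "(\<lambda>\<theta>. (1 / c powr (s - 1)) * (c powr (s - 1) * ?h' \<theta>)) = ?h'"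
    using c by (simp add: fun_eq_iff)
  finally show ?I .
  have "Gamma s = \<bar>c\<bar> *\<^sub>R (\<integral>\<theta>. ?h (0 + c * \<theta>) \<partial>lborel)"
    unfolding Ih[symmetric] by (rule lborel_integral_real_affine) (use c in simp)
  also have "\<dots> = c powr s * (\<integral>\<theta>. ?h' \<theta> \<partial>lborel)"
    unfolding sc integral_mult_right_zero using c by (simp add: powr_diff)
  finally show ?E using c by (simp add: field_simps)
qed

lemma integrable_F_integrand:
  assumes p: "p > 0" and t: "t \<ge> 0" and \<nu>: "Re \<nu> > -1"
  shows "integrable lborel (\<lambda>y. complex_of_real \<bar>y\<bar> powr \<nu> *
        complex_of_real (exp (- (\<bar>y\<bar> powr p) - t * \<bar>y\<bar> powr (2 * p - 2))))"
proof (rule Bochner_Integration.integrable_bound)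
  show "integrable lborel (\<lambda>y. \<bar>y\<bar> powr Re \<nu> * exp (- (\<bar>1 * y\<bar> powr p)))"
    by (rule integrable_abs_powr_exp) (use p \<nu> in auto)
  show "AE y in lborel. norm (complex_of_real \<bar>y\<bar> powr \<nu> *
        complex_of_real (exp (- (\<bar>y\<bar> powr p) - t * \<bar>y\<bar> powr (2 * p - 2)))) \<le>
      norm (\<bar>y\<bar> powr Re \<nu> * exp (- (\<bar>1 * y\<bar> powr p)))"
    using t by (intro AE_I2) (simp add: norm_mult norm_powr_real_powr mult_left_mono)
qed measurable

context weighted_lp
begin

section \<open>Homogeneous weights, the auxiliary variable \<theta> and separation of
  coordinates\<close>

definition pow_prod :: "('n \<Rightarrow> complex) \<Rightarrow> real ^ 'n \<Rightarrow> complex" where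
  "pow_prod l x = (\<Prod>k\<in>UNIV. complex_of_real \<bar>x $ k\<bar> powr l k)"

lemma measurable_pow_prod [measurable]: "pow_prod l \<in> borel_measurable borel"
  unfolding pow_prod_def[abs_def] by measurable

lemma pow_prod_scale:
  assumes "r > 0"
  shows "pow_prod l (r *\<^sub>R x) = complex_of_real r powr (\<Sum>k\<in>UNIV. l k) * pow_prod l x"
proof -
  have "pow_prod l (r *\<^sub>R x) = (\<Prod>k\<in>UNIV. complex_of_real r powr l k * complex_of_real \<bar>x $ k\<bar> powr l k)"
    unfolding pow_prod_def using assms
    by (intro prod.cong) (simp_all add: abs_mult powr_times_real)
  also have "\<dots> = complex_of_real r powr (\<Sum>k\<in>UNIV. l k) * pow_prod l x"
    using assms by (simp add: prod.distrib powr_sum pow_prod_def)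
  finally show ?thesis .
qed

text \<open>Degrees: 2 (p - 1) from the squared component, (p - 2) (m - 1) from the derivatives and
  - (p - 1) m from the denominator add up to p - m.\<close>

lemma curv_term_scale:
  assumes "r > 0" and m: "card I = m - 1" "m \<ge> 1"
  shows "curv_term i I (r *\<^sub>R x) / norm (normal (r *\<^sub>R x)) ^ m = r powr (p - real m) * (curv_term i I x / norm (normal x) ^ m)"
proof -
  have "(r powr (p - 1))\<^sup>2 * (r powr (p - 2)) ^ (m - 1) = r powr ((p - 1) + (p - 1) + (p - 2) * real (m - 1))"
    using assms(1) by (simp only: powr_add power2_eq_square) (simp add: powr_power mult.commute)
  also have "\<dots> = r powr (p - real m) * r powr ((p - 1) * real m)"
    using m by (simp add: powr_add[symmetric] of_nat_diff algebra_simps)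
  also have "r powr ((p - 1) * real m) = (r powr (p - 1)) ^ m"
    using assms(1) by (simp add: powr_power mult_ac)
  finally have e: "(r powr (p - 1))\<^sup>2 * (r powr (p - 2)) ^ (m - 1) = r powr (p - real m) * (r powr (p - 1)) ^ m" .
  have "curv_term i I (r *\<^sub>R x) = ((r powr (p - 1))\<^sup>2 * (r powr (p - 2)) ^ (m - 1)) * curv_term i I x"
    using assms by (simp add: curv_term_def normal_scale normal_deriv_scale prod.distrib power_mult_distrib mult_ac)
  moreover have "norm (normal (r *\<^sub>R x)) ^ m = (r powr (p - 1)) ^ m * norm (normal x) ^ m"
    using assms by (simp add: normal_scale power_mult_distrib)
  ultimately show ?thesis unfolding e using assms(1) by (simp add: field_simps)
qed

definition weighted_term :: "('n \<Rightarrow> complex) \<Rightarrow> nat \<Rightarrow> 'n \<Rightarrow> 'n set \<Rightarrow> real ^ 'n \<Rightarrow> complex" where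
  "weighted_term l m i I x = pow_prod l x * complex_of_real (curv_term i I x / norm (normal x) ^ m)"

lemma measurable_weighted_term [measurable]: "weighted_term l m i I \<in> borel_measurable borel"
  unfolding weighted_term_def[abs_def] by measurable

lemma integrable_weighted_term:
  assumes i: "i \<notin> I" and c: "\<And>k. Re (l k) + term_exp i I k > -1"
  shows "integrable (cone_measure rad) (weighted_term l m i I)"
proof (rule integrableI_bounded)
  have "norm (weighted_term l m i I x) = (\<Prod>k\<in>UNIV. \<bar>x $ k\<bar> powr Re (l k)) * curv_term i I x / norm (normal x) ^ m" for x
    by (simp add: weighted_term_def pow_prod_def norm_mult norm_divide norm_power prod_norm[symmetric] norm_powr_real_powr curv_term_nonneg
        del: of_real_divide of_real_power of_real_mult)
  then show "(\<integral>\<^sup>+x. ennreal (norm (weighted_term l m i I x)) \<partial>cone_measure rad) < \<infinity>"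
    using nn_integral_curv_term_finite[OF i, of "\<lambda>k. Re (l k)" m] c by simp
qed measurable

text \<open>The degree of \<open>weighted_term\<close> is the sum of the \<open>l k\<close> plus p -
  m, so the lower bound on the real part of that sum is precisely the radial condition at the
  origin.\<close>

lemma integral_weighted_term_exp:
  assumes i: "i \<notin> I" and c: "\<And>k. Re (l k) + term_exp i I k > -1" and m: "card I = m - 1" "m \<ge> 1"
    and \<Lambda>: "Re (\<Sum>k\<in>UNIV. l k) > real m - real CARD('n) - p"
  defines "D \<equiv> of_nat CARD('n) + (\<Sum>k\<in>UNIV. l k) + complex_of_real p - of_nat m"
  shows "integrable lborel (\<lambda>z. weighted_term l m i I z * complex_of_real (exp (- psi z)))"
    and "(\<integral>z. weighted_term l m i I z * complex_of_real (exp (- psi z)) \<partial>lborel) =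
      Gamma (D / of_real p) / of_real p * (\<integral>x. weighted_term l m i I x \<partial>cone_measure rad)"
proof -
  define d where "d = (\<Sum>k\<in>UNIV. l k) + complex_of_real (p - real m)"
  have hom: "weighted_term l m i I (r *\<^sub>R x) = complex_of_real r powr d * weighted_term l m i I x" if "r > 0" for r x
    using that unfolding weighted_term_def curv_term_scale[OF that m] pow_prod_scale[OF that] d_def powr_add
    by (simp add: powr_of_real[OF less_imp_le[OF that]] mult_ac del: of_real_diff)
  have re: "Re d + real CARD('n) > 0" using \<Lambda> by (simp add: d_def)
  have D: "of_nat CARD('n) + d = D" by (simp add: d_def D_def)
  note * = integrable_homogeneous_exp[OF measurable_weighted_term hom re integrable_weighted_term[OF i c]]
    integral_homogeneous_exp[OF measurable_weighted_term hom re integrable_weighted_term[OF i c]]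
  show "integrable lborel (\<lambda>z. weighted_term l m i I z * complex_of_real (exp (- psi z)))"
    "(\<integral>z. weighted_term l m i I z * complex_of_real (exp (- psi z)) \<partial>lborel) =
      Gamma (D / of_real p) / of_real p * (\<integral>x. weighted_term l m i I x \<partial>cone_measure rad)"
    using * unfolding D by simp_all
qed

text \<open>The joint integrand in z and \<theta>: its \<theta> integral restores
  \<open>weighted_term\<close> times exp (- \<open>psi\<close>) up to Gamma (m / 2), and its z
  integral factorizes. The indicator lets \<theta> range over the whole line, as the product measure
  requires.\<close>

definition theta_fun :: "('n \<Rightarrow> complex) \<Rightarrow> nat \<Rightarrow> 'n \<Rightarrow> 'n set \<Rightarrow> real ^ 'n \<Rightarrow> real \<Rightarrow> complex" where
  "theta_fun l m i I z \<theta> = complex_of_real (indicator {0<..} \<theta> * (\<theta> powr (real m / 2 - 1) * exp (- \<theta> * (norm (normal z))\<^sup>2))) *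
     (pow_prod l z * complex_of_real (curv_term i I z * exp (- psi z)))"

lemma measurable_theta_fun [measurable (raw)]:
  assumes [measurable]: "f \<in> borel_measurable M" "h \<in> borel_measurable M"
  shows "(\<lambda>x. theta_fun l m i I (f x) (h x)) \<in> borel_measurable M"
  unfolding theta_fun_def[abs_def] by measurable

text \<open>The kernel in \<theta> is nonnegative, so one Gamma integral evaluates both
  \<open>theta_fun\<close> and its norm. The norm identity is the input for exchanging the
  integrations.\<close>

lemma
  assumes z: "z \<noteq> 0" and m: "m \<ge> 1"
  shows integrable_theta_fun: "integrable lborel (theta_fun l m i I z)"
    and integral_theta_fun: "(\<integral>\<theta>. theta_fun l m i I z \<theta> \<partial>lborel) =
      complex_of_real (Gamma (real m / 2)) * (weighted_term l m i I z * complex_of_real (exp (- psi z)))"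
    and integral_norm_theta_fun: "(\<integral>\<theta>. norm (theta_fun l m i I z \<theta>) \<partial>lborel) =
      Gamma (real m / 2) * norm (weighted_term l m i I z * complex_of_real (exp (- psi z)))"
proof -
  obtain k where "z $ k \<noteq> 0" using z by (auto simp: vec_eq_iff)
  then have "normal z $ k \<noteq> 0" by (simp add: normal_def p a)
  then have N: "norm (normal z) > 0" by auto
  let ?c = "(norm (normal z))\<^sup>2"
  let ?h = "\<lambda>\<theta>. indicator {0<..} \<theta> * (\<theta> powr (real m / 2 - 1) * exp (- \<theta> * ?c)) :: real"
  have I: "integrable lborel ?h"
    and E: "(\<integral>\<theta>. ?h \<theta> \<partial>lborel) = Gamma (real m / 2) / ?c powr (real m / 2)"
    using integrable_Gamma_scaled[of "real m / 2" ?c] integral_Gamma_scaled[of "real m / 2" ?c] m N by auto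
  have "?c = norm (normal z) powr 2" using N by simp
  then have "?c powr (real m / 2) = norm (normal z) powr (2 * (real m / 2))" by (simp only: powr_powr)
  then have cm: "?c powr (real m / 2) = norm (normal z) ^ m"
    using N by (simp add: powr_realpow)
  let ?q = "pow_prod l z * complex_of_real (curv_term i I z * exp (- psi z))"
  have q: "?q / complex_of_real (norm (normal z) ^ m) = weighted_term l m i I z * complex_of_real (exp (- psi z))"
    by (simp add: weighted_term_def)
  show "integrable lborel (theta_fun l m i I z)"
    unfolding theta_fun_def[abs_def] by (intro integrable_mult_left) (simp only: complex_of_real_integrable_eq I)
  have "(\<integral>\<theta>. theta_fun l m i I z \<theta> \<partial>lborel) = complex_of_real (\<integral>\<theta>. ?h \<theta> \<partial>lborel) * ?q"
    unfolding theta_fun_def by (simp only: integral_mult_left_zero integral_complex_of_real)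
  then show "(\<integral>\<theta>. theta_fun l m i I z \<theta> \<partial>lborel) =
      complex_of_real (Gamma (real m / 2)) * (weighted_term l m i I z * complex_of_real (exp (- psi z)))"
    unfolding E cm q[symmetric] by simp
  have nh: "norm (complex_of_real (?h \<theta>)) = ?h \<theta>" for \<theta>
    unfolding norm_of_real by (rule abs_of_nonneg) (simp add: indicator_def)
  have "(\<integral>\<theta>. norm (theta_fun l m i I z \<theta>) \<partial>lborel) = (\<integral>\<theta>. ?h \<theta> \<partial>lborel) * norm ?q"
    unfolding theta_fun_def norm_mult[of "complex_of_real (?h _)"] nh by (rule integral_mult_left_zero)
  then show "(\<integral>\<theta>. norm (theta_fun l m i I z \<theta>) \<partial>lborel) =
      Gamma (real m / 2) * norm (weighted_term l m i I z * complex_of_real (exp (- psi z)))"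
    unfolding E cm q[symmetric] norm_divide norm_of_real by simp
qed

text \<open>Integrating the norm over \<theta> first leaves a multiple of the norm of a function
  already known to be integrable, which justifies Fubini. The point z = 0, where the normal
  vanishes, is a null set.\<close>

lemma
  assumes i: "i \<notin> I" and c: "\<And>k. Re (l k) + term_exp i I k > -1" and m: "card I = m - 1" "m \<ge> 1"
    and \<Lambda>: "Re (\<Sum>k\<in>UNIV. l k) > real m - real CARD('n) - p"
  defines "D \<equiv> of_nat CARD('n) + (\<Sum>k\<in>UNIV. l k) + complex_of_real p - of_nat m"
  shows integrable_theta_fun_swap: "integrable lborel (\<lambda>\<theta>. \<integral>z. theta_fun l m i I z \<theta> \<partial>lborel)"
    and integral_theta_fun_swap: "(\<integral>\<theta>. (\<integral>z. theta_fun l m i I z \<theta> \<partial>lborel) \<partial>lborel) =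
      complex_of_real (Gamma (real m / 2)) * (Gamma (D / of_real p) / of_real p * (\<integral>x. weighted_term l m i I x \<partial>cone_measure rad))"
proof -
  note ex = integral_weighted_term_exp[OF i c m \<Lambda>, folded D_def]
  have nz: "AE z in lborel. z \<noteq> (0 :: real ^ 'n)" by (rule AE_lborel_singleton)
  have int: "integrable (lborel \<Otimes>\<^sub>M lborel) (\<lambda>(z, \<theta>). theta_fun l m i I z \<theta>)"
  proof (rule lborel_pair.Fubini_integrable)
    show "(\<lambda>(z, \<theta>). theta_fun l m i I z \<theta>) \<in> borel_measurable (lborel \<Otimes>\<^sub>M lborel)" by measurable
    have "integrable lborel (\<lambda>z. Gamma (real m / 2) * norm (weighted_term l m i I z * complex_of_real (exp (- psi z))))"
      by (intro integrable_mult_right integrable_norm ex)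
    also have "?this \<longleftrightarrow> integrable lborel (\<lambda>z. LINT \<theta>|lborel. norm (case (z, \<theta>) of (z, \<theta>) \<Rightarrow> theta_fun l m i I z \<theta>))"
    proof (rule integrable_cong_AE)
      show "AE z in lborel. Gamma (real m / 2) * norm (weighted_term l m i I z * complex_of_real (exp (- psi z))) =
        (LINT \<theta>|lborel. norm (case (z, \<theta>) of (z, \<theta>) \<Rightarrow> theta_fun l m i I z \<theta>))"
        using nz
      proof eventually_elim
        case (elim z)
        show ?case unfolding prod.case by (rule integral_norm_theta_fun[OF elim m(2), symmetric])
      qed
    qed measurable
    finally show "integrable lborel (\<lambda>z. LINT \<theta>|lborel. norm (case (z, \<theta>) of (z, \<theta>) \<Rightarrow> theta_fun l m i I z \<theta>))" .
    show "AE z in lborel. integrable lborel (\<lambda>\<theta>. case (z, \<theta>) of (z, \<theta>) \<Rightarrow> theta_fun l m i I z \<theta>)"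
      using nz unfolding prod.case by eventually_elim (rule integrable_theta_fun[OF _ m(2)])
  qed
  show "integrable lborel (\<lambda>\<theta>. \<integral>z. theta_fun l m i I z \<theta> \<partial>lborel)"
    by (rule lborel_pair.integrable_snd[OF int])
  have "(\<integral>\<theta>. (\<integral>z. theta_fun l m i I z \<theta> \<partial>lborel) \<partial>lborel) = (\<integral>z. (\<integral>\<theta>. theta_fun l m i I z \<theta> \<partial>lborel) \<partial>lborel)"
    unfolding lborel_pair.integral_snd[OF int] lborel_pair.integral_fst[OF int] ..
  also have "\<dots> = (\<integral>z. complex_of_real (Gamma (real m / 2)) * (weighted_term l m i I z * complex_of_real (exp (- psi z))) \<partial>lborel)"
  proof (rule integral_cong_AE)
    show "AE z in lborel. (\<integral>\<theta>. theta_fun l m i I z \<theta> \<partial>lborel) =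
      complex_of_real (Gamma (real m / 2)) * (weighted_term l m i I z * complex_of_real (exp (- psi z)))"
      using nz by eventually_elim (rule integral_theta_fun[OF _ m(2)])
  qed measurable
  also have "\<dots> = complex_of_real (Gamma (real m / 2)) * (Gamma (D / of_real p) / of_real p * (\<integral>x. weighted_term l m i I x \<partial>cone_measure rad))"
    by (simp only: integral_mult_right_zero ex)
  finally show "(\<integral>\<theta>. (\<integral>z. theta_fun l m i I z \<theta> \<partial>lborel) \<partial>lborel) =
      complex_of_real (Gamma (real m / 2)) * (Gamma (D / of_real p) / of_real p * (\<integral>x. weighted_term l m i I x \<partial>cone_measure rad))" .
qed

definition factor :: "complex \<Rightarrow> 'n \<Rightarrow> 'n set \<Rightarrow> real \<Rightarrow> 'n \<Rightarrow> real \<Rightarrow> complex" where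
  "factor w i I \<theta> k y = complex_of_real \<bar>y\<bar> powr w * complex_of_real (term_coef i I k * term_pow i I k (a k * y)) *
     complex_of_real (exp (- (\<bar>a k * y\<bar> powr p) - \<theta> * (a k)\<^sup>2 * \<bar>a k * y\<bar> powr (2 * p - 2)))"

text \<open>Of all the powers, only \<bar>y\<bar> powr w is not already written in terms of a k * y.
  The substitution therefore leaves a k powr (- w) from this factor and 1 / a k from the
  measure.\<close>

lemma
  assumes \<theta>: "\<theta> \<ge> 0" and w: "Re w + term_exp i I k > -1"
  shows integrable_factor: "integrable lborel (factor w i I \<theta> k)" (is ?I)
    and integral_factor: "(\<integral>y. factor w i I \<theta> k y \<partial>lborel) = complex_of_real (a k) powr (- w - 1) *
      (complex_of_real (term_coef i I k) * F_integral p (\<theta> * (a k)\<^sup>2) (w + complex_of_real (term_exp i I k)))" (is ?E)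
proof -
  let ?e = "complex_of_real (term_exp i I k)"
  let ?f = "\<lambda>y. complex_of_real \<bar>y\<bar> powr (w + ?e) *
        complex_of_real (exp (- (\<bar>y\<bar> powr p) - (\<theta> * (a k)\<^sup>2) * \<bar>y\<bar> powr (2 * p - 2)))"
  have f: "integrable lborel ?f"
    by (rule integrable_F_integrand) (use p \<theta> w in auto)
  let ?C = "complex_of_real (a k) powr (- w) * complex_of_real (term_coef i I k)"
  have ak: "complex_of_real (a k) \<noteq> 0" using a[of k] by simp
  have eq: "factor w i I \<theta> k y = ?C * ?f (0 + a k * y)" for y
  proof -
    have "complex_of_real \<bar>a k * y\<bar> powr (w + ?e) =
        complex_of_real (a k) powr w * complex_of_real \<bar>y\<bar> powr w * complex_of_real (term_pow i I k (a k * y))"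
    proof -
      have "complex_of_real \<bar>a k * y\<bar> powr w = complex_of_real (a k) powr w * complex_of_real \<bar>y\<bar> powr w"
        using a[of k] by (simp add: abs_mult powr_times_real)
      moreover have "complex_of_real \<bar>a k * y\<bar> powr (w + ?e) = complex_of_real \<bar>a k * y\<bar> powr w * complex_of_real (term_pow i I k (a k * y))"
      proof (cases "k \<in> insert i I")
        case True
        then show ?thesis by (simp only: powr_add powr_of_real[OF abs_ge_zero] term_pow_def if_True)
      next
        case False
        then show ?thesis by (simp add: term_pow_def term_exp_def)
      qed
      ultimately show ?thesis by simp
    qed
    then show ?thesis
      using ak by (simp add: factor_def powr_minus)
  qed
  have "integrable lborel (\<lambda>y. ?C * ?f (0 + a k * y))"
    using a[of k] by (intro integrable_mult_right lborel_integrable_real_affine f) auto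
  then show ?I unfolding eq[symmetric] .
  have F: "F_integral p (\<theta> * (a k)\<^sup>2) (w + ?e) = \<bar>a k\<bar> *\<^sub>R (\<integral>y. ?f (0 + a k * y) \<partial>lborel)"
    unfolding F_integral_def by (rule lborel_integral_real_affine) (use a[of k] in simp)
  have "(\<integral>y. factor w i I \<theta> k y \<partial>lborel) = ?C * (\<integral>y. ?f (0 + a k * y) \<partial>lborel)"
    unfolding eq by (rule integral_mult_right_zero)
  also have "\<dots> = complex_of_real (a k) powr (- w - 1) * (complex_of_real (term_coef i I k) * F_integral p (\<theta> * (a k)\<^sup>2) (w + ?e))"
    unfolding F using a[of k] ak by (simp add: powr_diff scaleR_conv_of_real)
  finally show ?E .
qed

text \<open>Both \<open>psi\<close> and the squared length of the normal are sums over coordinates,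
  so the exponential splits; the remaining factors are products by construction.\<close>

lemma theta_fun_eq_prod:
  assumes i: "i \<notin> I"
  shows "theta_fun l m i I z \<theta> = complex_of_real (indicator {0<..} \<theta> * \<theta> powr (real m / 2 - 1)) *
    (\<Prod>k\<in>UNIV. factor (l k) i I \<theta> k (z $ k))"
proof -
  have "(norm (normal z))\<^sup>2 = (\<Sum>k\<in>UNIV. (normal z $ k)\<^sup>2)"
    unfolding power2_norm_eq_inner inner_vec_def by (simp add: power2_eq_square)
  also have "\<dots> = (\<Sum>k\<in>UNIV. (a k)\<^sup>2 * \<bar>a k * z $ k\<bar> powr (2 * p - 2))"
    by (simp add: normal_def normal_comp_power2[OF p a])
  finally have "exp (- \<theta> * (norm (normal z))\<^sup>2) * exp (- psi z) =
      (\<Prod>k\<in>UNIV. exp (- (\<bar>a k * z $ k\<bar> powr p) - \<theta> * (a k)\<^sup>2 * \<bar>a k * z $ k\<bar> powr (2 * p - 2)))"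
    by (simp add: psi_def exp_add[symmetric] exp_sum[symmetric] sum_subtractf sum_negf sum_distrib_left mult_ac)
  then have e: "complex_of_real (exp (- \<theta> * (norm (normal z))\<^sup>2) * exp (- psi z)) =
      (\<Prod>k\<in>UNIV. complex_of_real (exp (- (\<bar>a k * z $ k\<bar> powr p) - \<theta> * (a k)\<^sup>2 * \<bar>a k * z $ k\<bar> powr (2 * p - 2))))"
    by (simp only: of_real_prod)
  have curv_term: "complex_of_real (curv_term i I z) = (\<Prod>k\<in>UNIV. complex_of_real (term_coef i I k * term_pow i I k (a k * z $ k)))"
    by (simp only: curv_term_eq_prod[OF i] of_real_prod)
  have "(\<Prod>k\<in>UNIV. factor (l k) i I \<theta> k (z $ k)) =
      pow_prod l z * complex_of_real (curv_term i I z) * complex_of_real (exp (- \<theta> * (norm (normal z))\<^sup>2) * exp (- psi z))"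
    unfolding factor_def prod.distrib pow_prod_def curv_term e by (simp only: prod.distrib)
  then show ?thesis by (simp add: theta_fun_def)
qed

lemma prod_curv_term_split:
  fixes F :: "'n \<Rightarrow> complex \<Rightarrow> complex"
  assumes i: "i \<notin> I" and I: "card I = m - 1"
  shows "(\<Prod>k\<in>UNIV. complex_of_real (term_coef i I k) * F k (l k + complex_of_real (term_exp i I k))) =
    complex_of_real ((p - 1) ^ (m - 1)) *
      ((complex_of_real ((a i)\<^sup>2) * F i (l i + complex_of_real (2 * p - 2))) *
       (\<Prod>j\<in>I. complex_of_real ((a j)\<^sup>2) * F j (l j + complex_of_real (p - 2))) *
       (\<Prod>k\<in>UNIV - (I \<union> {i}). F k (l k)))"
proof -
  let ?t = "\<lambda>k. complex_of_real (term_coef i I k) * F k (l k + complex_of_real (term_exp i I k))"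
  have "prod ?t UNIV = prod ?t (insert i I) * prod ?t (UNIV - (I \<union> {i}))"
    by (subst prod.subset_diff[of "insert i I"]) (auto simp: mult.commute)
  also have "prod ?t (insert i I) = ?t i * prod ?t I" using i by simp
  also have "?t i = complex_of_real ((a i)\<^sup>2) * F i (l i + complex_of_real (2 * p - 2))"
    by (simp add: term_coef_def term_exp_def)
  also have "prod ?t I = (\<Prod>j\<in>I. complex_of_real (p - 1) * (complex_of_real ((a j)\<^sup>2) * F j (l j + complex_of_real (p - 2))))"
    using i by (intro prod.cong) (auto simp: term_coef_def term_exp_def)
  also have "\<dots> = complex_of_real ((p - 1) ^ (m - 1)) * (\<Prod>j\<in>I. complex_of_real ((a j)\<^sup>2) * F j (l j + complex_of_real (p - 2)))"
    by (simp only: prod.distrib prod_constant I of_real_power)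
  also have "prod ?t (UNIV - (I \<union> {i})) = (\<Prod>k\<in>UNIV - (I \<union> {i}). F k (l k))"
    by (intro prod.cong) (auto simp: term_coef_def term_exp_def)
  finally show ?thesis by (simp only: mult_ac)
qed

lemma integral_theta_fun_eq:
  assumes i: "i \<notin> I" and c: "\<And>k. Re (l k) + term_exp i I k > -1" and m: "card I = m - 1"
  shows "(\<integral>z. theta_fun l m i I z \<theta> \<partial>lborel) = indicator {0<..} \<theta> *\<^sub>R
     (complex_of_real ((p - 1) ^ (m - 1)) * (\<Prod>k\<in>UNIV. complex_of_real (a k) powr (- l k - 1)) *
       (complex_of_real (\<theta> powr (real m / 2 - 1)) *
        (complex_of_real ((a i)\<^sup>2) * F_integral p (\<theta> * (a i)\<^sup>2) (l i + complex_of_real (2 * p - 2))) *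
        (\<Prod>j\<in>I. complex_of_real ((a j)\<^sup>2) * F_integral p (\<theta> * (a j)\<^sup>2) (l j + complex_of_real (p - 2))) *
        (\<Prod>k\<in>UNIV - (I \<union> {i}). F_integral p (\<theta> * (a k)\<^sup>2) (l k))))"
proof (cases "\<theta> > 0")
  case True
  have "(\<integral>z. theta_fun l m i I z \<theta> \<partial>lborel) =
      complex_of_real (indicator {0<..} \<theta> * \<theta> powr (real m / 2 - 1)) * (\<Prod>k\<in>UNIV. \<integral>y. factor (l k) i I \<theta> k y \<partial>lborel)"
    using True c unfolding theta_fun_eq_prod[OF i] integral_mult_right_zero
    by (subst integral_lborel_prod_vec) (auto intro!: integrable_factor)
  also have "(\<Prod>k\<in>UNIV. \<integral>y. factor (l k) i I \<theta> k y \<partial>lborel) =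
      (\<Prod>k\<in>UNIV. complex_of_real (a k) powr (- l k - 1) *
        (complex_of_real (term_coef i I k) * F_integral p (\<theta> * (a k)\<^sup>2) (l k + complex_of_real (term_exp i I k))))"
    using True c by (intro prod.cong refl integral_factor) auto
  also have "\<dots> = (\<Prod>k\<in>UNIV. complex_of_real (a k) powr (- l k - 1)) *
      (\<Prod>k\<in>UNIV. complex_of_real (term_coef i I k) * F_integral p (\<theta> * (a k)\<^sup>2) (l k + complex_of_real (term_exp i I k)))"
    by (simp only: prod.distrib mult.assoc)
  finally show ?thesis
    unfolding prod_curv_term_split[OF i m, of "\<lambda>k. F_integral p (\<theta> * (a k)\<^sup>2)"] using True by (simp only: mult_ac indicator_simps greaterThan_iff scaleR_one mult_1_left)
qed (simp add: theta_fun_def)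

lemma
  assumes c: "\<And>i I k. i \<notin> I \<Longrightarrow> card I = m - 1 \<Longrightarrow> Re (l k) + term_exp i I k > -1"
    and m: "1 \<le> m" "m \<le> CARD('n)"
  shows integrable_pow_prod_curv_meas: "integrable (curv_meas (CARD('n) - m)) (pow_prod l)" (is ?I)
    and integral_pow_prod_curv_meas: "integral\<^sup>L (curv_meas (CARD('n) - m)) (pow_prod l) =
      (\<Sum>i\<in>UNIV. \<Sum>I\<in>{I. I \<subseteq> UNIV - {i} \<and> card I = m - 1}. \<integral>x. weighted_term l m i I x \<partial>cone_measure rad) /
        (of_nat m * complex_of_real (unit_ball_vol (real m)))" (is ?E)
proof -
  let ?J = "\<lambda>i::'n. {I. I \<subseteq> UNIV - {i} \<and> card I = m - 1}"
  have eq: "curv_density (CARD('n) - (CARD('n) - m)) x *\<^sub>R pow_prod l x =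
      (\<Sum>i\<in>UNIV. \<Sum>I\<in>?J i. weighted_term l m i I x) / (of_nat m * complex_of_real (unit_ball_vol (real m)))" for x
  proof -
    have "(\<Sum>i\<in>UNIV. \<Sum>I\<in>?J i. weighted_term l m i I x) = pow_prod l x * complex_of_real (curv_sum m x / norm (normal x) ^ m)"
      by (simp only: weighted_term_def sum_distrib_left[symmetric] of_real_sum[symmetric] sum_divide_distrib[symmetric] curv_sum_def)
    then show ?thesis
      using m by (simp add: curv_density_def scaleR_conv_of_real mult_ac)
  qed
  have int: "integrable (cone_measure rad) (weighted_term l m i I)" if "I \<in> ?J i" for i I
    using that c by (intro integrable_weighted_term) auto
  show ?I
    unfolding integrable_curv_meas_iff[OF measurable_pow_prod] eq
    by (intro integrable_divide_zero Bochner_Integration.integrable_sum int impI)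
  have "(\<integral>x. (\<Sum>i\<in>UNIV. \<Sum>I\<in>?J i. weighted_term l m i I x) \<partial>cone_measure rad) =
      (\<Sum>i\<in>UNIV. \<Sum>I\<in>?J i. \<integral>x. weighted_term l m i I x \<partial>cone_measure rad)"
    by (subst Bochner_Integration.integral_sum)
       (auto intro!: Bochner_Integration.integrable_sum Bochner_Integration.integral_sum sum.cong int)
  then show ?E
    unfolding integral_curv_meas[OF measurable_pow_prod] eq integral_divide_zero by (simp only:)
qed

end

theorem proposition4p10:
  fixes p :: real and a :: "'n::finite \<Rightarrow> real" and l :: "'n \<Rightarrow> complex" and m :: nat
  defines "n \<equiv> CARD('n)"
    and "\<Lambda> \<equiv> \<Sum>k\<in>UNIV. l k"
    and "\<mu> \<equiv> curvature_measure (weighted_lp_ball p a) (CARD('n) - m)"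
    and "f \<equiv> \<lambda>x::real^'n. \<Prod>k\<in>UNIV. complex_of_real \<bar>x $ k\<bar> powr l k"
    and "g \<equiv> \<lambda>i I \<theta>. complex_of_real (\<theta> powr (real m / 2 - 1)) *
             (complex_of_real ((a i)\<^sup>2) * F_integral p (\<theta> * (a i)\<^sup>2) (l i + complex_of_real (2 * p - 2))) *
             (\<Prod>j\<in>I. complex_of_real ((a j)\<^sup>2) * F_integral p (\<theta> * (a j)\<^sup>2) (l j + complex_of_real (p - 2))) *
             (\<Prod>k\<in>UNIV - (I \<union> {i}). F_integral p (\<theta> * (a k)\<^sup>2) (l k))"
  assumes p: "1 < p"
    and n: "n \<ge> 2"
    and a: "\<And>k. a k > 0"
    and m: "1 \<le> m" "m \<le> n"
    and \<Lambda>: "Re \<Lambda> > real m - real n - p"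
    and first: "m = 1 \<Longrightarrow> \<forall>k. Re (l k) > -1"
    and middle: "2 \<le> m \<Longrightarrow> m \<le> n - 1 \<Longrightarrow> \<forall>k. Re (l k) > max (-1) (1 - p)"
    and last: "m = n \<Longrightarrow> \<forall>k. Re (l k) > 1 - p"
  shows "integrable \<mu> f \<and>
    (\<forall>i. \<forall>I\<subseteq>UNIV - {i}. card I = m - 1 \<longrightarrow> set_integrable lborel {0<..} (g i I)) \<and>
    (LINT x|\<mu>. f x) =
      complex_of_real (p * (p - 1) ^ (m - 1)) /
        (of_nat m * complex_of_real (unit_ball_vol (real m)) *
         Gamma ((of_nat n + \<Lambda> + complex_of_real p - of_nat m) / complex_of_real p) *
         Gamma (of_nat m / 2)) *
      (\<Prod>k\<in>UNIV. complex_of_real (a k) powr (- l k - 1)) *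
      (\<Sum>i\<in>UNIV. \<Sum>I\<in>{I. I \<subseteq> UNIV - {i} \<and> card I = m - 1}.
         LINT \<theta>:{0<..}|lborel. g i I \<theta>)"
proof -
  interpret weighted_lp p a by unfold_locales (fact p, fact a)
  let ?J = "\<lambda>i::'n. {I. I \<subseteq> UNIV - {i} \<and> card I = m - 1}"
  define D where "D = of_nat n + \<Lambda> + complex_of_real p - of_nat m"
  define A where "A = (\<Prod>k\<in>UNIV. complex_of_real (a k) powr (- l k - 1))"
  define C where "C = complex_of_real ((p - 1) ^ (m - 1)) * A"
  define G1 where "G1 = Gamma (D / complex_of_real p)"
  define G2 where "G2 = complex_of_real (Gamma (real m / 2))"
  define M where "M = of_nat m * complex_of_real (unit_ball_vol (real m))"
  \<comment> \<open>For m = 1 the set I is empty, so the exponent shift p - 2 never occurs; for m =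
    n no index lies outside I and i, so the shift 0 never occurs. In between all shifts occur. The
    shift 2 * p - 2 is covered by either lower bound on Re (l k).\<close>
  have c: "Re (l k) + term_exp i I k > -1" if i: "i \<notin> I" and I: "card I = m - 1" for i k :: 'n and I
  proof -
    consider "m = 1" | "2 \<le> m" "m \<le> n - 1" | "m = n" "m \<ge> 2" using m n by linarith
    then show ?thesis
    proof cases
      case 1
      then have "I = {}" using I by simp
      moreover have "Re (l k) > -1" using first 1 by simp
      ultimately show ?thesis using p by (auto simp: term_exp_def)
    next
      case 2
      then have "Re (l k) > -1" "Re (l k) > 1 - p" using middle by auto
      then show ?thesis using p by (auto simp: term_exp_def)
    next
      case 3
      have "I = UNIV - {i}"
        by (rule card_subset_eq) (use i I 3 in \<open>auto simp: n_def card_Diff_singleton\<close>)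
      then show ?thesis using last 3 p by (auto simp: term_exp_def dest!: spec[of _ k])
    qed
  qed
  have m': "m \<ge> 1" "m \<le> CARD('n)" using m by (auto simp: n_def)
  have \<Lambda>': "Re (\<Sum>k\<in>UNIV. l k) > real m - real CARD('n) - p" using \<Lambda> by (simp add: \<Lambda>_def n_def)
  have \<mu>: "\<mu> = curv_meas (CARD('n) - m)"
    unfolding \<mu>_def using m' by (intro curvature_measure_ball) simp
  have f: "f = pow_prod l" by (simp add: f_def pow_prod_def fun_eq_iff)
  \<comment> \<open>The exchange of integrations yields integrability of C times g and an equation
    carrying C on one side and \<open>G1\<close>, \<open>G2\<close> on the other; the three factors
    must be invertible to isolate the wanted terms.\<close>
  have C0: "C \<noteq> 0"
    using p less_imp_neq[OF a] by (auto simp: C_def A_def)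
  have G1: "G1 \<noteq> 0"
  proof -
    \<comment> \<open>This is the hypothesis on \<Lambda>; it keeps the argument away from the
      poles, where \<open>Gamma\<close> has the value 0 by convention.\<close>
    have "Re (D / complex_of_real p) > 0" using \<Lambda> p by (simp add: D_def)
    moreover have "Re z \<le> 0" if "z \<in> \<int>\<^sub>\<le>\<^sub>0" for z :: complex
      using that by (auto elim!: nonpos_Ints_cases)
    ultimately have "D / complex_of_real p \<notin> \<int>\<^sub>\<le>\<^sub>0" by force
    then show ?thesis by (simp add: G1_def Gamma_eq_zero_iff)
  qed
  have G2: "G2 \<noteq> 0" using m' less_imp_neq[OF Gamma_real_pos[of "real m / 2"]] by (simp add: G2_def)
  have th: "(\<lambda>\<theta>. \<integral>z. theta_fun l m i I z \<theta> \<partial>lborel) = (\<lambda>\<theta>. C * (indicator {0<..} \<theta> *\<^sub>R g i I \<theta>))"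
    if "I \<in> ?J i" for i I
  proof
    fix \<theta>
    have "i \<notin> I" "card I = m - 1" using that by auto
    then show "(\<integral>z. theta_fun l m i I z \<theta> \<partial>lborel) = C * (indicator {0<..} \<theta> *\<^sub>R g i I \<theta>)"
      by (subst integral_theta_fun_eq) (auto simp: c g_def C_def A_def)
  qed
  have g: "set_integrable lborel {0<..} (g i I)" if "I \<in> ?J i" for i I
  proof -
    have "integrable lborel (\<lambda>\<theta>. C * (indicator {0<..} \<theta> *\<^sub>R g i I \<theta>))"
      unfolding th[OF that, symmetric] using that c \<Lambda>' m' by (intro integrable_theta_fun_swap) auto
    then have "integrable lborel (\<lambda>\<theta>. (1 / C) * (C * (indicator {0<..} \<theta> *\<^sub>R g i I \<theta>)))"
      by (rule integrable_mult_right)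
    then show ?thesis
      using C0 by (simp add: set_integrable_def)
  qed
  have ctf: "(\<integral>x. weighted_term l m i I x \<partial>cone_measure rad) =
      complex_of_real p * C / (G1 * G2) * (LINT \<theta>:{0<..}|lborel. g i I \<theta>)" if "I \<in> ?J i" for i I
  proof -
    have "C * (LINT \<theta>:{0<..}|lborel. g i I \<theta>) = (\<integral>\<theta>. (\<integral>z. theta_fun l m i I z \<theta> \<partial>lborel) \<partial>lborel)"
      unfolding th[OF that] by (simp only: integral_mult_right_zero set_lebesgue_integral_def)
    also have "\<dots> = G2 * (G1 / complex_of_real p * (\<integral>x. weighted_term l m i I x \<partial>cone_measure rad))"
      unfolding G1_def G2_def D_def \<Lambda>_def n_def using that c \<Lambda>' m' by (intro integral_theta_fun_swap) auto
    finally show ?thesis using G1 G2 p by (simp add: field_simps)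
  qed
  have "(LINT x|\<mu>. f x) = (\<Sum>i\<in>UNIV. \<Sum>I\<in>?J i. \<integral>x. weighted_term l m i I x \<partial>cone_measure rad) / M"
    unfolding \<mu> f M_def using c m' by (intro integral_pow_prod_curv_meas) auto
  also have "(\<Sum>i\<in>UNIV. \<Sum>I\<in>?J i. \<integral>x. weighted_term l m i I x \<partial>cone_measure rad) =
      complex_of_real p * C / (G1 * G2) * (\<Sum>i\<in>UNIV. \<Sum>I\<in>?J i. LINT \<theta>:{0<..}|lborel. g i I \<theta>)"
    by (simp add: ctf sum_distrib_left)
  finally have "(LINT x|\<mu>. f x) = complex_of_real (p * (p - 1) ^ (m - 1)) / (M * G1 * G2) * A *
      (\<Sum>i\<in>UNIV. \<Sum>I\<in>?J i. LINT \<theta>:{0<..}|lborel. g i I \<theta>)"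
    by (simp add: C_def mult_ac)
  moreover have "G2 = Gamma (of_nat m / 2)"
    using Gamma_complex_of_real[of "real m / 2"] by (simp add: G2_def)
  moreover have "integrable \<mu> f"
    unfolding \<mu> f using c m' by (intro integrable_pow_prod_curv_meas) auto
  ultimately show ?thesis
    using g by (auto simp: M_def G1_def D_def A_def)
qed

end
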